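(* Every function $f\in\mathcal{CB}$ is criniferous. In particular, if $f\in\mathcal{CB}$, then every point $z\in I(f)$ can be connected to $\infty$ by a curve $\gamma$ such that $f^n|_{\gamma}\to\infty$ uniformly as $n\to\infty$.
   Context: For an entire function $f$: $F(f)$ and $J(f)$ are its Fatou and Julia sets, $I(f)=\{z\in\mathbb{C}: f^n(z)\to\infty \text{ as } n\to\infty\}$ is its escaping set, and $S(f)$ is the closure of the set of its finite critical and asymptotic values. The class $\mathcal{B}$ consists of all transcendental entire functions $f$ with $S(f)$ bounded. A function $f\in\mathcal{B}$ is of disjoint type if $F(f)$ is connected and $P(f)=\overline{\bigcup_{n\ge 0}f^n(S(f))}$ is a compact subset of $F(f)$. For $f\in\mathcal B$, the function $\lambda f$ is of disjoint type for all $\lambda\in\mathbb{C}\setminus\{0\}$ with $|\lambda|$ sufficiently small. Cantor bouquets. A set $B\subset[0,+\infty)\times(\mathbb{R}\setminus\mathbb{Q})$ is a straight brush if: (i) $B$ is a closed subset of $\mathbb{R}^2$; (ii) for each $(x,y)\in B$ there is $t_y\ge 0$ such that $\{x:(x,y)\in B\}=[t_y,+\infty)$ (the set $[t_y,+\infty)\times\{y\}$ is called the hair attached at $y$, and $(t_y,y)$ its endpoint); (iii) the set $\{y:(x,y)\in B\text{ for some }x\}$ is dense in $\mathbb{R}\setminus\mathbb{Q}$, and for every $(x,y)\in B$ there exist two sequences of hairs attached respectively at $\beta_n,\gamma_n\in\mathbb{R}\setminus\mathbb{Q}$ such that $\beta_n<y<\gamma_n$, $\beta_n,\gamma_n\to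 y$ and $t_{\beta_n},t_{\gamma_n}\to t_y$ as $n\to\infty$. A Cantor bouquet is a set $A\subset\mathbb{R}^2\cong\mathbb{C}$ for which there is a homeomorphism $\psi:\mathbb{R}^2\to\mathbb{R}^2$ such that $\psi(A)$ is a straight brush. The class $\mathcal{CB}$ consists of all $f\in\mathcal{B}$ such that $J(\lambda f)$ is a Cantor bouquet for some $\lambda\in\mathbb{C}\setminus\{0\}$ with $|\lambda|$ sufficiently small, i.e. small enough that $\lambda f$ is of disjoint type (equivalently, for all $\lambda$ for which $\lambda f$ is of disjoint type). An entire function $f$ is criniferous if for every $z\in I(f)$ and all sufficiently large $n$ there is an arc $\gamma_n$ connecting $f^n(z)$ to $\infty$, in such a way that $f$ maps $\gamma_n$ injectively onto $\gamma_{n+1}$ and $\min_{w\in\gamma_n}|w|\to\infty$ as $n\to\infty$. *)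

theory Defs
  imports "HOL-Complex_Analysis.Complex_Analysis" "HOL-Computational_Algebra.Polynomial"
begin

section \<open>Fatou, Julia and escaping sets\<close>

definition uniformly_to_infinity_on ::
    "complex set \<Rightarrow> (nat \<Rightarrow> complex \<Rightarrow> complex) \<Rightarrow> bool" where
  "uniformly_to_infinity_on K h \<longleftrightarrow>
     (\<forall>R::real. \<forall>\<^sub>F n in sequentially. \<forall>w\<in>K. cmod (h n w) > R)"

text \<open>
  Normality with respect to the spherical metric, for a family of holomorphic functions on a
  domain \<open>U\<close>.  Since \<open>U\<close> is connected, a locally uniform limit (in the sphere) is either a
  finite, automatically holomorphic function or identically \<open>\<infinity>\<close>.
\<close>

definition normal_family_on :: "complex set \<Rightarrow> (complex \<Rightarrow> complex) set \<Rightarrow> bool" where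
  "normal_family_on U \<F> \<longleftrightarrow>
     (\<forall>h :: nat \<Rightarrow> complex \<Rightarrow> complex. range h \<subseteq> \<F> \<longrightarrow>
        (\<exists>r :: nat \<Rightarrow> nat. strict_mono r \<and>
          ((\<exists>g. \<forall>K. compact K \<and> K \<subseteq> U \<longrightarrow> uniform_limit K (h \<circ> r) g sequentially) \<or>
           (\<forall>K. compact K \<and> K \<subseteq> U \<longrightarrow> uniformly_to_infinity_on K (h \<circ> r)))))"

definition Fatou_set :: "(complex \<Rightarrow> complex) \<Rightarrow> complex set" where
  "Fatou_set f =
     {z. \<exists>U. open U \<and> connected U \<and> z \<in> U \<and> normal_family_on U (range (\<lambda>n. f ^^ n))}"

definition Julia_set :: "(complex \<Rightarrow> complex) \<Rightarrow> complex set" where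
  "Julia_set f = - Fatou_set f"

definition escaping_set :: "(complex \<Rightarrow> complex) \<Rightarrow> complex set" where
  "escaping_set f = {z. filterlim (\<lambda>n. (f ^^ n) z) at_infinity sequentially}"


section \<open>Singular values, the Eremenko--Lyubich class, disjoint type\<close>

definition curve_to_infinity :: "(real \<Rightarrow> complex) \<Rightarrow> bool" where
  "curve_to_infinity g \<longleftrightarrow> continuous_on {0..} g \<and> filterlim g at_infinity at_top"

definition critical_values :: "(complex \<Rightarrow> complex) \<Rightarrow> complex set" where
  "critical_values f = f ` {z. deriv f z = 0}"

definition asymptotic_values :: "(complex \<Rightarrow> complex) \<Rightarrow> complex set" where
  "asymptotic_values f = {a. \<exists>g. curve_to_infinity g \<and> ((f \<circ> g) \<longlongrightarrow> a) at_top}"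

definition singular_set :: "(complex \<Rightarrow> complex) \<Rightarrow> complex set" where
  "singular_set f = closure (critical_values f \<union> asymptotic_values f)"

definition postsingular_set :: "(complex \<Rightarrow> complex) \<Rightarrow> complex set" where
  "postsingular_set f = closure (\<Union>n. (f ^^ n) ` singular_set f)"

definition transcendental_entire :: "(complex \<Rightarrow> complex) \<Rightarrow> bool" where
  "transcendental_entire f \<longleftrightarrow> f holomorphic_on UNIV \<and> \<not> (\<exists>p. f = poly p)"

definition class_B :: "(complex \<Rightarrow> complex) set" where
  "class_B = {f. transcendental_entire f \<and> bounded (singular_set f)}"

definition disjoint_type :: "(complex \<Rightarrow> complex) \<Rightarrow> bool" where
  "disjoint_type f \<longleftrightarrow>
     f \<in> class_B \<and> connected (Fatou_set f) \<and>
     compact (postsingular_set f) \<and> postsingular_set f \<subseteq> Fatou_set f"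


section \<open>Cantor bouquets\<close>

text \<open>In the following, \<open>t y\<close> is only meaningful for those \<open>y\<close> that carry a hair.\<close>

definition straight_brush :: "(real \<times> real) set \<Rightarrow> bool" where
  "straight_brush B \<longleftrightarrow>
     B \<subseteq> {0..} \<times> (- \<rat>) \<and>
     closed B \<and>
     (\<exists>t :: real \<Rightarrow> real.
        (\<forall>(x, y) \<in> B. t y \<ge> 0 \<and> {x'. (x', y) \<in> B} = {t y..}) \<and>
        - \<rat> \<subseteq> closure (snd ` B) \<and>
        (\<forall>(x, y) \<in> B. \<exists>\<beta> \<gamma> :: nat \<Rightarrow> real.
           (\<forall>n. \<beta> n \<in> snd ` B \<and> \<gamma> n \<in> snd ` B \<and> \<beta> n < y \<and> y < \<gamma> n) \<and>
           \<beta> \<longlonglongrightarrow> y \<and> \<gamma> \<longlonglongrightarrow> y \<and>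
           (\<lambda>n. t (\<beta> n)) \<longlonglongrightarrow> t y \<and> (\<lambda>n. t (\<gamma> n)) \<longlonglongrightarrow> t y))"

definition Cantor_bouquet :: "complex set \<Rightarrow> bool" where
  "Cantor_bouquet A \<longleftrightarrow>
     (\<exists>(\<psi> :: complex \<Rightarrow> real \<times> real) \<psi>'.
        homeomorphism UNIV UNIV \<psi> \<psi>' \<and> straight_brush (\<psi> ` A))"

text \<open>
  ``\<open>\<bar>\<lambda>\<bar>\<close> sufficiently small'' means small enough that \<open>\<lambda> f\<close> is of disjoint type.
\<close>

definition class_CB :: "(complex \<Rightarrow> complex) set" where
  "class_CB = {f \<in> class_B. \<exists>c. c \<noteq> 0 \<and> disjoint_type (\<lambda>z. c * f z) \<and>
                               Cantor_bouquet (Julia_set (\<lambda>z. c * f z))}"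


section \<open>Criniferous functions\<close>

text \<open>
  \<open>G\<close> is an arc in the plane (without its endpoint \<open>\<infinity>\<close>) connecting \<open>w\<close> to \<open>\<infinity>\<close>.
\<close>

definition arc_to_infinity_from :: "complex \<Rightarrow> complex set \<Rightarrow> bool" where
  "arc_to_infinity_from w G \<longleftrightarrow>
     (\<exists>g. curve_to_infinity g \<and> inj_on g {0..} \<and> g 0 = w \<and> G = g ` {0..})"

text \<open>The infimum below is a minimum, as arcs to \<open>\<infinity>\<close> are closed and nonempty.\<close>

definition criniferous :: "(complex \<Rightarrow> complex) \<Rightarrow> bool" where
  "criniferous f \<longleftrightarrow>
     f holomorphic_on UNIV \<and>
     (\<forall>z \<in> escaping_set f. \<exists>(\<gamma> :: nat \<Rightarrow> complex set) N.
        (\<forall>n\<ge>N. arc_to_infinity_from ((f ^^ n) z) (\<gamma> n) \<and>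
               bij_betw f (\<gamma> n) (\<gamma> (Suc n))) \<and>
        filterlim (\<lambda>n. INF w\<in>\<gamma> n. cmod w) at_top sequentially)"

end

theory Submission
  imports Defs
begin

text \<open>
  Let \<open>f \<in> class_CB\<close> and let \<open>g = c f\<close> be of disjoint type with \<open>Julia_set g\<close> a Cantor bouquet.

  For \<open>g\<close> the hairs of the bouquet do the work, and they do it for a crude geometric reason.
  A straight brush lies in \<open>{0..} \<times> \<real>\<close>, so if the tail \<open>{x..} \<times> {y}\<close> of a hair meets a compact set,
  its initial point \<open>(x, y)\<close> lies in a compact set too: \<open>x\<close> is squeezed between \<open>0\<close> and the bound.
  Transported to the plane, the tails that start at the points of an escaping orbit tend to infinity
  uniformly (\<open>tail_far\<close>).  Moreover \<open>g\<close> maps the tail at \<open>w\<close> bijectively onto the tail at \<open>g w\<close>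
  (\<open>tail_image\<close>).  Indeed the image stays in one hair, because the second coordinates of a brush are
  irrational; \<open>g\<close> is locally injective on the Julia set, which contains no critical values, and a
  locally injective map between rays is monotone; finally, if the image did not run all the way to
  infinity, its limit would be an asymptotic value in the Julia set.  So \<open>g\<close> is criniferous.

  It remains to compare \<open>f\<close> with \<open>g\<close> near infinity.  In logarithmic coordinates, a map of class
  \<open>\<B>\<close> has inverse branches \<open>\<Psi>\<close> on a right half-plane, \<open>f (exp (\<Psi> \<omega>)) = exp \<omega>\<close>, which contract by a
  factor \<open>1/2\<close> far to the right (\<open>inverse_branch_lipschitz\<close>).  If \<open>exp \<kappa> = c\<close>, the inverse branches of \<open>g\<close>
  are \<open>\<omega> \<mapsto> \<Psi> (\<omega> - \<kappa>)\<close>: a bounded perturbation.  Hence every orbit of \<open>f\<close> that stays near infinity is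
  shadowed by an orbit of \<open>g\<close>, and conversely, uniquely and continuously (\<open>shadowing\<close>,
  \<open>backward_orbits_coincide\<close>).  Starting with an escaping point of \<open>f\<close>, one shadows its orbit by an
  escaping orbit of \<open>g\<close>, takes the tails of hairs there, and shadows these tails back
  (\<open>class_CB_rays\<close>).  That escaping points of \<open>g\<close> lie in the Julia set follows from the same contraction
  (\<open>escaping_set_subset_Julia\<close>).

  For the second assertion, an arc from \<open>(f ^^ n) z\<close> to infinity is lifted through \<open>f\<close>, \<open>n\<close> times.
  A lift exists even when the arc passes through critical values; it may run to infinity before the
  whole arc is covered, but then it is already a curve with the required property
  (\<open>lift_of_arc_to_infinity\<close>).
\<close>

section \<open>Lifting through entire functions\<close>

lemma unique_lift:
  fixes F :: "complex \<Rightarrow> complex" and p q :: "'a::topological_space \<Rightarrow> complex"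
  assumes F: "F holomorphic_on UNIV" and X: "connected X"
    and p: "continuous_on X p" and q: "continuous_on X q"
    and eq: "\<And>x. x \<in> X \<Longrightarrow> F (p x) = F (q x)"
    and reg: "\<And>x. x \<in> X \<Longrightarrow> deriv F (p x) \<noteq> 0"
    and x0: "x0 \<in> X" "p x0 = q x0" and x: "x \<in> X"
  shows "p x = q x"
proof -
  define E where "E = {x\<in>X. p x = q x}"
  have "closedin (top_of_set X) E"
  proof -
    have "E = X \<inter> (\<lambda>x. p x - q x) -` {0}" by (auto simp: E_def)
    then show ?thesis
      using continuous_closedin_preimage[OF continuous_on_diff[OF p q] closed_singleton[of 0]] by metis
  qed
  moreover have "openin (top_of_set X) E"
  proof (subst openin_subopen, intro ballI)
    fix y assume y: "y \<in> E"
    then have yX: "y \<in> X" "p y = q y" by (auto simp: E_def)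
    obtain r where r: "r > 0" "inj_on F (ball (p y) r)"
      using has_complex_derivative_locally_injective[OF F _ open_UNIV reg[OF yX(1)]] by auto
    define T where "T = (X \<inter> p -` ball (p y) r) \<inter> (X \<inter> q -` ball (p y) r)"
    have "openin (top_of_set X) T"
      unfolding T_def using p q by (intro openin_Int continuous_openin_preimage_gen) auto
    moreover have "y \<in> T" using yX r by (auto simp: T_def)
    moreover have "T \<subseteq> E"
      using r eq by (auto simp: T_def E_def inj_on_def)
    ultimately show "\<exists>T. openin (top_of_set X) T \<and> y \<in> T \<and> T \<subseteq> E" by blast
  qed
  ultimately have "E = {} \<or> E = X"
    using X by (auto simp: connected_clopen)
  then show ?thesis using x0 x by (auto simp: E_def)
qed

lemma nonconstant_entire_open_map:
  assumes "f holomorphic_on UNIV" "\<not> f constant_on UNIV" "open U"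
  shows "open (f ` U)"
  using open_mapping_thm[OF assms(1) open_UNIV connected_UNIV assms(3) _ assms(2)] by auto

text \<open>
  If the lift does not tend to infinity, it accumulates at some point \<open>z\<close>.  Since \<open>f\<close> omits the value
  \<open>f z\<close> on small circles around \<open>z\<close>, the lift eventually cannot cross such a circle, and it is trapped.
\<close>

lemma limit_or_infinity:
  fixes f :: "complex \<Rightarrow> complex" and q :: "real \<Rightarrow> complex"
  assumes f: "f holomorphic_on UNIV" "\<not> f constant_on UNIV"
    and q: "continuous_on {0..<T} q" and T: "0 < T"
    and lim: "((\<lambda>t. f (q t)) \<longlongrightarrow> b) (at_left T)"
  shows "(\<exists>z. (q \<longlongrightarrow> z) (at_left T) \<and> f z = b) \<or> filterlim q at_infinity (at_left T)"
proof (cases "filterlim q at_infinity (at_left T)")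
  case False
  then obtain M where "\<not> (eventually (\<lambda>t. M \<le> norm (q t)) (at_left T))"
    by (auto simp: filterlim_at_infinity[of 0])
  then have freq: "frequently (\<lambda>t. norm (q t) < M) (at_left T)"
    by (auto simp: frequently_def not_less)
  have "\<exists>u. \<forall>n. T - 1 / real (Suc n) < u n \<and> u n < T \<and> norm (q (u n)) < M"
  proof -
    have "\<exists>u. T - 1 / real (Suc n) < u \<and> u < T \<and> norm (q u) < M" for n
    proof -
      have "eventually (\<lambda>t. t \<in> {T - 1 / real (Suc n)<..<T}) (at_left T)"
        by (rule eventually_at_left_real) auto
      from frequently_eventually_frequently[OF freq this] show ?thesis
        by (auto dest!: frequently_ex)
    qed
    then show ?thesis by metis
  qed
  then obtain u where u: "\<And>n. T - 1 / real (Suc n) < u n" "\<And>n. u n < T" "\<And>n. norm (q (u n)) < M"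
    by blast
  have "u \<longlonglongrightarrow> T"
  proof (rule tendsto_sandwich)
    show "(\<lambda>n. T - 1 / real (Suc n)) \<longlonglongrightarrow> T"
      using tendsto_diff[OF tendsto_const LIMSEQ_inverse_real_of_nat] by (simp add: inverse_eq_divide)
  qed (use u in \<open>auto intro!: always_eventually less_imp_le\<close>)
  then have uT: "filterlim u (at_left T) sequentially"
    using u by (auto simp: filterlim_at intro!: always_eventually) 
  have "compact (cball (0::complex) M)" by simp
  then obtain z r where r: "strict_mono r" "((q \<circ> u) \<circ> r) \<longlonglongrightarrow> z"
    unfolding compact_eq_seq_compact_metric seq_compact_def
    using u(3) by (metis comp_apply less_imp_le mem_cball_0)
  have uT': "filterlim (u \<circ> r) (at_left T) sequentially"
    using filterlim_compose[OF uT filterlim_subseq[OF r(1)]] by (simp add: o_def)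
  have "isCont f z" using f(1)
    using field_differentiable_imp_continuous_at holomorphic_on_imp_differentiable_at by blast
  then have "(\<lambda>n. f (q (u (r n)))) \<longlonglongrightarrow> f z"
    using isCont_tendsto_compose[OF _ r(2)] by (simp add: o_def)
  moreover have "(\<lambda>n. f (q (u (r n)))) \<longlonglongrightarrow> b"
    using filterlim_compose[OF lim uT'] by (simp add: o_def)
  ultimately have fz: "f z = b" using LIMSEQ_unique by blast
  have "(q \<longlongrightarrow> z) (at_left T)"
  proof (rule tendstoI)
    fix e :: real assume "e > 0"
    have nc: "\<exists>y. f y \<noteq> f z" using f(2) by (auto simp: constant_on_def)
    obtain d where d: "d > 0" "\<And>w. w \<in> ball z d - {z} \<Longrightarrow> f w \<noteq> f z"
    proof -
      obtain y where y: "f y - f z \<noteq> 0" using nc by auto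
      have "(\<lambda>w. f w - f z) holomorphic_on UNIV" using f by (intro holomorphic_intros)
      from isolated_zeros[OF this open_UNIV connected_UNIV _ _ _ y, of z] that show thesis
        by auto
    qed
    define s where "s = min (e/2) (d/2)"
    have s: "s > 0" "s < e" "s < d" using \<open>e>0\<close> d by (auto simp: s_def)
    have "continuous_on (sphere z s) (\<lambda>w. norm (f w - b))"
      using f(1) by (intro continuous_intros) (meson holomorphic_on_imp_continuous_on holomorphic_on_subset subset_UNIV)
    moreover have "sphere z s \<noteq> {}" using s by auto
    ultimately obtain w0 where w0: "w0 \<in> sphere z s" "\<And>w. w \<in> sphere z s \<Longrightarrow> norm (f w0 - b) \<le> norm (f w - b)"
      using continuous_attains_inf[of "sphere z s" "\<lambda>w. norm (f w - b)"] by auto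
    define \<delta> where "\<delta> = norm (f w0 - b)"
    have "w0 \<in> ball z d - {z}" using w0(1) s by auto
    then have \<delta>: "\<delta> > 0" using d(2) fz by (auto simp: \<delta>_def)
    have "eventually (\<lambda>t. dist (f (q t)) b < \<delta>) (at_left T)"
      using lim \<delta> by (auto dest: tendstoD)
    then obtain t0 where t0: "t0 < T" "\<And>t. t0 < t \<Longrightarrow> t < T \<Longrightarrow> dist (f (q t)) b < \<delta>"
      by (auto simp: eventually_at_left[of 0] eventually_at_left[OF T])
    define t1 where "t1 = max t0 0"
    have "eventually (\<lambda>t. t \<in> {t1<..<T}) (at_left T)"
      using t0 T by (intro eventually_at_left_real) (auto simp: t1_def)
    moreover have "eventually (\<lambda>n. dist ((q \<circ> u \<circ> r) n) z < s) sequentially"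
      using r(2) s(1) tendstoD by blast
    ultimately have "eventually (\<lambda>n. (u \<circ> r) n \<in> {t1<..<T} \<and> dist ((q \<circ> u \<circ> r) n) z < s) sequentially"
      using filterlim_iff[THEN iffD1, OF uT'] eventually_conj by blast
    then obtain t2 where t2: "t1 < t2" "t2 < T" "dist (q t2) z < s"
      by (auto simp: eventually_sequentially)
    have in_ball: "q t \<in> ball z s" if t: "t2 \<le> t" "t < T" for t
    proof (rule ccontr)
      assume nb: "q t \<notin> ball z s"
      have "continuous_on {t2..t} (\<lambda>x. dist z (q x))"
        using t t2 by (intro continuous_intros continuous_on_subset[OF q]) (auto simp: t1_def)
      then obtain x where x: "t2 \<le> x" "x \<le> t" "dist z (q x) = s"
        using IVT'[of "\<lambda>x. dist z (q x)" t2 s t] t2 t nb by (auto simp: dist_commute)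
      then have "dist (f (q x)) b < \<delta>" using t0(2)[of x] t t2 by (auto simp: t1_def)
      moreover have "\<delta> \<le> dist (f (q x)) b" using w0(2)[of "q x"] x by (auto simp: \<delta>_def dist_norm)
      ultimately show False by simp
    qed
    have "eventually (\<lambda>t. t \<in> {t2<..<T}) (at_left T)"
      using t2 by (intro eventually_at_left_real) auto
    then show "eventually (\<lambda>t. dist (q t) z < e) (at_left T)"
    proof eventually_elim
      case (elim t)
      then have "q t \<in> ball z s" using in_ball[of t] by simp
      then show ?case using s by (simp add: dist_commute)
    qed
  qed
  with fz show ?thesis by blast
qed auto

text \<open>
  The half-open intervals on which lifts live are reparametrised to \<open>{0..}\<close>, the parameter domain of
  a curve to infinity.
\<close>

definition stretch :: "real \<Rightarrow> real \<Rightarrow> real" where "stretch T s = T * (s / (1 + s))"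

lemma stretch:
  assumes "0 < T"
  shows "continuous_on {0..} (stretch T)" "inj_on (stretch T) {0..}" "stretch T ` {0..} = {0..<T}"
    "stretch T 0 = 0" "filterlim (stretch T) (at_left T) at_top"
proof -
  show "continuous_on {0..} (stretch T)" unfolding stretch_def by (intro continuous_intros) auto
  show "inj_on (stretch T) {0..}"
    using assms by (auto simp: stretch_def inj_on_def divide_simps algebra_simps)
  show "stretch T ` {0..} = {0..<T}"
  proof (intro equalityI subsetI)
    fix t assume t: "t \<in> {0..<T}"
    then have "t = stretch T (t / (T - t))" "t / (T - t) \<ge> 0"
      using assms by (auto simp: stretch_def divide_simps)
    then show "t \<in> stretch T ` {0..}" by auto
  qed (use assms in \<open>auto simp: stretch_def divide_simps\<close>)
  show "stretch T 0 = 0" by (simp add: stretch_def)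
  show "filterlim (stretch T) (at_left T) at_top"
    unfolding filterlim_at
  proof
    have "((\<lambda>s::real. s / (1 + s)) \<longlongrightarrow> 1) at_top" by real_asymp
    from tendsto_mult[OF tendsto_const this, of T]
    show "(stretch T \<longlongrightarrow> T) at_top" by (simp add: stretch_def[abs_def])
    show "eventually (\<lambda>x. stretch T x \<in> {..<T} \<and> stretch T x \<noteq> T) at_top"
      using eventually_ge_at_top[of 0] by eventually_elim (use assms in \<open>auto simp: stretch_def divide_simps\<close>)
  qed
qed

lemma curve_to_infinity_stretch:
  assumes "0 < T" "continuous_on {0..<T} q" "filterlim q at_infinity (at_left T)"
  shows "curve_to_infinity (q \<circ> stretch T)"
  unfolding curve_to_infinity_def
proof
  show "continuous_on {0..} (q \<circ> stretch T)"
    using assms stretch[OF assms(1)] by (intro continuous_on_compose) auto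
  show "filterlim (q \<circ> stretch T) at_infinity at_top"
    unfolding o_def by (rule filterlim_compose[OF assms(3) stretch(5)[OF assms(1)]])
qed

lemma asymptotic_valueI:
  fixes q :: "real \<Rightarrow> complex"
  assumes "0 < T" "continuous_on {0..<T} q" "filterlim q at_infinity (at_left T)"
    "((\<lambda>t. f (q t)) \<longlongrightarrow> b) (at_left T)"
  shows "b \<in> singular_set f"
proof -
  have "((f \<circ> (q \<circ> stretch T)) \<longlongrightarrow> b) at_top"
    unfolding o_def using filterlim_compose[OF assms(4) stretch(5)[OF assms(1)]] .
  then have "b \<in> asymptotic_values f"
    using curve_to_infinity_stretch[OF assms(1-3)] by (auto simp: asymptotic_values_def)
  then show ?thesis using closure_subset by (auto simp: singular_set_def)
qed

lemma regular_if_not_singular: "f z \<notin> singular_set f \<Longrightarrow> deriv f z \<noteq> 0"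
proof -
  have "critical_values f \<subseteq> singular_set f"
    unfolding singular_set_def by (meson closure_subset le_supE)
  then show "f z \<notin> singular_set f \<Longrightarrow> deriv f z \<noteq> 0"
    by (auto simp: critical_values_def)
qed

lemma local_inverse:
  assumes f: "f holomorphic_on UNIV" and d: "deriv f z \<noteq> 0"
  obtains V k r where "open V" "f z \<in> V" "k holomorphic_on V" "0 < r"
     "\<forall>y\<in>V. f (k y) = y" "\<forall>x\<in>ball z r. f x \<in> V \<and> k (f x) = x"
proof -
  obtain r where r: "r > 0" "open (f ` ball z r)" "inj_on f (ball z r)"
    using has_complex_derivative_locally_invertible[OF f _ open_UNIV d] by auto
  have "f holomorphic_on ball z r" using f holomorphic_on_subset by blast
  from holomorphic_has_inverse[OF this open_ball r(3)] obtain k where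
    k: "k holomorphic_on f ` ball z r" "\<And>x. x \<in> ball z r \<Longrightarrow> deriv f x * deriv k (f x) = 1"
    "\<And>x. x \<in> ball z r \<Longrightarrow> k (f x) = x" by blast
  show thesis by (rule that[OF r(2) _ k(1) r(1)]) (use k r in auto)
qed

text \<open>
  Away from the singular set there is nothing that can obstruct the continuation of an inverse of \<open>f\<close>:
  along a segment, a lift either converges, to a regular point of \<open>f\<close>, or exhibits an asymptotic value.
  Lifts on convex sets containing the base point \<open>\<omega>0\<close> agree where they are both defined, because the
  intersection is again convex; hence it suffices to reach every point of \<open>D\<close> by some such lift.
\<close>

lemma lift_through_entire_on_convex:
  fixes f h :: "complex \<Rightarrow> complex"
  assumes f: "f holomorphic_on UNIV" and nc: "\<not> f constant_on UNIV"
    and D: "open D" "convex D" and h: "h holomorphic_on D"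
    and reg: "\<And>x. x \<in> D \<Longrightarrow> h x \<notin> singular_set f"
    and \<omega>0: "\<omega>0 \<in> D" "f z0 = h \<omega>0"
  obtains \<Phi> where "\<Phi> holomorphic_on D" "\<Phi> \<omega>0 = z0" "\<And>x. x \<in> D \<Longrightarrow> f (\<Phi> x) = h x"
proof -
  define lifts where "lifts C \<Phi> \<longleftrightarrow> open C \<and> convex C \<and> \<omega>0 \<in> C \<and> C \<subseteq> D \<and> \<Phi> holomorphic_on C \<and>
     \<Phi> \<omega>0 = z0 \<and> (\<forall>x\<in>C. f (\<Phi> x) = h x)" for C \<Phi>
  define good where "good x \<longleftrightarrow> (\<exists>C \<Phi>. lifts C \<Phi> \<and> x \<in> C)" for x
  have uniq: "\<Phi>1 x = \<Phi>2 x" if 1: "lifts C1 \<Phi>1" "x \<in> C1" and 2: "lifts C2 \<Phi>2" "x \<in> C2" for C1 \<Phi>1 C2 \<Phi>2 x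
  proof (rule unique_lift[OF f, of "C1 \<inter> C2" \<Phi>1 \<Phi>2 \<omega>0])
    show "connected (C1 \<inter> C2)" using 1 2 by (auto simp: lifts_def intro!: convex_connected convex_Int)
    show "continuous_on (C1 \<inter> C2) \<Phi>1" "continuous_on (C1 \<inter> C2) \<Phi>2" using 1 2
      by (auto simp: lifts_def intro!: holomorphic_on_imp_continuous_on intro: holomorphic_on_subset)
    show "deriv f (\<Phi>1 y) \<noteq> 0" if "y \<in> C1 \<inter> C2" for y
      using that 1 reg[of y] by (intro regular_if_not_singular) (auto simp: lifts_def)
  qed (use 1 2 in \<open>auto simp: lifts_def\<close>)
  have goodI: "good x" if "lifts C \<Psi>" "x \<in> C" for C \<Psi> x
    using that unfolding good_def by blast
  define \<Phi> where "\<Phi> x = (SOME z. \<exists>C \<Phi>. lifts C \<Phi> \<and> x \<in> C \<and> z = \<Phi> x)" for x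
  have \<Phi>: "\<Phi> x = \<Phi>1 x" if "lifts C \<Phi>1" "x \<in> C" for C \<Phi>1 x
    unfolding \<Phi>_def by (rule some_equality) (use that uniq in blast)+
  have good0: "good \<omega>0"
  proof -
    have d: "deriv f z0 \<noteq> 0" using reg[OF \<omega>0(1)] \<omega>0(2) by (intro regular_if_not_singular) auto
    obtain V k r where k: "open V" "f z0 \<in> V" "k holomorphic_on V" "0 < r"
       "\<forall>y\<in>V. f (k y) = y" "\<forall>x\<in>ball z0 r. f x \<in> V \<and> k (f x) = x"
      using local_inverse[OF f d] by metis
    have "open (D \<inter> h -` V)"
      using continuous_open_preimage[OF holomorphic_on_imp_continuous_on[OF h] D(1) k(1)] .
    then obtain e where e: "e > 0" "ball \<omega>0 e \<subseteq> D \<inter> h -` V"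
      using \<omega>0 k(2) by (metis IntI open_contains_ball vimage_eq)
    have "lifts (ball \<omega>0 e) (k \<circ> h)"
      unfolding lifts_def
    proof (intro conjI ballI)
      show "(k \<circ> h) holomorphic_on ball \<omega>0 e"
        by (rule holomorphic_on_compose_gen[OF _ k(3)]) (use e h in \<open>auto intro: holomorphic_on_subset\<close>)
      show "(k \<circ> h) \<omega>0 = z0" using bspec[OF k(6), of z0] k(4) \<omega>0 by auto
    qed (use e k in auto)
    then show ?thesis using e unfolding good_def by (meson centre_in_ball)
  qed
  have good_seg: "good y" if "good x" "y \<in> closed_segment \<omega>0 x" for x y
  proof -
    obtain C \<Phi>1 where C: "lifts C \<Phi>1" "x \<in> C" using \<open>good x\<close> by (auto simp: good_def)
    then have "closed_segment \<omega>0 x \<subseteq> C" by (intro closed_segment_subset) (auto simp: lifts_def)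
    then show ?thesis using C that(2) by (auto simp: good_def)
  qed
  have all_good: "good w" if w: "w \<in> D" for w
  proof (rule ccontr)
    assume ng: "\<not> good w"
    define p where "p t = \<omega>0 + of_real t * (w - \<omega>0)" for t :: real
    have p_cont: "continuous_on A p" for A unfolding p_def by (intro continuous_intros)
    have pD: "p t \<in> D" if "0 \<le> t" "t \<le> 1" for t
    proof -
      have "p t = (1 - t) *\<^sub>R \<omega>0 + t *\<^sub>R w" by (simp add: p_def scaleR_conv_of_real algebra_simps)
      then show ?thesis using D(2) \<omega>0(1) w that by (simp add: convex_alt)
    qed
    have seg: "p s \<in> closed_segment \<omega>0 (p t)" if "0 \<le> s" "s \<le> t" for s t
    proof (cases "t = 0")
      case False
      have "p s = (1 - s/t) *\<^sub>R \<omega>0 + (s/t) *\<^sub>R p t"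
        using False by (simp add: p_def scaleR_conv_of_real algebra_simps of_real_diff of_real_divide)
      then show ?thesis using that False by (auto simp: closed_segment_def intro!: exI[of _ "s/t"])
    qed (use that in \<open>auto simp: p_def\<close>)
    define A where "A = {t\<in>{0..1}. good (p t)}"
    have A0: "0 \<in> A" using good0 by (simp add: A_def p_def)
    have Abdd: "bdd_above A" by (rule bdd_aboveI[of _ 1]) (auto simp: A_def)
    define T where "T = Sup A"
    have T01: "0 \<le> T" "T \<le> 1" using A0 Abdd
      by (auto simp: T_def intro!: cSup_upper cSup_least) (auto simp: A_def)
    have below: "good (p t)" if t: "0 \<le> t" "t < T" for t
    proof -
      obtain s where "s \<in> A" "t < s" 
        using t(2) A0 less_cSup_iff[of A t, OF _ Abdd] unfolding T_def by blast
      then show ?thesis using good_seg[of "p s" "p t"] seg[of t s] t by (auto simp: A_def)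
    qed
    have Tbad: "\<not> good (p T)"
    proof
      assume "good (p T)"
      then obtain C \<Phi>1 where C: "lifts C \<Phi>1" "p T \<in> C" by (auto simp: good_def)
      have "p 1 = w" by (simp add: p_def)
      then have "T < 1" using \<open>good (p T)\<close> ng T01 by (cases "T = 1") auto
      have "open (p -` C)" using C p_cont[of UNIV] by (auto simp: lifts_def intro: open_vimage)
      then obtain e where e: "e > 0" "ball T e \<subseteq> p -` C" using C(2)
        by (meson open_contains_ball vimage_eq)
      define s where "s = min 1 (T + e/2)"
      have "s \<in> ball T e" "s \<le> 1" "T < s" using \<open>T < 1\<close> e by (auto simp: s_def dist_real_def)
      then have "good (p s)" using e by (intro goodI[OF C(1)]) auto
      then have "s \<in> A" using T01 \<open>T < s\<close> \<open>s \<le> 1\<close> by (auto simp: A_def)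
      then have "s \<le> T" using Abdd by (auto simp: T_def intro: cSup_upper)
      then show False using \<open>T < s\<close> by simp
    qed
    have Tpos: "0 < T" using Tbad good0 T01 by (cases "T = 0") (auto simp: p_def)
    define q where "q t = \<Phi> (p t)" for t
    have fq: "f (q t) = h (p t)" if "0 \<le> t" "t < T" for t
      using below[OF that] \<Phi> by (auto simp: good_def q_def lifts_def)
    have q_cont: "continuous_on {0..<T} q"
    proof (rule continuous_at_imp_continuous_on, intro ballI)
      fix t assume t: "t \<in> {0..<T}"
      then obtain C \<Phi>1 where C: "lifts C \<Phi>1" "p t \<in> C"
        using below[of t] unfolding good_def by auto
      have "isCont (\<Phi>1 \<circ> p) t"
      proof (rule continuous_at_compose[of t p \<Phi>1])
        show "isCont p t" using p_cont[of UNIV] by (simp add: continuous_on_eq_continuous_at)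
        show "isCont \<Phi>1 (p t)" using C by (auto simp: lifts_def holomorphic_on_imp_continuous_on
             continuous_on_eq_continuous_at dest!: holomorphic_on_imp_continuous_on)
      qed
      moreover have "eventually (\<lambda>s. (\<Phi>1 \<circ> p) s = q s) (nhds t)"
      proof -
        have "open (p -` C)" using C p_cont[of UNIV] by (auto simp: lifts_def intro: open_vimage)
        then have "eventually (\<lambda>s. s \<in> p -` C) (nhds t)" using C(2) by (intro eventually_nhds_in_open) auto
        then show ?thesis by eventually_elim (use \<Phi> C in \<open>auto simp: q_def\<close>)
      qed
      ultimately show "isCont q t" using isCont_cong by blast
    qed
    have bD: "p T \<in> D" using pD T01 by auto
    have ht: "((\<lambda>t. h (p t)) \<longlongrightarrow> h (p T)) (at_left T)"
    proof -
      have "isCont h (p T)" using bD D h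
        by (auto simp: continuous_on_eq_continuous_at dest!: holomorphic_on_imp_continuous_on)
      moreover have "(p \<longlongrightarrow> p T) (at_left T)"
        using p_cont[of UNIV] by (simp add: continuous_on_def filterlim_at_split)
      ultimately show ?thesis by (rule isCont_tendsto_compose)
    qed
    have ev: "eventually (\<lambda>t. t \<in> {0<..<T}) (at_left T)"
      using Tpos by (intro eventually_at_left_real) auto
    have lim: "((\<lambda>t. f (q t)) \<longlongrightarrow> h (p T)) (at_left T)"
      by (rule Lim_transform_eventually[OF ht]) (use ev in eventually_elim, use fq in auto)
    have "\<not> filterlim q at_infinity (at_left T)"
      using asymptotic_valueI[OF Tpos q_cont _ lim] reg[OF bD] by blast
    then obtain z where z: "(q \<longlongrightarrow> z) (at_left T)" "f z = h (p T)"
      using limit_or_infinity[OF f nc q_cont Tpos lim] by blast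
    have dz: "deriv f z \<noteq> 0" using reg[OF bD] z(2) by (intro regular_if_not_singular) auto
    obtain V k r where k: "open V" "f z \<in> V" "k holomorphic_on V" "0 < r"
       "\<forall>y\<in>V. f (k y) = y" "\<forall>x\<in>ball z r. f x \<in> V \<and> k (f x) = x"
      using local_inverse[OF f dz] by metis
    have "open (D \<inter> h -` V)"
      using continuous_open_preimage[OF holomorphic_on_imp_continuous_on[OF h] D(1) k(1)] .
    then obtain e where e: "e > 0" "ball (p T) e \<subseteq> D \<inter> h -` V"
      using bD k(2) z(2) by (metis IntI open_contains_ball vimage_eq)
    have "eventually (\<lambda>t. dist (q t) z < r) (at_left T)" using z k(4) by (auto dest: tendstoD)
    moreover have "eventually (\<lambda>t. dist (p t) (p T) < e) (at_left T)"
      using p_cont[of UNIV] e(1) by (auto simp: continuous_on_def filterlim_at_split dest: tendstoD)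
    ultimately have "eventually (\<lambda>t. t \<in> {0<..<T} \<and> dist (q t) z < r \<and> dist (p t) (p T) < e) (at_left T)"
      using ev by eventually_elim auto
    then obtain t where t: "0 < t" "t < T" "dist (q t) z < r" "dist (p t) (p T) < e"
      by (metis (mono_tags, lifting) eventually_happens' greaterThanLessThan_iff trivial_limit_at_left_real)
    obtain C1 \<Phi>1 where C1: "lifts C1 \<Phi>1" "p t \<in> C1" using below[of t] t by (auto simp: good_def)
    define W where "W = ball (p T) e"
    have agree: "\<Phi>1 x = (k \<circ> h) x" if "x \<in> C1 \<inter> W" for x
    proof (rule unique_lift[OF f, of "C1 \<inter> W" \<Phi>1 "k \<circ> h" "p t"])
      show "connected (C1 \<inter> W)" using C1 by (auto simp: lifts_def W_def intro!: convex_connected convex_Int)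
      show "continuous_on (C1 \<inter> W) \<Phi>1" using C1
        by (auto simp: lifts_def intro!: holomorphic_on_imp_continuous_on intro: holomorphic_on_subset)
      show "continuous_on (C1 \<inter> W) (k \<circ> h)"
        using e by (intro holomorphic_on_imp_continuous_on holomorphic_on_compose_gen[OF _ k(3)]
           holomorphic_on_subset[OF h]) (auto simp: W_def)
      show "f (\<Phi>1 y) = f ((k \<circ> h) y)" if "y \<in> C1 \<inter> W" for y
      proof -
        have "h y \<in> V" using that e by (auto simp: W_def)
        then show ?thesis using that C1 k(5) by (auto simp: lifts_def)
      qed
      show "deriv f (\<Phi>1 y) \<noteq> 0" if "y \<in> C1 \<inter> W" for y
        using that C1 reg[of y] by (intro regular_if_not_singular) (auto simp: lifts_def)
      show "p t \<in> C1 \<inter> W" using C1 t by (auto simp: W_def dist_commute)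
      have "\<Phi>1 (p t) = q t" using \<Phi>[OF C1] by (simp add: q_def)
      also have "\<dots> = k (f (q t))" using bspec[OF k(6), of "q t"] t(3) by (auto simp: dist_commute)
      also have "\<dots> = (k \<circ> h) (p t)" using fq[of t] t by simp
      finally show "\<Phi>1 (p t) = (k \<circ> h) (p t)" .
    qed (use that in auto)
    \<comment> \<open>The lifts on \<open>C1\<close> and \<open>W\<close> cover the segment up to \<open>p T\<close>.  The union \<open>C1 \<union> W\<close> need not be convex,
      but a thin tube around the segment is, being a sum of two convex sets.\<close>
    define S where "S = closed_segment \<omega>0 (p T)"
    have "S \<subseteq> C1 \<union> W"
    proof
      fix x assume "x \<in> S"
      then obtain v where v: "0 \<le> v" "v \<le> 1" "x = (1 - v) *\<^sub>R \<omega>0 + v *\<^sub>R p T"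
        by (auto simp: S_def closed_segment_def)
      then have x: "x = p (v * T)" by (simp add: p_def scaleR_conv_of_real algebra_simps)
      show "x \<in> C1 \<union> W"
      proof (cases "v * T \<le> t")
        case True
        then have "x \<in> closed_segment \<omega>0 (p t)" using seg[of "v * T" t] x v T01 by auto
        then show ?thesis using C1 closed_segment_subset[of \<omega>0 C1 "p t"] by (auto simp: lifts_def)
      next
        case False
        have "v * T \<le> T" using v T01 by (simp add: mult_left_le_one_le)
        have "dist (p (v * T)) (p T) = \<bar>v * T - T\<bar> * cmod (w - \<omega>0)"
          by (simp add: dist_norm p_def left_diff_distrib[symmetric] norm_mult flip: of_real_mult of_real_diff)
        also have "\<dots> \<le> \<bar>t - T\<bar> * cmod (w - \<omega>0)"
          using False \<open>v * T \<le> T\<close> t by (intro mult_right_mono) auto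
        also have "\<dots> = dist (p t) (p T)"
          by (simp add: dist_norm p_def left_diff_distrib[symmetric] norm_mult flip: of_real_mult of_real_diff)
        finally show ?thesis using x t(4) by (auto simp: W_def dist_commute)
      qed
    qed
    moreover have "open (C1 \<union> W)" using C1 by (auto simp: lifts_def W_def)
    moreover have "compact S" by (simp add: S_def)
    ultimately obtain \<eta> where \<eta>: "\<eta> > 0" "(\<Union>x\<in>S. ball x \<eta>) \<subseteq> C1 \<union> W"
      using compact_subset_open_imp_ball_epsilon_subset by metis
    define C where "C = (\<Union>x\<in>S. \<Union>y\<in>ball 0 \<eta>. {x + y})"
    have C_eq: "C = (\<Union>x\<in>S. ball x \<eta>)"
    proof -
      have "(\<Union>y\<in>ball 0 \<eta>. {x + y}) = ball x \<eta>" for x :: complex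
      proof -
        have "(\<Union>y\<in>ball 0 \<eta>. {x + y}) = (+) x ` ball 0 \<eta>" by blast
        also have "\<dots> = ball x \<eta>" using ball_translation[of x 0 \<eta>] by simp
        finally show ?thesis .
      qed
      then show ?thesis by (simp add: C_def)
    qed
    have ends: "\<omega>0 \<in> S" "p T \<in> S" by (auto simp: S_def)
    have "lifts C (\<lambda>x. if x \<in> C1 then \<Phi>1 x else (k \<circ> h) x)"
      unfolding lifts_def
    proof (intro conjI ballI)
      show "open C" by (auto simp: C_eq)
      show "convex C" unfolding C_def by (intro convex_sums) (auto simp: S_def)
      show "\<omega>0 \<in> C" using ends \<eta> by (auto simp: C_eq intro!: bexI[of _ \<omega>0])
      show "C \<subseteq> D" using \<eta> C1 e by (auto simp: C_eq lifts_def W_def)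
      have "(\<lambda>x. if x \<in> C1 then \<Phi>1 x else (k \<circ> h) x) holomorphic_on (C1 \<union> W)"
      proof (rule holomorphic_on_If_Un)
        show "k \<circ> h holomorphic_on W"
          using e by (intro holomorphic_on_compose_gen[OF _ k(3)] holomorphic_on_subset[OF h]) (auto simp: W_def)
      qed (use C1 agree in \<open>auto simp: lifts_def W_def\<close>)
      then show "(\<lambda>x. if x \<in> C1 then \<Phi>1 x else (k \<circ> h) x) holomorphic_on C"
        using \<eta>(2) by (auto simp: C_eq intro: holomorphic_on_subset)
      show "(if \<omega>0 \<in> C1 then \<Phi>1 \<omega>0 else (k \<circ> h) \<omega>0) = z0" using C1 by (auto simp: lifts_def)
      fix x assume "x \<in> C"
      then have "x \<in> C1 \<or> x \<in> W" using \<eta>(2) unfolding C_eq by blast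
      then show "f (if x \<in> C1 then \<Phi>1 x else (k \<circ> h) x) = h x"
        using C1 e k(5) by (auto simp: lifts_def W_def)
    qed
    then have "good (p T)"
      by (rule goodI) (use ends \<eta> in \<open>auto simp: C_eq intro!: bexI[of _ "p T"]\<close>)
    with Tbad show False by blast
  qed
  show thesis
  proof
    show "\<Phi> holomorphic_on D"
    proof (subst holomorphic_on_open[OF D(1)], intro ballI allI impI)
      fix x assume "x \<in> D"
      then obtain C \<Phi>1 where C: "lifts C \<Phi>1" "x \<in> C"
        using all_good[OF \<open>x \<in> D\<close>] unfolding good_def by blast
      then have "(\<Phi>1 has_field_derivative deriv \<Phi>1 x) (at x)"
        by (auto simp: lifts_def intro: holomorphic_derivI)
      then have "(\<Phi> has_field_derivative deriv \<Phi>1 x) (at x)"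
        by (rule has_field_derivative_transform_within_open[of _ _ _ C]) (use C \<Phi> in \<open>auto simp: lifts_def\<close>)
      then show "\<exists>f'. (\<Phi> has_field_derivative f') (at x)" by blast
    qed
    show "\<Phi> \<omega>0 = z0"
    proof -
      obtain C \<Phi>1 where C: "lifts C \<Phi>1" "\<omega>0 \<in> C" using good0 unfolding good_def by blast
      then show ?thesis using \<Phi>[OF C] by (simp add: lifts_def)
    qed
    show "f (\<Phi> x) = h x" if x: "x \<in> D" for x
    proof -
      obtain C \<Phi>1 where C: "lifts C \<Phi>1" "x \<in> C" using all_good[OF x] unfolding good_def by blast
      then show ?thesis using \<Phi>[OF C] by (simp add: lifts_def)
    qed
  qed
qed

section \<open>Inverse branches in logarithmic coordinates\<close>

text \<open>
  Outside the disc of radius \<open>exp \<rho>\<close> there are no singular values.  That \<open>f 0\<close> lies in this disc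
  keeps the preimages of its complement away from \<open>0\<close>, so that they have logarithms.
\<close>

definition tame_beyond :: "(complex \<Rightarrow> complex) \<Rightarrow> real \<Rightarrow> bool" where
  "tame_beyond f \<rho> \<longleftrightarrow> transcendental_entire f \<and> (\<forall>w\<in>singular_set f. cmod w \<le> exp \<rho>) \<and> cmod (f 0) \<le> exp \<rho>"

lemma class_B_tame_beyond:
  assumes "f \<in> class_B"
  shows "\<exists>\<rho>. tame_beyond f \<rho>"
proof -
  obtain K where K: "\<forall>w\<in>singular_set f. cmod w \<le> K"
    using assms by (auto simp: class_B_def bounded_iff)
  define M where "M = max 1 (max K (cmod (f 0)))"
  have "M > 0" "K \<le> M" "cmod (f 0) \<le> M" by (auto simp: M_def)
  then have "tame_beyond f (ln M)"
    using assms K by (force simp: tame_beyond_def class_B_def)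
  then show ?thesis ..
qed

lemma transcendental_entire_nonconstant:
  assumes "transcendental_entire f"
  shows "\<not> f constant_on UNIV"
proof
  assume "f constant_on UNIV"
  then obtain c where "\<And>z. f z = c" by (auto simp: constant_on_def)
  then have "f = poly [:c:]" by auto
  then show False using assms by (auto simp: transcendental_entire_def)
qed

lemma transcendental_entire_not_to_infinity:
  assumes "transcendental_entire f"
  shows "\<not> filterlim f at_infinity at_infinity"
proof
  assume "filterlim f at_infinity at_infinity"
  then have "((inverse \<circ> f) \<longlongrightarrow> 0) at_infinity"
    unfolding o_def by (rule filterlim_compose[OF tendsto_inverse_0])
  then obtain a n where a: "\<And>z. f z = (\<Sum>i\<le>n. a i * z^i)"
    using pole_at_infinity[of f 0] assms unfolding transcendental_entire_def by metis
  have "f = poly (\<Sum>i\<le>n. monom (a i) i)"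
    by (rule ext) (simp add: a poly_sum poly_monom)
  then show False using assms by (auto simp: transcendental_entire_def)
qed

text \<open>
  This is how polynomials are recognised: a lift of \<open>exp\<close> through \<open>f\<close> with a period \<open>p \<i>\<close> is a finite
  covering of a neighbourhood of infinity in disguise.  The image \<open>V \<sigma>\<close> of the half-plane to the right
  of \<open>\<sigma>\<close> is open and unbounded, and by periodicity its boundary lies in the compact image of a period
  segment; so \<open>V \<sigma>\<close> contains a neighbourhood of infinity, where \<open>\<bar>f\<bar>\<close> exceeds \<open>exp \<sigma>\<close>.
\<close>

lemma periodic_exp_lift_imp_pole:
  assumes f: "f holomorphic_on UNIV" and p: "p > 0"
    and \<Phi>: "\<Phi> holomorphic_on {\<omega>. \<rho> < Re \<omega>}"
    and lift: "\<And>\<omega>. \<rho> < Re \<omega> \<Longrightarrow> f (\<Phi> \<omega>) = exp \<omega>"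
    and per: "\<And>\<omega>. \<rho> < Re \<omega> \<Longrightarrow> \<Phi> (\<omega> + of_real p * \<i>) = \<Phi> \<omega>"
  shows "filterlim f at_infinity at_infinity"
proof -
  have cont_f: "continuous_on S f" for S
    using f holomorphic_on_imp_continuous_on holomorphic_on_subset by blast
  have cont_\<Phi>: "continuous_on {\<omega>. \<rho> < Re \<omega>} \<Phi>"
    using \<Phi> holomorphic_on_imp_continuous_on by blast
  have pern: "\<Phi> (\<omega> + of_nat k * (of_real p * \<i>)) = \<Phi> \<omega>" if "\<rho> < Re \<omega>" for k \<omega>
  proof (induction k)
    case (Suc k)
    have "\<Phi> (\<omega> + of_nat (Suc k) * (of_real p * \<i>)) = \<Phi> ((\<omega> + of_nat k * (of_real p * \<i>)) + of_real p * \<i>)"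
      by (simp add: algebra_simps)
    also have "\<dots> = \<Phi> (\<omega> + of_nat k * (of_real p * \<i>))" using that by (intro per) auto
    finally show ?case using Suc by simp
  qed auto
  have reduce: "\<exists>\<omega>'. Re \<omega>' = Re \<omega> \<and> 0 \<le> Im \<omega>' \<and> Im \<omega>' \<le> p \<and> \<Phi> \<omega>' = \<Phi> \<omega>" if \<omega>: "\<rho> < Re \<omega>" for \<omega>
  proof -
    define k where "k = \<lfloor>Im \<omega> / p\<rfloor>"
    define \<omega>' where "\<omega>' = \<omega> - of_int k * (of_real p * \<i>)"
    have "of_int k \<le> Im \<omega> / p" "Im \<omega> / p \<le> of_int k + 1" unfolding k_def by linarith+
    then have "of_int k * p \<le> Im \<omega>" "Im \<omega> \<le> (of_int k + 1) * p"
      using p by (simp_all add: pos_le_divide_eq pos_divide_le_eq)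
    then have im: "0 \<le> Im \<omega>'" "Im \<omega>' \<le> p" "Re \<omega>' = Re \<omega>" by (auto simp: \<omega>'_def algebra_simps)
    have "\<Phi> \<omega>' = \<Phi> \<omega>"
    proof (cases "k \<ge> 0")
      case True
      then show ?thesis using pern[of \<omega>' "nat k"] \<omega> im by (simp add: \<omega>'_def of_nat_nat)
    next
      case False
      then have "\<omega>' = \<omega> + of_nat (nat (-k)) * (of_real p * \<i>)" by (simp add: \<omega>'_def of_nat_nat)
      then show ?thesis using pern[of \<omega> "nat (-k)"] \<omega> by simp
    qed
    then show ?thesis using im by blast
  qed
  have H_sub: "{\<omega>. \<sigma> < Re \<omega>} \<subseteq> {\<omega>. \<rho> < Re \<omega>}" if "\<rho> < \<sigma>" for \<sigma> using that by auto
  define V where "V \<sigma> = \<Phi> ` {\<omega>. \<sigma> < Re \<omega>}" for \<sigma>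
  have nc: "\<not> \<Phi> constant_on {\<omega>. \<rho> < Re \<omega>}"
  proof
    assume "\<Phi> constant_on {\<omega>. \<rho> < Re \<omega>}"
    then obtain c where "\<And>\<omega>. \<rho> < Re \<omega> \<Longrightarrow> \<Phi> \<omega> = c" by (auto simp: constant_on_def)
    then have "exp (of_real (\<rho>+1)) = exp (of_real (\<rho>+2) :: complex)"
      using lift[of "of_real (\<rho>+1)"] lift[of "of_real (\<rho>+2)"] by simp
    then have "cmod (exp (of_real (\<rho>+1))) = cmod (exp (of_real (\<rho>+2) :: complex))" by simp
    then show False by (simp del: of_real_add)
  qed
  have openV: "open (V \<sigma>)" if "\<rho> < \<sigma>" for \<sigma>
    unfolding V_def using nc \<Phi> H_sub[OF that]
    by (intro open_mapping_thm[OF \<Phi>]) (auto simp: open_halfspace_Re_gt convex_halfspace_Re_gt convex_connected)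
  have frontV: "frontier (V \<sigma>) \<subseteq> \<Phi> ` cbox (Complex \<sigma> 0) (Complex \<sigma> p)" if \<sigma>: "\<rho> < \<sigma>" for \<sigma>
  proof
    fix z assume z: "z \<in> frontier (V \<sigma>)"
    then have zc: "z \<in> closure (V \<sigma>)" and znot: "z \<notin> V \<sigma>"
      using openV[OF \<sigma>] by (auto simp: frontier_def interior_open)
    define B where "B = ln (cmod (f z) + 1)"
    have B: "exp B = cmod (f z) + 1" by (simp add: B_def add_nonneg_pos)
    define U where "U = {w. cmod (f w) < exp B}"
    have "open U" unfolding U_def using cont_f[of UNIV] by (intro open_Collect_less continuous_intros) auto
    moreover have "z \<in> U" by (simp add: U_def B)
    ultimately have "z \<in> closure (U \<inter> V \<sigma>)" using zc open_Int_closure_subset by blast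
    moreover have "U \<inter> V \<sigma> \<subseteq> \<Phi> ` cbox (Complex \<sigma> 0) (Complex B p)"
    proof
      fix v assume v: "v \<in> U \<inter> V \<sigma>"
      then obtain \<omega> where \<omega>: "\<sigma> < Re \<omega>" "v = \<Phi> \<omega>" by (auto simp: V_def)
      obtain \<omega>' where \<omega>': "Re \<omega>' = Re \<omega>" "0 \<le> Im \<omega>'" "Im \<omega>' \<le> p" "\<Phi> \<omega>' = \<Phi> \<omega>"
        using reduce[of \<omega>] \<omega> \<sigma> by auto
      have "exp (Re \<omega>) < exp B" using v lift[of \<omega>] \<omega> \<sigma> by (auto simp: U_def)
      then have "\<omega>' \<in> cbox (Complex \<sigma> 0) (Complex B p)" using \<omega> \<omega>' by (auto simp: in_cbox_complex_iff)
      then show "v \<in> \<Phi> ` cbox (Complex \<sigma> 0) (Complex B p)" using \<omega> \<omega>' by (metis imageI)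
    qed
    moreover have "closed (\<Phi> ` cbox (Complex \<sigma> 0) (Complex B p))"
      using \<sigma> by (intro compact_imp_closed compact_continuous_image continuous_on_subset[OF cont_\<Phi>] compact_cbox)
         (auto simp: in_cbox_complex_iff)
    ultimately have "z \<in> \<Phi> ` cbox (Complex \<sigma> 0) (Complex B p)" by (meson closure_minimal subsetD)
    then obtain \<omega> where \<omega>: "\<omega> \<in> cbox (Complex \<sigma> 0) (Complex B p)" "z = \<Phi> \<omega>" by blast
    moreover have "\<not> \<sigma> < Re \<omega>" using znot \<omega> by (auto simp: V_def)
    ultimately show "z \<in> \<Phi> ` cbox (Complex \<sigma> 0) (Complex \<sigma> p)" by (auto simp: in_cbox_complex_iff)
  qed
  show ?thesis
    unfolding filterlim_at_infinity[OF order_refl]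
  proof (intro allI impI)
    fix B :: real assume "0 < B"
    define \<sigma> where "\<sigma> = max (\<rho> + 1) (ln B)"
    have \<sigma>: "\<rho> < \<sigma>" by (simp add: \<sigma>_def)
    have "B = exp (ln B)" using \<open>0 < B\<close> by simp
    also have "\<dots> \<le> exp \<sigma>" unfolding exp_le_cancel_iff by (simp add: \<sigma>_def)
    finally have B: "B \<le> exp \<sigma>" .
    have "compact (\<Phi> ` cbox (Complex \<sigma> 0) (Complex \<sigma> p))"
      using \<sigma> by (intro compact_continuous_image continuous_on_subset[OF cont_\<Phi>] compact_cbox)
         (auto simp: in_cbox_complex_iff)
    then obtain M where M: "\<And>v. v \<in> \<Phi> ` cbox (Complex \<sigma> 0) (Complex \<sigma> p) \<Longrightarrow> cmod v \<le> M"
      using compact_imp_bounded bounded_iff by metis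
    have "compact (f ` cball 0 M)" by (intro compact_continuous_image cont_f compact_cball)
    then obtain C where C: "\<And>v. v \<in> f ` cball 0 M \<Longrightarrow> cmod v \<le> C"
      using compact_imp_bounded bounded_iff by metis
    define a where "a = max (\<sigma> + 1) (ln (max 1 C + 1))"
    have "max 1 C + 1 = exp (ln (max 1 C + 1))" by simp
    also have "\<dots> \<le> exp a" unfolding exp_le_cancel_iff by (simp add: a_def)
    finally have a: "C < exp a" "\<sigma> < a" by (auto simp: a_def)
    have aV: "\<Phi> (of_real a) \<in> V \<sigma>" using a by (auto simp: V_def)
    have "cmod (f (\<Phi> (of_real a))) = exp a" using lift[of "of_real a"] a \<sigma> by (simp add: norm_exp_eq_Re)
    then have "\<Phi> (of_real a) \<notin> cball 0 M" using C[of "f (\<Phi> (of_real a))"] a by auto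
    then have ne: "- cball 0 M \<inter> V \<sigma> \<noteq> {}" using aV by blast
    have "- cball 0 M \<inter> frontier (V \<sigma>) = {}" using frontV[OF \<sigma>] M by (fastforce simp: dist_norm)
    moreover have "connected (- cball (0::complex) M)"
      by (intro connected_complement_bounded_convex) auto
    ultimately have "- cball 0 M \<subseteq> V \<sigma>" using connected_Int_frontier ne by blast
    then have "B \<le> cmod (f z)" if "M < cmod z" for z
    proof -
      have "z \<in> V \<sigma>" using that \<open>- cball 0 M \<subseteq> V \<sigma>\<close> by auto
      then obtain \<omega> where \<omega>: "\<sigma> < Re \<omega>" "z = \<Phi> \<omega>" by (auto simp: V_def)
      then have "cmod (f z) = exp (Re \<omega>)" using lift[of \<omega>] \<sigma> by (simp add: norm_exp_eq_Re)
      moreover have "exp \<sigma> < exp (Re \<omega>)" using \<omega> by simp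
      ultimately show ?thesis using B by linarith
    qed
    then show "\<forall>\<^sub>F x in at_infinity. B \<le> cmod (f x)"
      unfolding eventually_at_infinity by (intro exI[of _ "M+1"]) auto
  qed
qed

text \<open>
  Two points with the same image differ by a multiple of \<open>2 pi \<i>\<close>; by uniqueness of lifts this
  multiple would be a period, and \<open>f\<close> would be a polynomial.
\<close>

lemma exp_lift_injective:
  assumes f: "tame_beyond f \<rho>"
    and \<Phi>: "\<Phi> holomorphic_on {\<omega>. \<rho> < Re \<omega>}"
    and lift: "\<And>\<omega>. \<rho> < Re \<omega> \<Longrightarrow> f (\<Phi> \<omega>) = exp \<omega>"
  shows "inj_on \<Phi> {\<omega>. \<rho> < Re \<omega>}"
proof -
  have fh: "f holomorphic_on UNIV" and tr: "transcendental_entire f"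
    using f by (auto simp: tame_beyond_def transcendental_entire_def)
  have key: False if p: "p > 0" "exp (of_real p * \<i>) = (1::complex)" and \<omega>0: "\<rho> < Re \<omega>0" "\<Phi> (\<omega>0 + of_real p * \<i>) = \<Phi> \<omega>0" for p \<omega>0
  proof -
    have "\<Phi> \<omega> = \<Phi> (\<omega> + of_real p * \<i>)" if \<omega>: "\<rho> < Re \<omega>" for \<omega>
    proof (rule unique_lift[OF fh, of "{\<omega>. \<rho> < Re \<omega>}" \<Phi> "\<lambda>\<omega>. \<Phi> (\<omega> + of_real p * \<i>)" \<omega>0])
      show "connected {\<omega>. \<rho> < Re \<omega>}" by (simp add: convex_connected convex_halfspace_Re_gt)
      show "continuous_on {\<omega>. \<rho> < Re \<omega>} \<Phi>" using \<Phi> holomorphic_on_imp_continuous_on by blast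
      then show "continuous_on {\<omega>. \<rho> < Re \<omega>} (\<lambda>\<omega>. \<Phi> (\<omega> + of_real p * \<i>))"
        by (rule continuous_on_compose2) (auto intro!: continuous_intros)
      fix x assume x: "x \<in> {\<omega>. \<rho> < Re \<omega>}"
      then show "f (\<Phi> x) = f (\<Phi> (x + of_real p * \<i>))"
        using lift[of x] lift[of "x + of_real p * \<i>"] p by (simp add: exp_add)
      have "exp \<rho> < cmod (f (\<Phi> x))" using x lift[of x] by (simp add: norm_exp_eq_Re)
      then show "deriv f (\<Phi> x) \<noteq> 0" using f
        by (intro regular_if_not_singular) (auto simp: tame_beyond_def)
    qed (use \<omega> \<omega>0 in auto)
    note per = this
    have "filterlim f at_infinity at_infinity"
      by (rule periodic_exp_lift_imp_pole[OF fh p(1) \<Phi> lift per[symmetric]])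
    then show False using transcendental_entire_not_to_infinity[OF tr] by blast
  qed
  show ?thesis
  proof (rule inj_onI)
    fix x y assume xy: "x \<in> {\<omega>. \<rho> < Re \<omega>}" "y \<in> {\<omega>. \<rho> < Re \<omega>}" "\<Phi> x = \<Phi> y"
    then have "exp x = exp y" using lift[of x] lift[of y] by simp
    then obtain n :: int where n: "x = y + (of_int (2 * n) * pi) * \<i>" by (auto simp: exp_eq)
    define p where "p = 2 * of_int \<bar>n\<bar> * pi"
    have ep: "exp (of_real p * \<i>) = (1::complex)"
      using exp_integer_2pi[of "of_int \<bar>n\<bar>"] by (simp add: p_def mult_ac)
    consider "n = 0" | "n > 0" | "n < 0" by linarith
    then show "x = y"
    proof cases
      case 2
      then have "x = y + of_real p * \<i>" "p > 0" using n by (auto simp: p_def)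
      then show ?thesis using key[OF _ ep, of y] xy by simp
    next
      case 3
      then have "y = x + of_real p * \<i>" "p > 0" using n by (auto simp: p_def mult_less_0_iff)
      then show ?thesis using key[OF _ ep, of x] xy by simp
    qed (use n in simp)
  qed
qed

text \<open>
  These are the inverse branches of the logarithmic transform of \<open>f\<close>, each of which maps the
  half-plane into one logarithmic tract.
\<close>

definition inverse_branch :: "(complex \<Rightarrow> complex) \<Rightarrow> real \<Rightarrow> (complex \<Rightarrow> complex) \<Rightarrow> bool" where
  "inverse_branch f \<rho> \<Psi> \<longleftrightarrow> \<Psi> holomorphic_on {\<omega>. \<rho> < Re \<omega>} \<and> (\<forall>\<omega>. \<rho> < Re \<omega> \<longrightarrow> f (exp (\<Psi> \<omega>)) = exp \<omega>)"

lemma inverse_branch_exists: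
  assumes f: "tame_beyond f \<rho>" and eq: "f (exp \<zeta>) = exp \<omega>" and \<omega>: "\<rho> < Re \<omega>"
  shows "\<exists>\<Psi>. inverse_branch f \<rho> \<Psi> \<and> \<Psi> \<omega> = \<zeta>"
proof -
  let ?H = "{\<omega>. \<rho> < Re \<omega>}"
  have fh: "f holomorphic_on UNIV" "\<not> f constant_on UNIV"
    using f transcendental_entire_nonconstant by (auto simp: tame_beyond_def transcendental_entire_def)
  have H: "open ?H" "convex ?H" by (auto simp: open_halfspace_Re_gt convex_halfspace_Re_gt)
  have reg: "exp x \<notin> singular_set f" if "x \<in> ?H" for x
  proof -
    have "exp \<rho> < cmod (exp x)" using that by (simp add: norm_exp_eq_Re)
    then show ?thesis using f by (auto simp: tame_beyond_def)
  qed
  obtain \<Phi> where \<Phi>: "\<Phi> holomorphic_on ?H" "\<Phi> \<omega> = exp \<zeta>" "\<And>x. x \<in> ?H \<Longrightarrow> f (\<Phi> x) = exp x"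
    using lift_through_entire_on_convex[OF fh H holomorphic_on_exp reg _ eq] \<omega> by auto
  have "\<Phi> x \<noteq> 0" if "x \<in> ?H" for x
  proof
    assume "\<Phi> x = 0"
    then have "cmod (f 0) = exp (Re x)" using \<Phi>(3)[OF that] by (simp add: norm_exp_eq_Re)
    then show False using f that by (auto simp: tame_beyond_def)
  qed
  then obtain L where L: "L holomorphic_on ?H" "\<And>x. x \<in> ?H \<Longrightarrow> exp (L x) = \<Phi> x"
    using holomorphic_logarithm_exists[OF H(2,1) \<Phi>(1), of \<omega>] \<omega> by auto
  define \<Psi> where "\<Psi> x = L x + (\<zeta> - L \<omega>)" for x
  have e: "exp (\<zeta> - L \<omega>) = 1" using L(2)[of \<omega>] \<Phi>(2) \<omega> by (simp add: exp_diff)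
  have "inverse_branch f \<rho> \<Psi>"
    unfolding inverse_branch_def \<Psi>_def using L \<Phi> e
    by (auto intro!: holomorphic_intros simp: exp_add)
  moreover have "\<Psi> \<omega> = \<zeta>" by (simp add: \<Psi>_def)
  ultimately show ?thesis by blast
qed

lemma inverse_branch_inj:
  assumes "tame_beyond f \<rho>" "inverse_branch f \<rho> \<Psi>" "\<rho> < Re x" "\<rho> < Re y" "exp (\<Psi> x) = exp (\<Psi> y)"
  shows "x = y"
proof -
  have "inj_on (\<lambda>x. exp (\<Psi> x)) {\<omega>. \<rho> < Re \<omega>}"
    using assms by (intro exp_lift_injective[of f]) (auto simp: inverse_branch_def intro!: holomorphic_intros)
  then show ?thesis using assms by (auto simp: inj_on_def)
qed

text \<open>
  By Bloch's theorem the image contains a disc of radius \<open>r * cmod (deriv h a) / 12\<close>, and it cannot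
  contain two points that differ by \<open>2 pi \<i>\<close>.
\<close>

lemma deriv_bound_of_exp_injective:
  assumes h: "h holomorphic_on ball a r" and r: "0 < r"
    and inj: "\<And>x y. x \<in> ball a r \<Longrightarrow> y \<in> ball a r \<Longrightarrow> exp (h x) = exp (h y) \<Longrightarrow> h x = h y"
  shows "r * cmod (deriv h a) \<le> 12 * pi"
proof (rule ccontr)
  assume "\<not> ?thesis"
  then have gt: "pi < r * cmod (deriv h a) / 12" by simp
  obtain b where b: "ball b (r * cmod (deriv h a) / 12) \<subseteq> h ` ball a r"
    using Bloch[OF h r order_refl] by blast
  have "b - of_real pi * \<i> \<in> h ` ball a r" "b + of_real pi * \<i> \<in> h ` ball a r"
    using b gt by (auto simp: dist_norm norm_mult intro!: subsetD[OF b])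
  then obtain x y where xy: "x \<in> ball a r" "y \<in> ball a r" "h x = b - of_real pi * \<i>" "h y = b + of_real pi * \<i>"
    by auto
  have "h y = h x + 2 * of_real pi * \<i>" by (simp add: xy)
  then have "exp (h x) = exp (h y)" by (simp add: exp_add)
  then have "h x = h y" using inj xy by blast
  then show False using xy by simp
qed

text \<open>
  At distance \<open>d\<close> from the boundary line \<open>Re \<omega> = \<rho>\<close>, the derivative of \<open>\<Psi>\<close> is at most \<open>12 * pi / d\<close>.
\<close>

lemma inverse_branch_lipschitz:
  assumes f: "tame_beyond f \<rho>" and \<Psi>: "inverse_branch f \<rho> \<Psi>"
    and x: "\<rho> + 24 * pi \<le> Re x" and y: "\<rho> + 24 * pi \<le> Re y"
  shows "dist (\<Psi> x) (\<Psi> y) \<le> dist x y / 2"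
proof -
  let ?S = "{\<omega>. \<rho> + 24 * pi \<le> Re \<omega>}"
  have hol: "\<Psi> holomorphic_on {\<omega>. \<rho> < Re \<omega>}" using \<Psi> by (simp add: inverse_branch_def)
  have "cmod (\<Psi> x - \<Psi> y) \<le> 1/2 * cmod (x - y)"
  proof (rule field_differentiable_bound[of ?S \<Psi> "deriv \<Psi>"])
    show "convex ?S" by (rule convex_halfspace_Re_ge)
    fix z assume z: "z \<in> ?S"
    define r where "r = Re z - \<rho>"
    have r: "r \<ge> 24 * pi" "r > 0" using z pi_gt_zero by (auto simp: r_def simp del: pi_gt_zero)
    have zH: "\<rho> < Re z" using r by (simp add: r_def)
    show "(\<Psi> has_field_derivative deriv \<Psi> z) (at z within ?S)"
      by (rule holomorphic_derivI[OF hol]) (use zH in \<open>auto simp: open_halfspace_Re_gt\<close>)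
    have sub: "ball z r \<subseteq> {\<omega>. \<rho> < Re \<omega>}"
    proof
      fix u assume "u \<in> ball z r"
      then have "\<bar>Re (z - u)\<bar> < r" using abs_Re_le_cmod[of "z - u"] by (simp add: dist_norm)
      then show "u \<in> {\<omega>. \<rho> < Re \<omega>}" by (simp add: r_def)
    qed
    have "r * cmod (deriv \<Psi> z) \<le> 12 * pi"
    proof (rule deriv_bound_of_exp_injective)
      show "\<Psi> holomorphic_on ball z r" using hol sub holomorphic_on_subset by blast
      show "\<Psi> u = \<Psi> v" if "u \<in> ball z r" "v \<in> ball z r" "exp (\<Psi> u) = exp (\<Psi> v)" for u v
        using inverse_branch_inj[OF f \<Psi>, of u v] that(3) subsetD[OF sub that(1)] subsetD[OF sub that(2)] by auto
    qed (use r in simp)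
    moreover have "24 * pi * cmod (deriv \<Psi> z) \<le> r * cmod (deriv \<Psi> z)"
      using r by (intro mult_right_mono) auto
    ultimately have "24 * pi * cmod (deriv \<Psi> z) \<le> 24 * pi * (1/2)" by linarith
    then show "cmod (deriv \<Psi> z) \<le> 1/2" by simp
  qed (use x y in auto)
  then show ?thesis by (simp add: dist_norm)
qed

text \<open>
  A continuous family of orbit segments that uses an inverse branch at one parameter uses the same
  branch throughout.
\<close>

lemma inverse_branch_follows:
  fixes \<zeta>0 \<zeta>1 :: "'a::topological_space \<Rightarrow> complex"
  assumes f: "tame_beyond f \<rho>" and \<Psi>: "inverse_branch f \<rho> \<Psi>" and X: "connected X"
    and \<zeta>: "continuous_on X \<zeta>0" "continuous_on X \<zeta>1"
    and eq: "\<And>x. x \<in> X \<Longrightarrow> f (exp (\<zeta>0 x)) = exp (\<zeta>1 x)"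
    and H: "\<And>x. x \<in> X \<Longrightarrow> \<rho> < Re (\<zeta>1 x)"
    and x0: "x0 \<in> X" "\<zeta>0 x0 = \<Psi> (\<zeta>1 x0)" and x: "x \<in> X"
  shows "\<zeta>0 x = \<Psi> (\<zeta>1 x)"
proof (rule unique_lift[of "f \<circ> exp" X \<zeta>0 "\<lambda>x. \<Psi> (\<zeta>1 x)" x0 x, OF _ X \<zeta>(1) _ _ _ x0 x])
  have fh: "f holomorphic_on UNIV" using f by (auto simp: tame_beyond_def transcendental_entire_def)
  show "f \<circ> exp holomorphic_on UNIV"
    by (intro holomorphic_on_compose holomorphic_intros) (use fh in \<open>auto intro: holomorphic_on_subset\<close>)
  show "continuous_on X (\<lambda>x. \<Psi> (\<zeta>1 x))"
    using \<Psi> H by (intro continuous_on_compose2[OF _ \<zeta>(2)])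
      (auto simp: inverse_branch_def intro!: holomorphic_on_imp_continuous_on)
  fix y assume y: "y \<in> X"
  show "(f \<circ> exp) (\<zeta>0 y) = (f \<circ> exp) (\<Psi> (\<zeta>1 y))"
    using \<Psi> H[OF y] eq[OF y] by (simp add: inverse_branch_def)
  have d: "deriv f (exp (\<zeta>0 y)) \<noteq> 0"
  proof (rule regular_if_not_singular)
    have "exp \<rho> < cmod (f (exp (\<zeta>0 y)))" using eq[OF y] H[OF y] by (simp add: norm_exp_eq_Re)
    then show "f (exp (\<zeta>0 y)) \<notin> singular_set f" using f by (auto simp: tame_beyond_def)
  qed
  have "((f \<circ> exp) has_field_derivative deriv f (exp (\<zeta>0 y)) * exp (\<zeta>0 y)) (at (\<zeta>0 y))"
    by (intro DERIV_chain DERIV_exp holomorphic_derivI[OF fh]) auto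
  then have "deriv (f \<circ> exp) (\<zeta>0 y) = deriv f (exp (\<zeta>0 y)) * exp (\<zeta>0 y)" by (rule DERIV_imp_deriv)
  then show "deriv (f \<circ> exp) (\<zeta>0 y) \<noteq> 0" using d by simp
qed

text \<open>
  Both orbits are pulled back by the same contractions, so a bounded distance far out on the orbits
  is halved with each step back.
\<close>

lemma backward_orbits_coincide:
  fixes x y :: "nat \<Rightarrow> complex"
  assumes lip: "\<And>n u v. r \<le> Re u \<Longrightarrow> r \<le> Re v \<Longrightarrow> dist (\<Psi> n u) (\<Psi> n v) \<le> dist u v / 2"
    and x: "\<And>n. x n = \<Psi> n (x (Suc n))" "\<And>n. r \<le> Re (x n)"
    and y: "\<And>n. y n = \<Psi> n (y (Suc n))" "\<And>n. r \<le> Re (y n)"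
    and M: "\<And>n. dist (x n) (y n) \<le> M"
  shows "x n = y n"
proof -
  have *: "dist (x n) (y n) \<le> M * (1/2)^k" for n k
  proof (induction k arbitrary: n)
    case (Suc k)
    have "dist (x n) (y n) \<le> dist (x (Suc n)) (y (Suc n)) / 2"
      using lip[of "x (Suc n)" "y (Suc n)" n] x y by metis
    then show ?case using Suc[of "Suc n"] by simp
  qed (use M in simp)
  have "(\<lambda>k. M * (1/2)^k) \<longlonglongrightarrow> M * 0"
    by (intro tendsto_mult tendsto_const LIMSEQ_power_zero) auto
  then have "dist (x n) (y n) \<le> 0"
    using * by (intro LIMSEQ_le_const[of "\<lambda>k. M * (1/2)^k"]) auto
  then show ?thesis by simp
qed

text \<open>
  The shadowing orbit is the limit of the orbit segments that coincide with \<open>\<zeta>\<close> at time \<open>n + m\<close> and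
  are pulled back \<open>m\<close> times by the perturbed branches.  The distance \<open>cmod \<kappa>\<close> reproduces itself under one
  step of this, as \<open>(cmod \<kappa> + cmod \<kappa>) / 2 = cmod \<kappa>\<close>, and the successive corrections decay
  geometrically, uniformly in the parameter \<open>s\<close>.
\<close>

lemma shadowing:
  fixes \<Psi> :: "nat \<Rightarrow> complex \<Rightarrow> complex" and \<zeta> :: "nat \<Rightarrow> 'a::topological_space \<Rightarrow> complex"
  assumes lip: "\<And>n u v. r \<le> Re u \<Longrightarrow> r \<le> Re v \<Longrightarrow> dist (\<Psi> n u) (\<Psi> n v) \<le> dist u v / 2"
    and \<zeta>: "\<And>n s. s \<in> X \<Longrightarrow> \<zeta> n s = \<Psi> n (\<zeta> (Suc n) s)"
    and Re_\<zeta>: "\<And>n s. s \<in> X \<Longrightarrow> r + 2 * cmod \<kappa> \<le> Re (\<zeta> n s)"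
    and cont: "\<And>n. continuous_on X (\<zeta> n)"
  obtains \<xi> where "\<And>n. continuous_on X (\<xi> n)" "\<And>n s. s \<in> X \<Longrightarrow> \<xi> n s = \<Psi> n (\<xi> (Suc n) s - \<kappa>)"
    "\<And>n s. s \<in> X \<Longrightarrow> dist (\<xi> n s) (\<zeta> n s) \<le> cmod \<kappa>"
proof -
  have Psi_cont: "continuous_on {u. r \<le> Re u} (\<Psi> n)" for n
  proof (rule continuous_onI)
    fix u and e :: real assume "u \<in> {u. r \<le> Re u}" "e > 0"
    then show "\<exists>d>0. \<forall>v\<in>{u. r \<le> Re u}. dist v u < d \<longrightarrow> dist (\<Psi> n v) (\<Psi> n u) \<le> e"
      using lip by (intro exI[of _ e]) (smt (verit) mem_Collect_eq field_sum_of_halves zero_le_dist)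
  qed
  \<comment> \<open>\<open>A m n s\<close>: start at \<open>\<zeta> (n + m) s\<close> and apply \<open>m\<close> perturbed inverse branches.\<close>
  define A where "A = rec_nat \<zeta> (\<lambda>m a n s. \<Psi> n (a (Suc n) s - \<kappa>))"
  have A0: "A 0 = \<zeta>" and AS: "A (Suc m) n s = \<Psi> n (A m (Suc n) s - \<kappa>)" for m n s
    by (simp_all add: A_def)
  have Re_near: "r + cmod \<kappa> \<le> Re u" if "s \<in> X" "dist u (\<zeta> n s) \<le> cmod \<kappa>" for u n s
    using Re_\<zeta>[OF that(1), of n] that(2) abs_Re_le_cmod[of "u - \<zeta> n s"] by (simp add: dist_norm)
  have Re_k: "r \<le> Re (u - \<kappa>)" if "r + cmod \<kappa> \<le> Re u" for u
    using that abs_Re_le_cmod[of \<kappa>] by simp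
  have near: "dist (A m n s) (\<zeta> n s) \<le> cmod \<kappa>" if s: "s \<in> X" for m n s
  proof (induction m arbitrary: n)
    case (Suc m)
    have "dist (A (Suc m) n s) (\<zeta> n s) = dist (\<Psi> n (A m (Suc n) s - \<kappa>)) (\<Psi> n (\<zeta> (Suc n) s))"
      using \<zeta>[OF s, of n] by (simp add: AS)
    also have "\<dots> \<le> dist (A m (Suc n) s - \<kappa>) (\<zeta> (Suc n) s) / 2"
    proof (rule lip)
      show "r \<le> Re (A m (Suc n) s - \<kappa>)" using Re_k Re_near[OF s Suc] by blast
      show "r \<le> Re (\<zeta> (Suc n) s)" using Re_\<zeta>[OF s, of "Suc n"] norm_ge_zero[of \<kappa>] by linarith
    qed
    also have "dist (A m (Suc n) s - \<kappa>) (\<zeta> (Suc n) s) \<le> dist (A m (Suc n) s) (\<zeta> (Suc n) s) + cmod \<kappa>"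
      using norm_triangle_ineq4[of "A m (Suc n) s - \<zeta> (Suc n) s" \<kappa>] by (simp add: dist_norm algebra_simps)
    finally show ?case using Suc[of "Suc n"] by simp
  qed (simp add: A0)
  have Re_A: "r \<le> Re (A m n s - \<kappa>)" if "s \<in> X" for m n s
    by (rule Re_k[OF Re_near[OF that near[OF that]]])
  have step: "dist (A (Suc m) n s) (A m n s) \<le> cmod \<kappa> * (1/2)^m" if s: "s \<in> X" for m n s
  proof (induction m arbitrary: n)
    case 0
    then show ?case using near[OF s, of 1 n] by (simp add: A0)
  next
    case (Suc m)
    have "dist (A (Suc (Suc m)) n s) (A (Suc m) n s)
        \<le> dist (A (Suc m) (Suc n) s - \<kappa>) (A m (Suc n) s - \<kappa>) / 2"
      unfolding AS[of "Suc m" n] AS[of m n] by (rule lip[OF Re_A[OF s] Re_A[OF s]])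
    also have "\<dots> = dist (A (Suc m) (Suc n) s) (A m (Suc n) s) / 2" by (simp add: dist_norm)
    finally show ?case using Suc[of "Suc n"] by simp
  qed
  have A_cont: "continuous_on X (A m n)" for m n
  proof (induction m arbitrary: n)
    case (Suc m)
    have "continuous_on X (\<lambda>s. \<Psi> n (A m (Suc n) s - \<kappa>))"
      by (rule continuous_on_compose2[OF Psi_cont]) (use Suc Re_A in \<open>auto intro!: continuous_intros\<close>)
    then show ?case by (simp add: AS)
  qed (simp add: A0 cont)
  have "\<exists>l. uniform_limit X (\<lambda>m. A m n) l sequentially" for n
  proof -
    have "uniformly_convergent_on X (\<lambda>m. A m n)"
    proof (rule Cauchy_uniformly_convergent)
      show "uniformly_Cauchy_on X (\<lambda>m. A m n)"
        unfolding uniformly_Cauchy_on_def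
      proof (intro allI impI)
        fix e :: real assume e: "e > 0"
        have far: "dist (A (m + k) n s) (A m n s) \<le> 2 * cmod \<kappa> * (1/2)^m" if s: "s \<in> X" for s m k
        proof -
          have "dist (A (m + k) n s) (A m n s) \<le> 2 * cmod \<kappa> * (1/2)^m * (1 - (1/2)^k)"
          proof (induction k)
            case (Suc k)
            have "dist (A (m + Suc k) n s) (A m n s) \<le> dist (A (Suc (m + k)) n s) (A (m+k) n s) + dist (A (m + k) n s) (A m n s)"
              using dist_triangle[of "A (m + Suc k) n s" "A m n s" "A (m+k) n s"] by simp
            also have "\<dots> \<le> cmod \<kappa> * (1/2)^(m+k) + 2 * cmod \<kappa> * (1/2)^m * (1 - (1/2)^k)"
              using Suc step[OF s] by (intro add_mono) auto
            also have "\<dots> = 2 * cmod \<kappa> * (1/2)^m * (1 - (1/2)^Suc k)" by (simp add: power_add algebra_simps)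
            finally show ?case .
          qed auto
          also have "\<dots> \<le> 2 * cmod \<kappa> * (1/2)^m * 1"
            by (intro mult_left_mono) auto
          finally show ?thesis by simp
        qed
        have "(\<lambda>m. 2 * cmod \<kappa> * (1/2)^m) \<longlonglongrightarrow> 2 * cmod \<kappa> * 0"
          by (intro tendsto_mult tendsto_const LIMSEQ_power_zero) auto
        then have "eventually (\<lambda>m. 2 * cmod \<kappa> * (1/2)^m < e/2) sequentially"
          using e by (intro order_tendstoD) auto
        then obtain N where N: "2 * cmod \<kappa> * (1/2)^N < e/2" by (auto simp: eventually_sequentially)
        show "\<exists>M. \<forall>s\<in>X. \<forall>m\<ge>M. \<forall>k\<ge>M. dist (A m n s) (A k n s) < e"
        proof (intro exI[of _ N] ballI allI impI)
          fix s m k assume s: "s \<in> X" "N \<le> m" "N \<le> k"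
          have "dist (A m n s) (A N n s) \<le> 2 * cmod \<kappa> * (1/2)^N" "dist (A k n s) (A N n s) \<le> 2 * cmod \<kappa> * (1/2)^N"
            using far[OF s(1), of N "m-N"] far[OF s(1), of N "k-N"] s by auto
          then show "dist (A m n s) (A k n s) < e"
            using dist_triangle2[of "A m n s" "A k n s" "A N n s"] N by linarith
        qed
      qed
    qed
    then show ?thesis by (auto simp: uniformly_convergent_on_def)
  qed
  then obtain \<xi> where \<xi>: "\<And>n. uniform_limit X (\<lambda>m. A m n) (\<xi> n) sequentially" by metis
  have pt: "(\<lambda>m. A m n s) \<longlonglongrightarrow> \<xi> n s" if "s \<in> X" for n s
    using tendsto_uniform_limitI[OF \<xi> that] .
  have near': "dist (\<xi> n s) (\<zeta> n s) \<le> cmod \<kappa>" if s: "s \<in> X" for n s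
    by (rule LIMSEQ_le_const2[OF tendsto_dist[OF pt[OF s] tendsto_const]]) (use near[OF s] in auto)
  show thesis
  proof
    show "continuous_on X (\<xi> n)" for n
      by (rule uniform_limit_theorem[OF _ \<xi>]) (auto simp: A_cont)
    show "\<xi> n s = \<Psi> n (\<xi> (Suc n) s - \<kappa>)" if s: "s \<in> X" for n s
    proof (rule LIMSEQ_unique)
      show "(\<lambda>m. A (Suc m) n s) \<longlonglongrightarrow> \<xi> n s" using pt[OF s] by (rule LIMSEQ_Suc)
      have "\<xi> (Suc n) s - \<kappa> \<in> {u. r \<le> Re u}" using Re_k Re_near[OF s near'[OF s]] by auto
      moreover have "(\<lambda>m. A m (Suc n) s - \<kappa>) \<longlonglongrightarrow> \<xi> (Suc n) s - \<kappa>"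
        by (intro tendsto_intros pt s)
      moreover have "\<forall>m. A m (Suc n) s - \<kappa> \<in> {u. r \<le> Re u}" using Re_A[OF s] by auto
      ultimately show "(\<lambda>m. A (Suc m) n s) \<longlonglongrightarrow> \<Psi> n (\<xi> (Suc n) s - \<kappa>)"
        unfolding AS using Psi_cont[of n] by (auto simp: continuous_on_sequentially o_def)
    qed
  qed (use near' in blast)
qed

section \<open>Escaping points and the Julia set\<close>

lemma eventually_norm_gt_of_filterlim:
  fixes f :: "'a \<Rightarrow> complex"
  assumes "filterlim f at_infinity F"
  shows "eventually (\<lambda>x. R < cmod (f x)) F"
proof -
  have "eventually (\<lambda>x. max R 0 + 1 \<le> cmod (f x)) F"
    using assms unfolding filterlim_at_infinity[OF order_refl] by auto
  then show ?thesis by eventually_elim auto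
qed

lemma filterlim_at_infinityI_norm_gt:
  fixes f :: "'a \<Rightarrow> complex"
  assumes "\<And>R. eventually (\<lambda>x. R < cmod (f x)) F"
  shows "filterlim f at_infinity F"
  unfolding filterlim_at_infinity[OF order_refl]
proof (intro allI impI)
  fix R :: real
  show "eventually (\<lambda>x. R \<le> cmod (f x)) F"
    using assms[of R] by eventually_elim auto
qed

lemma funpow_holomorphic:
  fixes g :: "complex \<Rightarrow> complex"
  assumes "g holomorphic_on UNIV"
  shows "(g ^^ n) holomorphic_on A"
proof -
  have "(g ^^ n) holomorphic_on UNIV"
  proof (induction n)
    case (Suc n)
    then show ?case using holomorphic_on_compose_gen[OF Suc assms] by (simp only: funpow.simps subset_UNIV)
  qed (simp add: id_def)
  then show ?thesis using holomorphic_on_subset by blast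
qed

lemma funpow_continuous:
  fixes g :: "complex \<Rightarrow> complex"
  assumes "g holomorphic_on UNIV"
  shows "continuous_on A (g ^^ n)"
  using funpow_holomorphic[OF assms] holomorphic_on_imp_continuous_on by blast

lemma funpow_open_map:
  assumes "g holomorphic_on UNIV" "\<not> g constant_on UNIV" "open U"
  shows "open ((g ^^ n) ` U)"
proof (induction n)
  case (Suc n)
  have "(g ^^ Suc n) ` U = g ` ((g ^^ n) ` U)" by (simp add: image_comp)
  then show ?case using nonconstant_entire_open_map[OF assms(1,2) Suc] by simp
qed (use assms in simp)

lemma Fatou_backward_invariant:
  assumes g: "g holomorphic_on UNIV" and z: "g z \<in> Fatou_set g"
  shows "z \<in> Fatou_set g"
proof -
  obtain U where U: "open U" "connected U" "g z \<in> U" and norm: "normal_family_on U (range (\<lambda>n. g ^^ n))"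
    using z by (auto simp: Fatou_set_def)
  have cg: "continuous_on A g" for A
    using g holomorphic_on_imp_continuous_on holomorphic_on_subset by blast
  have "open (g -` U)" using open_vimage[OF U(1) cg] .
  then obtain e where e: "e > 0" "ball z e \<subseteq> g -` U" using U(3)
    by (meson open_contains_ball vimage_eq)
  have "normal_family_on (ball z e) (range (\<lambda>n. g ^^ n))"
    unfolding normal_family_on_def
  proof (intro allI impI)
    fix h :: "nat \<Rightarrow> complex \<Rightarrow> complex" assume "range h \<subseteq> range (\<lambda>n. g ^^ n)"
    then have "\<forall>j. \<exists>m. h j = g ^^ m" by blast
    then obtain m where m: "\<And>j. h j = g ^^ m j" by metis
    show "\<exists>r. strict_mono r \<and>
        ((\<exists>G. \<forall>K. compact K \<and> K \<subseteq> ball z e \<longrightarrow> uniform_limit K (h \<circ> r) G sequentially) \<or>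
         (\<forall>K. compact K \<and> K \<subseteq> ball z e \<longrightarrow> uniformly_to_infinity_on K (h \<circ> r)))"
    \<comment> \<open>\<open>g ^^ m\<close> is transported from \<open>g z\<close> to \<open>z\<close> as \<open>g ^^ (m - 1) \<circ> g\<close>, which excludes \<open>m = 0\<close>.\<close>
    proof (cases "infinite {j. m j = 0}")
      case True
      then obtain r :: "nat \<Rightarrow> nat" where r: "strict_mono r" "\<And>n. r n \<in> {j. m j = 0}"
        using infinite_enumerate by blast
      have "uniform_limit K (h \<circ> r) id sequentially" for K
      proof -
        have "h \<circ> r = (\<lambda>_. id)" using r(2) m by auto
        then show ?thesis by (simp add: uniform_limit_const)
      qed
      then show ?thesis using r(1) by blast
    next
      case False
      then obtain j0 where j0: "\<And>j. m j = 0 \<Longrightarrow> j < j0"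
        using finite_nat_bounded[of "{j. m j = 0}"] by auto
      define h' where "h' i = g ^^ (m (j0 + i) - 1)" for i
      have hh': "h (j0 + i) = h' i \<circ> g" for i
      proof -
        have "m (j0 + i) \<noteq> 0" using j0[of "j0 + i"] by auto
        then obtain k where "m (j0 + i) = Suc k" using not0_implies_Suc by blast
        then show ?thesis by (simp add: m h'_def funpow_Suc_right del: funpow.simps)
      qed
      have "range h' \<subseteq> range (\<lambda>n. g ^^ n)" by (auto simp: h'_def)
      then obtain r where r: "strict_mono r"
        "(\<exists>G. \<forall>K. compact K \<and> K \<subseteq> U \<longrightarrow> uniform_limit K (h' \<circ> r) G sequentially) \<or>
         (\<forall>K. compact K \<and> K \<subseteq> U \<longrightarrow> uniformly_to_infinity_on K (h' \<circ> r))"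
        using norm unfolding normal_family_on_def by meson
      define r' where "r' i = j0 + r i" for i
      have r': "strict_mono r'" using r(1) by (auto simp: r'_def strict_mono_def)
      have hr: "h (r' i) x = h' (r i) (g x)" for i x by (simp add: r'_def hh')
      have gK: "compact (g ` K)" "g ` K \<subseteq> U" if "compact K" "K \<subseteq> ball z e" for K
        using that e cg by (auto intro: compact_continuous_image)
      from r(2) show ?thesis
      proof
        assume "\<exists>G. \<forall>K. compact K \<and> K \<subseteq> U \<longrightarrow> uniform_limit K (h' \<circ> r) G sequentially"
        then obtain G where G: "\<And>K. compact K \<Longrightarrow> K \<subseteq> U \<Longrightarrow> uniform_limit K (h' \<circ> r) G sequentially" by blast
        have "uniform_limit K (h \<circ> r') (G \<circ> g) sequentially" if "compact K" "K \<subseteq> ball z e" for K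
          using G[OF gK[OF that]] by (simp add: uniform_limit_iff hr)
        then show ?thesis using r' by blast
      next
        assume G: "\<forall>K. compact K \<and> K \<subseteq> U \<longrightarrow> uniformly_to_infinity_on K (h' \<circ> r)"
        have "uniformly_to_infinity_on K (h \<circ> r')" if "compact K" "K \<subseteq> ball z e" for K
        proof -
          have "uniformly_to_infinity_on (g ` K) (h' \<circ> r)" using G gK[OF that] by blast
          then show ?thesis by (simp add: uniformly_to_infinity_on_def hr)
        qed
        then show ?thesis using r' by blast
      qed
    qed
  qed
  then show ?thesis using e(1) unfolding Fatou_set_def
    by (intro CollectI exI[of _ "ball z e"]) auto
qed

text \<open>
  Normality is used for the subsequence of those iterates that fail to be large somewhere on the disc:
  none of its subsequences can converge to a finite limit, because the centre escapes, nor to infinity.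
\<close>

lemma escaping_Fatou_point_locally_uniform:
  assumes w: "w \<in> escaping_set g" "w \<in> Fatou_set g"
  obtains r where "r > 0" "uniformly_to_infinity_on (cball w r) (\<lambda>n. g ^^ n)"
proof -
  obtain U where U: "open U" "connected U" "w \<in> U" and norm: "normal_family_on U (range (\<lambda>n. g ^^ n))"
    using w by (auto simp: Fatou_set_def)
  obtain r where r: "r > 0" "cball w r \<subseteq> U" using U by (meson open_contains_cball)
  have "uniformly_to_infinity_on (cball w r) (\<lambda>n. g ^^ n)"
  proof (rule ccontr)
    assume "\<not> ?thesis"
    then obtain R where "\<not> (\<forall>\<^sub>F n in sequentially. \<forall>x\<in>cball w r. R < cmod ((g ^^ n) x))"
      by (auto simp: uniformly_to_infinity_on_def)
    then have "infinite {n. \<exists>x\<in>cball w r. cmod ((g ^^ n) x) \<le> R}"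
      unfolding cofinite_eq_sequentially[symmetric] eventually_cofinite by (simp add: not_less)
    then obtain s :: "nat \<Rightarrow> nat" where s: "strict_mono s" "\<And>n. \<exists>x\<in>cball w r. cmod ((g ^^ s n) x) \<le> R"
      using infinite_enumerate[of "{n. \<exists>x\<in>cball w r. cmod ((g ^^ n) x) \<le> R}"] by auto
    define h where "h j = g ^^ s j" for j
    have "range h \<subseteq> range (\<lambda>n. g ^^ n)" by (auto simp: h_def)
    then obtain q where q: "strict_mono q"
      "(\<exists>G. \<forall>K. compact K \<and> K \<subseteq> U \<longrightarrow> uniform_limit K (h \<circ> q) G sequentially) \<or>
       (\<forall>K. compact K \<and> K \<subseteq> U \<longrightarrow> uniformly_to_infinity_on K (h \<circ> q))"
      using norm unfolding normal_family_on_def by meson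
    from q(2) show False
    proof
      assume "\<exists>G. \<forall>K. compact K \<and> K \<subseteq> U \<longrightarrow> uniform_limit K (h \<circ> q) G sequentially"
      then obtain G where "\<forall>K. compact K \<and> K \<subseteq> U \<longrightarrow> uniform_limit K (h \<circ> q) G sequentially" by blast
      then have G: "uniform_limit (cball w r) (h \<circ> q) G sequentially" using r by auto
      have "(\<lambda>n. (h \<circ> q) n w) \<longlonglongrightarrow> G w"
        using tendsto_uniform_limitI[OF G, of w] r by auto
      moreover have "filterlim (\<lambda>n. (h \<circ> q) n w) at_infinity sequentially"
      proof -
        have "filterlim (\<lambda>n. s (q n)) sequentially sequentially"
          using filterlim_compose[OF filterlim_subseq[OF s(1)] filterlim_subseq[OF q(1)]] .
        moreover have "filterlim (\<lambda>n. (g ^^ n) w) at_infinity sequentially" using w by (simp add: escaping_set_def)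
        ultimately have "filterlim (\<lambda>n. (g ^^ s (q n)) w) at_infinity sequentially"
          using filterlim_compose by blast
        then show ?thesis by (simp add: h_def)
      qed
      ultimately show False using not_tendsto_and_filterlim_at_infinity trivial_limit_sequentially by blast
    next
      assume "\<forall>K. compact K \<and> K \<subseteq> U \<longrightarrow> uniformly_to_infinity_on K (h \<circ> q)"
      then have "\<forall>\<^sub>F n in sequentially. \<forall>x\<in>cball w r. R < cmod ((h \<circ> q) n x)"
        using r by (auto simp: uniformly_to_infinity_on_def)
      then obtain n where "\<forall>x\<in>cball w r. R < cmod ((g ^^ s (q n)) x)"
        by (auto simp: eventually_sequentially h_def)
      then show False using s(2)[of "q n"] by force
    qed
  qed
  then show thesis using that r by blast
qed

text \<open>
  Otherwise a whole disc around \<open>w\<close> escapes uniformly, and its iterates \<open>\<zeta> n\<close> in logarithmic coordinates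
  stay in the images of inverse branches, on which \<open>exp\<close> is injective.  Their derivatives are therefore
  bounded, independently of \<open>n\<close>.  But they are linked by contractions, which makes \<open>\<zeta> 0\<close> constant, and so an
  iterate of \<open>g\<close>, in contradiction with the open mapping theorem.
\<close>

lemma escaping_set_subset_Julia:
  assumes g: "g \<in> class_B" and w: "w \<in> escaping_set g"
  shows "w \<in> Julia_set g"
proof (rule ccontr)
  assume "w \<notin> Julia_set g"
  then have "w \<in> Fatou_set g" by (simp add: Julia_set_def)
  then obtain r where r: "r > 0" and unif: "uniformly_to_infinity_on (cball w r) (\<lambda>n. g ^^ n)"
    using escaping_Fatou_point_locally_uniform[OF w] by blast
  obtain \<rho> where \<rho>: "tame_beyond g \<rho>" using class_B_tame_beyond[OF g] by blast
  have gh: "g holomorphic_on UNIV" and nc: "\<not> g constant_on UNIV"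
    using g transcendental_entire_nonconstant by (auto simp: class_B_def transcendental_entire_def)
  define R where "R = \<rho> + 24 * pi"
  have "\<forall>\<^sub>F n in sequentially. \<forall>x\<in>cball w r. exp R < cmod ((g ^^ n) x)"
    using unif by (auto simp: uniformly_to_infinity_on_def)
  then obtain N where "\<forall>n\<ge>N. \<forall>x\<in>cball w r. exp R < cmod ((g ^^ n) x)"
    unfolding eventually_sequentially by blast
  then have N: "exp R < cmod ((g ^^ (N + n)) x)" if "x \<in> cball w r" for n x
    using that by auto
  have "\<exists>L. L holomorphic_on ball w r \<and> (\<forall>x\<in>ball w r. exp (L x) = (g ^^ (N + n)) x)" for n
  proof -
    have nz: "(g ^^ (N + n)) x \<noteq> 0" if "x \<in> ball w r" for x
    proof
      assume "(g ^^ (N + n)) x = 0"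
      then have "exp R < 0" using N[of x n] that by auto
      then show False by (simp add: not_less_iff_gr_or_eq)
    qed
    show ?thesis
      by (rule holomorphic_logarithm_exists[OF convex_ball open_ball funpow_holomorphic[OF gh] nz, where ?z0.0 = w]) (use r in auto)
  qed
  then obtain \<zeta> where \<zeta>: "\<And>n. \<zeta> n holomorphic_on ball w r"
    "\<And>n x. x \<in> ball w r \<Longrightarrow> exp (\<zeta> n x) = (g ^^ (N + n)) x" by metis
  have Re_\<zeta>: "R < Re (\<zeta> n x)" if "x \<in> ball w r" for n x
  proof -
    have "exp R < exp (Re (\<zeta> n x))"
      using N[of x n] that by (simp add: norm_exp_eq_Re[symmetric] \<zeta>)
    then show ?thesis by simp
  qed
  have R\<rho>: "\<rho> < R" by (simp add: R_def)
  have wb: "w \<in> ball w r" using r by simp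
  have step: "g (exp (\<zeta> n x)) = exp (\<zeta> (Suc n) x)" if "x \<in> ball w r" for n x
    using that by (simp add: \<zeta>)
  have "\<exists>\<Psi>. inverse_branch g \<rho> \<Psi> \<and> \<Psi> (\<zeta> (Suc n) w) = \<zeta> n w" for n
    using Re_\<zeta>[OF wb, of "Suc n"] R\<rho> by (intro inverse_branch_exists[OF \<rho> step[OF wb]]) simp
  then obtain \<Psi> where \<Psi>: "\<And>n. inverse_branch g \<rho> (\<Psi> n)" "\<And>n. \<Psi> n (\<zeta> (Suc n) w) = \<zeta> n w" by metis
  have follow: "\<zeta> n x = \<Psi> n (\<zeta> (Suc n) x)" if x: "x \<in> ball w r" for n x
  proof (rule inverse_branch_follows[of g \<rho> "\<Psi> n" "ball w r" "\<zeta> n" "\<zeta> (Suc n)" w x, OF \<rho> \<Psi>(1) _ _ _ step _ wb \<Psi>(2)[symmetric] x])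
    show "connected (ball w r)" by simp
    show "continuous_on (ball w r) (\<zeta> n)" "continuous_on (ball w r) (\<zeta> (Suc n))"
      using \<zeta>(1) holomorphic_on_imp_continuous_on by blast+
    show "\<rho> < Re (\<zeta> (Suc n) y)" if "y \<in> ball w r" for y
      using Re_\<zeta>[OF that, of "Suc n"] R\<rho> by simp
  qed
  have exp_inj: "\<zeta> n x = \<zeta> n y" if "x \<in> ball w r" "y \<in> ball w r" "exp (\<zeta> n x) = exp (\<zeta> n y)" for n x y
  proof -
    have "\<rho> < Re (\<zeta> (Suc n) x)" "\<rho> < Re (\<zeta> (Suc n) y)"
      using Re_\<zeta>[OF that(1), of "Suc n"] Re_\<zeta>[OF that(2), of "Suc n"] R\<rho> by simp_all
    then have "\<zeta> (Suc n) x = \<zeta> (Suc n) y"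
      using inverse_branch_inj[OF \<rho> \<Psi>(1)[of n]] that(3) follow[OF that(1)] follow[OF that(2)] by metis
    then show ?thesis using follow[OF that(1)] follow[OF that(2)] by metis
  qed
  have sub: "ball x (r/2) \<subseteq> ball w r" if "x \<in> ball w (r/2)" for x
  proof
    fix y assume "y \<in> ball x (r/2)"
    then show "y \<in> ball w r" using that dist_triangle[of w y x] by (simp add: dist_commute)
  qed
  have der: "cmod (deriv (\<zeta> n) x) \<le> 24 * pi / r" if x: "x \<in> ball w (r/2)" for n x
  proof -
    have "r/2 * cmod (deriv (\<zeta> n) x) \<le> 12 * pi"
    proof (rule deriv_bound_of_exp_injective)
      show "\<zeta> n holomorphic_on ball x (r/2)" using \<zeta>(1) sub[OF x] holomorphic_on_subset by blast
      show "\<zeta> n u = \<zeta> n v" if "u \<in> ball x (r/2)" "v \<in> ball x (r/2)" "exp (\<zeta> n u) = exp (\<zeta> n v)" for u v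
        using exp_inj that subsetD[OF sub[OF x]] by blast
    qed (use r in simp)
    then show ?thesis using r by (simp add: field_simps)
  qed
  have bdd: "dist (\<zeta> n x) (\<zeta> n w) \<le> 12 * pi" if x: "x \<in> ball w (r/2)" for n x
  proof -
    have "cmod (\<zeta> n x - \<zeta> n w) \<le> 24 * pi / r * cmod (x - w)"
    proof (rule field_differentiable_bound[of "ball w (r/2)" "\<zeta> n" "deriv (\<zeta> n)"])
      show "(\<zeta> n has_field_derivative deriv (\<zeta> n) z) (at z within ball w (r/2))" if "z \<in> ball w (r/2)" for z
        by (rule holomorphic_derivI[OF \<zeta>(1)]) (use that r in auto)
    qed (use der x r in auto)
    also have "\<dots> \<le> 24 * pi / r * (r/2)"
      using x r by (intro mult_left_mono) (auto simp: dist_norm norm_minus_commute)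
    also have "\<dots> = 12 * pi" using r by simp
    finally show ?thesis by (simp add: dist_norm)
  qed
  have const: "(g ^^ N) x = (g ^^ N) w" if x: "x \<in> ball w (r/2)" for x
  proof -
    have xr: "x \<in> ball w r" using x r by auto
    have "\<zeta> 0 x = \<zeta> 0 w"
    proof (rule backward_orbits_coincide[of R \<Psi> "\<lambda>n. \<zeta> n x" "\<lambda>n. \<zeta> n w" "12 * pi"])
      show "dist (\<Psi> n u) (\<Psi> n v) \<le> dist u v / 2" if "R \<le> Re u" "R \<le> Re v" for n u v
        using inverse_branch_lipschitz[OF \<rho> \<Psi>(1)] that by (simp add: R_def)
      show "R \<le> Re (\<zeta> n x)" "R \<le> Re (\<zeta> n w)" for n using Re_\<zeta>[OF xr, of n] Re_\<zeta>[OF wb, of n] by simp_all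
      show "\<zeta> n x = \<Psi> n (\<zeta> (Suc n) x)" "\<zeta> n w = \<Psi> n (\<zeta> (Suc n) w)" for n
        using follow[OF xr] follow[OF wb] by blast+
      show "dist (\<zeta> n x) (\<zeta> n w) \<le> 12 * pi" for n by (rule bdd[OF x])
    qed
    then show ?thesis using \<zeta>(2)[OF xr, of 0] \<zeta>(2)[OF wb, of 0] by simp
  qed
  have "open ((g ^^ N) ` ball w (r/2))" by (rule funpow_open_map[OF gh nc open_ball])
  moreover have "(g ^^ N) ` ball w (r/2) = {(g ^^ N) w}"
  proof -
    have "w \<in> ball w (r/2)" using r by simp
    then show ?thesis using const by (metis image_constant_conv[of "(g ^^ N) w" "ball w (r/2)"] empty_iff image_cong)
  qed
  ultimately show False using not_open_singleton by metis
qed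

lemma disjoint_type_singular_set_disjnt_Julia:
  assumes "disjoint_type g" "z \<in> singular_set g"
  shows "z \<notin> Julia_set g"
proof -
  have "z \<in> (\<Union>n. (g ^^ n) ` singular_set g)" using assms(2) by (intro UN_I[of 0]) auto
  then have "z \<in> postsingular_set g"
    unfolding postsingular_set_def by (rule subsetD[OF closure_subset])
  then show ?thesis using assms by (auto simp: disjoint_type_def Julia_set_def)
qed

section \<open>Tails of hairs of a Cantor bouquet\<close>

text \<open>
  If \<open>\<phi> a = \<phi> b\<close>, then \<open>\<phi>\<close> has an extremum inside \<open>{a<..<b}\<close>, near which it cannot be injective.
\<close>

lemma locally_injective_imp_injective:
  fixes \<phi> :: "real \<Rightarrow> real"
  assumes cont: "continuous_on {0..} \<phi>"
    and loc: "\<And>u. 0 \<le> u \<Longrightarrow> \<exists>d>0. inj_on \<phi> ({0..} \<inter> ball u d)"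
  shows "inj_on \<phi> {0..}"
proof -
  have no_extremum: False if ab: "0 \<le> a" "a < x" "x < b" and ext: "(\<forall>v\<in>{a..b}. \<phi> v \<le> \<phi> x) \<or> (\<forall>v\<in>{a..b}. \<phi> x \<le> \<phi> v)" for a b x
  proof -
    obtain d where d: "d > 0" "inj_on \<phi> ({0..} \<inter> ball x d)" using loc[of x] ab by auto
    define e where "e = min (d/2) (min (x - a) (b - x))"
    have e: "e > 0" "e < d" "e \<le> x - a" "e \<le> b - x" using d ab by (auto simp: e_def)
    have sub: "{x-e..x+e} \<subseteq> {0..} \<inter> ball x d" using e ab by (auto simp: dist_real_def)
    have "inj_on \<phi> {x-e..x+e}" using d(2) sub inj_on_subset by blast
    moreover have "continuous_on {x-e..x+e} \<phi>" using cont sub continuous_on_subset by (metis le_inf_iff)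
    ultimately have "(\<phi> (x-e) < \<phi> x \<and> \<phi> x < \<phi> (x+e)) \<or> (\<phi> (x+e) < \<phi> x \<and> \<phi> x < \<phi> (x-e))"
      using continuous_inj_imp_mono[of "x-e" x "x+e" \<phi>] e by auto
    moreover have "x - e \<in> {a..b}" "x + e \<in> {a..b}" using e by auto
    ultimately show False using ext by force
  qed
  have neq: "\<phi> a \<noteq> \<phi> b" if ab: "0 \<le> a" "a < b" for a b
  proof
    assume eq: "\<phi> a = \<phi> b"
    have "continuous_on {a..b} \<phi>" using cont ab by (auto intro: continuous_on_subset)
    moreover have "compact {a..b}" "{a..b} \<noteq> {}" using ab by auto
    ultimately obtain xM xm where "xM \<in> {a..b}" "\<forall>v\<in>{a..b}. \<phi> v \<le> \<phi> xM" "xm \<in> {a..b}" "\<forall>v\<in>{a..b}. \<phi> xm \<le> \<phi> v"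
      using continuous_attains_sup[of "{a..b}" \<phi>] continuous_attains_inf[of "{a..b}" \<phi>] by metis
    then have xM: "xM \<in> {a..b}" "\<And>v. v \<in> {a..b} \<Longrightarrow> \<phi> v \<le> \<phi> xM"
      and xm: "xm \<in> {a..b}" "\<And>v. v \<in> {a..b} \<Longrightarrow> \<phi> xm \<le> \<phi> v" by blast+
    consider "\<phi> xM \<noteq> \<phi> a" | "\<phi> xm \<noteq> \<phi> a" | "\<phi> xM = \<phi> a" "\<phi> xm = \<phi> a" by blast
    then show False
    proof cases
      case 1
      then have "a < xM" "xM < b" using xM(1) eq by (auto simp: less_le)
      then show False using no_extremum[of a xM b] xM ab by blast
    next
      case 2
      then have "a < xm" "xm < b" using xm(1) eq by (auto simp: less_le)
      then show False using no_extremum[of a xm b] xm ab by blast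
    next
      case 3
      then have "\<forall>v\<in>{a..b}. \<phi> v \<le> \<phi> ((a+b)/2)" using xM xm(2)[of "(a+b)/2"] ab by fastforce
      then show False using no_extremum[of a "(a+b)/2" b] ab by auto
    qed
  qed
  show ?thesis
  proof (rule inj_onI)
    fix x y assume "x \<in> {0..}" "y \<in> {0..}" "\<phi> x = \<phi> y"
    then show "x = y" using neq[of x y] neq[of y x] by (cases x y rule: linorder_cases) auto
  qed
qed

lemma bounded_mono_on_converges:
  fixes \<phi> :: "real \<Rightarrow> real"
  assumes mono: "\<And>u v. 0 \<le> u \<Longrightarrow> u \<le> v \<Longrightarrow> \<phi> u \<le> \<phi> v" and bdd: "\<And>u. 0 \<le> u \<Longrightarrow> \<phi> u \<le> K"
  shows "\<exists>L. (\<phi> \<longlongrightarrow> L) at_top"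
proof -
  have ba: "bdd_above (\<phi> ` {0..})" using bdd by (intro bdd_aboveI[of _ K]) auto
  have "(\<phi> \<longlongrightarrow> Sup (\<phi> ` {0..})) at_top"
  proof (rule increasing_tendsto)
    show "\<forall>\<^sub>F u in at_top. \<phi> u \<le> Sup (\<phi> ` {0..})"
      using eventually_ge_at_top[of 0] by eventually_elim (auto intro!: cSup_upper ba)
    fix x assume "x < Sup (\<phi> ` {0..})"
    then obtain u where u: "0 \<le> u" "x < \<phi> u" using less_cSup_iff[OF _ ba, of x] by auto
    show "\<forall>\<^sub>F v in at_top. x < \<phi> v"
      using eventually_ge_at_top[of u] by eventually_elim (use mono u in force)
  qed
  then show ?thesis ..
qed

lemma continuous_injective_ray:
  fixes \<phi> :: "real \<Rightarrow> real"
  assumes cont: "continuous_on {0..} \<phi>" and inj: "inj_on \<phi> {0..}"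
    and low: "\<And>u. 0 \<le> u \<Longrightarrow> l \<le> \<phi> u"
    and nolim: "\<And>L. \<not> (\<phi> \<longlongrightarrow> L) at_top"
  shows "\<phi> ` {0..} = {\<phi> 0..}"
proof -
  have mono3: "(\<phi> a < \<phi> x \<and> \<phi> x < \<phi> b) \<or> (\<phi> b < \<phi> x \<and> \<phi> x < \<phi> a)" if "0 \<le> a" "a < x" "x < b" for a x b
    using that by (intro continuous_inj_imp_mono continuous_on_subset[OF cont] inj_on_subset[OF inj]) auto
  have "\<phi> 0 < \<phi> 1"
  proof (rule ccontr)
    assume "\<not> \<phi> 0 < \<phi> 1"
    moreover have "\<phi> 0 \<noteq> \<phi> 1" using inj_onD[OF inj, of 0 1] by auto
    ultimately have d01: "\<phi> 1 < \<phi> 0" by simp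
    have d0: "\<phi> u < \<phi> 0" if "u > 0" for u
      using d01 mono3[of 0 u 1] mono3[of 0 1 u] that by (cases u "1::real" rule: linorder_cases) auto
    have "- \<phi> u \<le> - \<phi> v" if "0 \<le> u" "u \<le> v" for u v
      using mono3[of 0 u v] d0[of u] d0[of v] that by (cases "u = v"; cases "u = 0") auto
    then obtain L where "((\<lambda>u. - \<phi> u) \<longlongrightarrow> L) at_top"
      using bounded_mono_on_converges[of "\<lambda>u. - \<phi> u" "-l"] low by auto
    then have "(\<phi> \<longlongrightarrow> -L) at_top" using tendsto_minus by fastforce
    then show False using nolim by blast
  qed
  then have d0: "\<phi> 0 < \<phi> u" if "u > 0" for u
    using mono3[of 0 u 1] mono3[of 0 1 u] that by (cases u "1::real" rule: linorder_cases) auto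
  have mono: "\<phi> u \<le> \<phi> v" if "0 \<le> u" "u \<le> v" for u v
    using mono3[of 0 u v] d0[of u] d0[of v] that by (cases "u = v"; cases "u = 0") auto
  show ?thesis
  proof (intro equalityI subsetI)
    fix y assume "y \<in> {\<phi> 0..}"
    have "\<exists>v\<ge>0. y < \<phi> v"
    proof (rule ccontr)
      assume "\<not> ?thesis"
      then show False using bounded_mono_on_converges[of \<phi> y, OF mono] nolim by (meson not_less)
    qed
    then obtain v where v: "0 \<le> v" "y < \<phi> v" by blast
    have "\<exists>x. 0 \<le> x \<and> x \<le> v \<and> \<phi> x = y"
      using v \<open>y \<in> {\<phi> 0..}\<close> by (intro IVT' continuous_on_subset[OF cont]) auto
    then show "y \<in> \<phi> ` {0..}" by auto
  qed (use mono in auto)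
qed

text \<open>
  A homeomorphism \<open>\<psi>\<close> of the plane that straightens \<open>J\<close>, with inverse \<open>\<psi>'\<close>.
\<close>

locale bouquet_chart =
  fixes J :: "complex set" and \<psi> :: "complex \<Rightarrow> real \<times> real" and \<psi>' :: "real \<times> real \<Rightarrow> complex"
  assumes homeo: "homeomorphism UNIV UNIV \<psi> \<psi>'" and brush: "straight_brush (\<psi> ` J)"
begin

lemma inverses [simp]: "\<psi>' (\<psi> z) = z" "\<psi> (\<psi>' p) = p"
  using homeo unfolding homeomorphism_def by blast+

lemma charts_continuous: "continuous_on A \<psi>" "continuous_on A' \<psi>'"
  using homeo by (auto simp: homeomorphism_def intro: continuous_on_subset)

text \<open>
  The part of a hair from \<open>w\<close> to infinity, parametrised by the horizontal distance in the brush.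
\<close>

definition tail :: "complex \<Rightarrow> real \<Rightarrow> complex" where
  "tail w u = \<psi>' (fst (\<psi> w) + u, snd (\<psi> w))"

lemma tail_0 [simp]: "tail w 0 = w" by (simp add: tail_def)

lemma \<psi>_tail: "\<psi> (tail w u) = (fst (\<psi> w) + u, snd (\<psi> w))" by (simp add: tail_def)

lemma tail_continuous: "continuous_on A (tail w)"
  unfolding tail_def by (intro continuous_on_compose2[OF charts_continuous(2)[of UNIV]] continuous_intros) auto

lemma tail_inj: "inj_on (tail w) A"
  by (rule inj_onI) (metis \<psi>_tail add_left_cancel prod.inject)

lemma brush_quadrant:
  assumes "w \<in> J"
  shows "0 \<le> fst (\<psi> w)" "snd (\<psi> w) \<notin> \<rat>"
proof -
  have "\<psi> w \<in> {0..} \<times> (- \<rat>)" using brush assms unfolding straight_brush_def by blast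
  then show "0 \<le> fst (\<psi> w)" "snd (\<psi> w) \<notin> \<rat>" by (auto simp: mem_Times_iff)
qed

lemma tail_in:
  assumes w: "w \<in> J" and u: "0 \<le> u"
  shows "tail w u \<in> J"
proof -
  obtain t where t: "\<forall>(x, y) \<in> \<psi> ` J. t y \<ge> 0 \<and> {x'. (x', y) \<in> \<psi> ` J} = {t y..}"
    using brush unfolding straight_brush_def by blast
  have "(fst (\<psi> w), snd (\<psi> w)) \<in> \<psi> ` J" using w by simp
  then have eq: "{x'. (x', snd (\<psi> w)) \<in> \<psi> ` J} = {t (snd (\<psi> w))..}" using t by blast
  moreover have "fst (\<psi> w) \<in> {x'. (x', snd (\<psi> w)) \<in> \<psi> ` J}" using w by simp
  ultimately have "fst (\<psi> w) + u \<in> {x'. (x', snd (\<psi> w)) \<in> \<psi> ` J}" using u by simp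
  then have "\<psi> (tail w u) \<in> \<psi> ` J" by (simp add: \<psi>_tail)
  then show ?thesis by (metis imageE inverses(1))
qed

lemma closed_J: "closed J"
proof -
  have "J = \<psi> -` (\<psi> ` J)" by auto (metis inverses(1))
  moreover have "closed (\<psi> ` J)" using brush by (simp add: straight_brush_def)
  ultimately show ?thesis using closed_vimage charts_continuous(1)[of UNIV] by metis
qed

text \<open>
  The source of uniform escape.  If a tail meets \<open>cball 0 M\<close>, then in the brush its initial point
  lies to the left of a point of a fixed compact set, on the same horizontal line; as the brush lies in
  the right half-plane, this confines the initial point to a compact set.
\<close>

lemma tail_far:
  obtains M' where "\<And>w u. w \<in> J \<Longrightarrow> M' < cmod w \<Longrightarrow> 0 \<le> u \<Longrightarrow> M < cmod (tail w u)"
proof -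
  have "bounded (\<psi> ` cball 0 M)"
    by (intro compact_imp_bounded compact_continuous_image charts_continuous compact_cball)
  then obtain L where L: "\<And>z. cmod z \<le> M \<Longrightarrow> norm (\<psi> z) \<le> L" 
    unfolding bounded_iff by (metis imageI mem_cball_0)
  have "bounded (\<psi>' ` cball 0 (2 * L))"
    by (intro compact_imp_bounded compact_continuous_image charts_continuous compact_cball)
  then obtain M' where M': "\<And>p. norm p \<le> 2 * L \<Longrightarrow> cmod (\<psi>' p) \<le> M'" 
    unfolding bounded_iff by (metis imageI mem_cball_0)
  have "M < cmod (tail w u)" if "w \<in> J" "M' < cmod w" "0 \<le> u" for w u
  proof (rule ccontr)
    assume "\<not> M < cmod (tail w u)"
    then have le: "norm (fst (\<psi> w) + u, snd (\<psi> w)) \<le> L" using L[of "tail w u"] by (simp add: \<psi>_tail)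
    have "norm (\<psi> w) \<le> \<bar>fst (\<psi> w)\<bar> + \<bar>snd (\<psi> w)\<bar>"
      using norm_Pair_le[of "fst (\<psi> w)" "snd (\<psi> w)"] by simp
    moreover have "\<bar>fst (\<psi> w)\<bar> \<le> \<bar>fst (\<psi> w) + u\<bar>" using brush_quadrant[OF that(1)] that(3) by simp
    moreover have "\<bar>fst (\<psi> w) + u\<bar> \<le> L" "\<bar>snd (\<psi> w)\<bar> \<le> L"
      using le norm_fst_le[of "fst (\<psi> w) + u" "snd (\<psi> w)"] norm_snd_le[of "snd (\<psi> w)" "fst (\<psi> w) + u"]
      by auto
    ultimately have "norm (\<psi> w) \<le> 2 * L" by linarith
    then have "cmod w \<le> M'" using M'[of "\<psi> w"] by simp
    then show False using that by simp
  qed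
  then show thesis using that by blast
qed

lemma curve_to_infinity_tail: "curve_to_infinity (tail w)"
  unfolding curve_to_infinity_def
proof
  show "filterlim (tail w) at_infinity at_top"
  proof (rule filterlim_at_infinityI_norm_gt)
    fix R
    have "bounded (\<psi> ` cball 0 R)"
      by (intro compact_imp_bounded compact_continuous_image charts_continuous compact_cball)
    then obtain L where L: "\<And>z. cmod z \<le> R \<Longrightarrow> norm (\<psi> z) \<le> L" 
    unfolding bounded_iff by (metis imageI mem_cball_0)
    show "\<forall>\<^sub>F u in at_top. R < cmod (tail w u)"
      using eventually_gt_at_top[of "L - fst (\<psi> w)"]
    proof eventually_elim
      case (elim u)
      show ?case
      proof (rule ccontr)
        assume "\<not> R < cmod (tail w u)"
        then have "norm (fst (\<psi> w) + u, snd (\<psi> w)) \<le> L" using L[of "tail w u"] by (simp add: \<psi>_tail)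
        then have "\<bar>fst (\<psi> w) + u\<bar> \<le> L"
          using norm_fst_le[of "fst (\<psi> w) + u" "snd (\<psi> w)"] by auto
        then show False using elim by linarith
      qed
    qed
  qed
qed (rule tail_continuous)

text \<open>
  In the brush, the image of the tail at \<open>w\<close> moves on the hair of \<open>g w\<close> and is described by its
  first coordinate \<open>\<phi>\<close>.  Critical values lie outside \<open>J\<close>, so \<open>\<phi>\<close> is locally injective.  It cannot converge,
  since a limit would give an asymptotic value in \<open>J\<close>.  Hence it increases from \<open>\<phi> 0\<close> to infinity.
\<close>

lemma tail_image:
  assumes g: "g holomorphic_on UNIV" and inv: "\<And>z. z \<in> J \<Longrightarrow> g z \<in> J"
    and sing: "\<And>z. z \<in> singular_set g \<Longrightarrow> z \<notin> J" and w: "w \<in> J"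
  shows "inj_on (g \<circ> tail w) {0..}" "(g \<circ> tail w) ` {0..} = tail (g w) ` {0..}"
proof -
  have cg: "continuous_on A g" for A
    using g holomorphic_on_imp_continuous_on holomorphic_on_subset by blast
  define \<Theta> where "\<Theta> u = \<psi> (g (tail w u))" for u
  define \<phi> where "\<phi> u = fst (\<Theta> u)" for u
  define y' where "y' = snd (\<psi> (g w))"
  have \<Theta>_cont: "continuous_on A \<Theta>" for A
    unfolding \<Theta>_def
    by (intro continuous_on_compose2[OF charts_continuous(1)[of UNIV]] continuous_on_compose2[OF cg[of UNIV]] tail_continuous) auto
  have \<phi>_cont: "continuous_on A \<phi>" for A unfolding \<phi>_def by (intro continuous_intros \<Theta>_cont)
  have gJ: "g (tail w u) \<in> J" if "0 \<le> u" for u using inv tail_in[OF w that] by blast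
  have snd: "snd (\<Theta> u) = y'" if "0 \<le> u" for u
  proof (rule ccontr)
    assume ne: "snd (\<Theta> u) \<noteq> y'"
    have conn: "connected ((\<lambda>u. snd (\<Theta> u)) ` {0..})"
      by (intro connected_continuous_image continuous_intros \<Theta>_cont) (simp add: convex_connected)
    have mem: "snd (\<Theta> u) \<in> (\<lambda>u. snd (\<Theta> u)) ` {0..}" "y' \<in> (\<lambda>u. snd (\<Theta> u)) ` {0..}"
      using that by (auto simp: y'_def \<Theta>_def intro: rev_image_eqI[of 0])
    have "min (snd (\<Theta> u)) y' < max (snd (\<Theta> u)) y'" using ne by linarith
    from Rats_dense_in_real[OF this] obtain q where q: "q \<in> \<rat>" "min (snd (\<Theta> u)) y' < q" "q < max (snd (\<Theta> u)) y'"
      by blast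
    have "q \<in> (\<lambda>u. snd (\<Theta> u)) ` {0..}"
      using connectedD_interval[OF conn mem, of q] connectedD_interval[OF conn mem(2,1), of q] q by linarith
    then obtain v where "0 \<le> v" "q = snd (\<psi> (g (tail w v)))" by (auto simp: \<Theta>_def)
    then show False using brush_quadrant(2)[OF gJ] q by simp
  qed
  have rep: "g (tail w u) = \<psi>' (\<phi> u, y')" if "0 \<le> u" for u
  proof -
    have "(\<phi> u, y') = \<Theta> u" using snd[OF that] by (simp add: \<phi>_def prod_eq_iff)
    then show ?thesis by (simp add: \<Theta>_def)
  qed
  have inj\<phi>: "inj_on \<phi> {0..}"
  proof (rule locally_injective_imp_injective[OF \<phi>_cont])
    fix u :: real assume u: "0 \<le> u"
    have "deriv g (tail w u) \<noteq> 0" using sing gJ[OF u] by (intro regular_if_not_singular) auto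
    then obtain r where r: "r > 0" "inj_on g (ball (tail w u) r)"
      using has_complex_derivative_locally_injective[OF g _ open_UNIV] by blast
    have "open (tail w -` ball (tail w u) r)" by (intro open_vimage tail_continuous) auto
    then obtain d where d: "d > 0" "ball u d \<subseteq> tail w -` ball (tail w u) r"
      using r by (metis centre_in_ball open_contains_ball vimage_eq)
    have "inj_on \<phi> ({0..} \<inter> ball u d)"
    proof (rule inj_onI)
      fix a b assume ab: "a \<in> {0..} \<inter> ball u d" "b \<in> {0..} \<inter> ball u d" "\<phi> a = \<phi> b"
      then have "g (tail w a) = g (tail w b)" using rep[of a] rep[of b] by simp
      moreover have "tail w a \<in> ball (tail w u) r" "tail w b \<in> ball (tail w u) r" using ab d by blast+
      ultimately have "tail w a = tail w b" using r(2) by (auto simp: inj_on_def)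
      then show "a = b" using tail_inj[of w UNIV] by (auto simp: inj_on_def)
    qed
    then show "\<exists>d>0. inj_on \<phi> ({0..} \<inter> ball u d)" using d by blast
  qed
  have nolim: "\<not> (\<phi> \<longlongrightarrow> L) at_top" for L
  proof
    assume L: "(\<phi> \<longlongrightarrow> L) at_top"
    have "isCont \<psi>' (L, y')" using charts_continuous(2)[of UNIV] by (simp add: continuous_on_eq_continuous_at)
    then have "((\<lambda>u. \<psi>' (\<phi> u, y')) \<longlongrightarrow> \<psi>' (L, y')) at_top"
      by (rule isCont_tendsto_compose) (intro tendsto_intros L)
    moreover have "\<forall>\<^sub>F u in at_top. \<psi>' (\<phi> u, y') = g (tail w u)"
      using eventually_ge_at_top[of 0] by eventually_elim (simp add: rep)
    ultimately have lim: "((g \<circ> tail w) \<longlongrightarrow> \<psi>' (L, y')) at_top"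
      unfolding o_def by (rule Lim_transform_eventually)
    then have "\<psi>' (L, y') \<in> asymptotic_values g"
      using curve_to_infinity_tail unfolding asymptotic_values_def by blast
    then have "\<psi>' (L, y') \<in> singular_set g"
      unfolding singular_set_def by (intro subsetD[OF closure_subset]) simp
    moreover have "\<psi>' (L, y') \<in> J"
    proof (rule Lim_in_closed_set[OF closed_J _ _ lim])
      show "\<forall>\<^sub>F u in at_top. (g \<circ> tail w) u \<in> J"
        using eventually_ge_at_top[of 0] by eventually_elim (simp add: gJ)
    qed auto
    ultimately show False using sing by blast
  qed
  have low: "0 \<le> \<phi> u" if "0 \<le> u" for u using brush_quadrant(1)[OF gJ[OF that]] by (simp add: \<phi>_def \<Theta>_def)
  have img: "\<phi> ` {0..} = {\<phi> 0..}" by (rule continuous_injective_ray[OF \<phi>_cont inj\<phi> low nolim])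
  show "inj_on (g \<circ> tail w) {0..}"
  proof (rule inj_onI)
    fix a b assume ab: "a \<in> {0..}" "b \<in> {0..}" "(g \<circ> tail w) a = (g \<circ> tail w) b"
    then have "\<phi> a = \<phi> b" by (simp add: \<phi>_def \<Theta>_def)
    then show "a = b" using inj\<phi> ab by (auto simp: inj_on_def)
  qed
  have "(g \<circ> tail w) ` {0..} = (\<lambda>x. \<psi>' (x, y')) ` (\<phi> ` {0..})"
    unfolding image_image by (rule image_cong) (auto simp: rep)
  also have "\<dots> = (\<lambda>x. \<psi>' (x, y')) ` ((\<lambda>u. \<phi> 0 + u) ` {0..})"
    unfolding img by (simp add: image_add_atLeast)
  also have "\<dots> = tail (g w) ` {0..}"
    unfolding image_image by (rule image_cong) (auto simp: tail_def y'_def \<phi>_def \<Theta>_def)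
  finally show "(g \<circ> tail w) ` {0..} = tail (g w) ` {0..}" .
qed


text \<open>
  The iterates of a tail come with parametrisations of their own; these, too, tend to infinity at
  the end of the parameter interval.
\<close>

lemma curve_onto_tail_to_infinity:
  assumes c: "continuous_on {0..} c" "inj_on c {0..}" "c ` {0..} = tail w ` {0..}"
  shows "curve_to_infinity c"
proof -
  define h where "h s = fst (\<psi> (c s))" for s
  have h_cont: "continuous_on {0..} h"
    unfolding h_def by (intro continuous_intros continuous_on_compose2[OF charts_continuous(1)[of UNIV] c(1)]) auto
  have rep: "\<exists>u\<ge>0. c s = tail w u \<and> h s = fst (\<psi> w) + u" if "0 \<le> s" for s
  proof -
    have "c s \<in> tail w ` {0..}" using c(3) that by blast
    then show ?thesis by (auto simp: h_def \<psi>_tail)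
  qed
  have h_inj: "inj_on h {0..}"
  proof (rule inj_onI)
    fix a b :: real assume ab: "a \<in> {0..}" "b \<in> {0..}" "h a = h b"
    then have "c a = c b" using rep[of a] rep[of b] by auto
    then show "a = b" using inj_onD[OF c(2)] ab by blast
  qed
  have h_top: "filterlim h at_top at_top"
    unfolding filterlim_at_top
  proof
    fix Z :: real
    \<comment> \<open>A point of the tail where \<open>h\<close> exceeds both \<open>Z\<close> and \<open>h 0\<close>: beyond it \<open>h\<close> can only increase.\<close>
    define u where "u = \<bar>Z\<bar> + \<bar>h 0\<bar> + \<bar>fst (\<psi> w)\<bar> + 1"
    have "tail w u \<in> c ` {0..}" using c(3) by (auto simp: u_def)
    then obtain s0 where s0: "0 \<le> s0" "c s0 = tail w u" by auto
    have big: "Z < h s0" "h 0 < h s0" using s0 by (auto simp: h_def \<psi>_tail) (auto simp: u_def h_def)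
    show "\<forall>\<^sub>F s in at_top. Z \<le> h s"
      using eventually_gt_at_top[of s0]
    proof eventually_elim
      case (elim s)
      have "s0 \<noteq> 0" using big by auto
      then have "(h 0 < h s0 \<and> h s0 < h s) \<or> (h s < h s0 \<and> h s0 < h 0)"
        using elim s0 by (intro continuous_inj_imp_mono continuous_on_subset[OF h_cont] inj_on_subset[OF h_inj]) auto
      then show ?case using big by linarith
    qed
  qed
  show ?thesis
    unfolding curve_to_infinity_def
  proof
    show "filterlim c at_infinity at_top"
    proof (rule filterlim_at_infinityI_norm_gt)
      fix R
      have "bounded (\<psi> ` cball 0 R)"
        by (intro compact_imp_bounded compact_continuous_image charts_continuous compact_cball)
      then obtain L where L: "\<And>z. cmod z \<le> R \<Longrightarrow> norm (\<psi> z) \<le> L"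
        unfolding bounded_iff by (metis imageI mem_cball_0)
      have "\<forall>\<^sub>F s in at_top. L < h s" using h_top by (simp add: filterlim_at_top_dense)
      then show "\<forall>\<^sub>F s in at_top. R < cmod (c s)"
      proof eventually_elim
        case (elim s)
        have "h s \<le> norm (\<psi> (c s))"
          using norm_fst_le[of "fst (\<psi> (c s))" "snd (\<psi> (c s))"] by (simp add: h_def)
        then show ?case using L[of "c s"] elim by linarith
      qed
    qed
  qed (rule c(1))
qed

end

section \<open>Lifting arcs through critical values\<close>

lemma filterlim_at_infinity_of_image:
  fixes f :: "complex \<Rightarrow> complex"
  assumes f: "f holomorphic_on UNIV" and lim: "filterlim (\<lambda>x. f (q x)) at_infinity F"
  shows "filterlim q at_infinity F"
  unfolding filterlim_at_infinity[OF order_refl]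
proof (intro allI impI)
  fix R :: real
  have "compact (f ` cball 0 R)"
    using f by (intro compact_continuous_image compact_cball)
      (auto intro!: holomorphic_on_imp_continuous_on intro: holomorphic_on_subset)
  then obtain C where C: "\<And>z. cmod z \<le> R \<Longrightarrow> cmod (f z) \<le> C"
    using compact_imp_bounded[of "f ` cball 0 R"] unfolding bounded_iff by (metis imageI mem_cball_0)
  have "eventually (\<lambda>x. max C 0 + 1 \<le> cmod (f (q x))) F"
    using lim unfolding filterlim_at_infinity[OF order_refl] by auto
  then show "eventually (\<lambda>x. R \<le> cmod (q x)) F"
  proof eventually_elim
    case (elim x)
    then show ?case using C[of "q x"] by linarith
  qed
qed

text \<open>
  Up to a local change of coordinates \<open>w \<mapsto> (w - z) * G w\<close>, an entire function is a power.
\<close>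

lemma entire_local_power_form:
  assumes f: "f holomorphic_on UNIV" "\<not> f constant_on UNIV"
  obtains n G r where "0 < n" "0 < r" "G holomorphic_on ball z r"
    "\<And>w. w \<in> ball z r \<Longrightarrow> f w - f z = ((w - z) * G w) ^ n" "G z \<noteq> 0"
proof -
  have "\<exists>n>0. (deriv ^^ n) f z \<noteq> 0"
  proof (rule ccontr)
    assume "\<not> ?thesis"
    then have "f w = f z" for w
      using holomorphic_fun_eq_const_on_connected[OF f(1) open_UNIV connected_UNIV _ UNIV_I UNIV_I] by blast
    then show False using f(2) by (auto simp: constant_on_def)
  qed
  define n where "n = (LEAST n. 0 < n \<and> (deriv ^^ n) f z \<noteq> 0)"
  have n: "0 < n" "(deriv ^^ n) f z \<noteq> 0"
    unfolding n_def using LeastI_ex[OF \<open>\<exists>n>0. (deriv ^^ n) f z \<noteq> 0\<close>] by blast+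
  have least: "(deriv ^^ i) f z = 0" if "0 < i" "i < n" for i
    using not_less_Least[of i "\<lambda>n. 0 < n \<and> (deriv ^^ n) f z \<noteq> 0"] that unfolding n_def by blast
  obtain G r where "0 < r" "G holomorphic_on ball z r"
    "\<And>w. w \<in> ball z r \<Longrightarrow> f w - f z = ((w - z) * G w) ^ n" "\<And>w. w \<in> ball z r \<Longrightarrow> G w \<noteq> 0"
    using holomorphic_factor_order_of_zero_strong[OF f(1) open_UNIV UNIV_I n least] by metis
  then show thesis using that[of n r G] n(1) by simp
qed

text \<open>
  Injectivity of the arc ensures that \<open>p t - p t0\<close> vanishes only at \<open>t0\<close>, so that beyond \<open>t0\<close> a root is
  obtained from a continuous logarithm.
\<close>

lemma continuous_root_of_arc:
  fixes p :: "real \<Rightarrow> complex"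
  assumes p: "continuous_on {t0..<t1} p" "inj_on p {t0..<t1}" and t: "t0 < t1" and n: "0 < n"
  obtains u where "continuous_on {t0..<t1} u" "u t0 = 0" "\<And>t. t \<in> {t0..<t1} \<Longrightarrow> u t ^ n = p t - p t0"
proof -
  have nz: "p t - p t0 \<noteq> 0" if "t \<in> {t0<..<t1}" for t
    using inj_onD[OF p(2), of t t0] that by auto
  have "continuous_on {t0<..<t1} (\<lambda>t. p t - p t0)"
    by (intro continuous_intros continuous_on_subset[OF p(1)]) auto
  moreover have "contractible {t0<..<t1}" by (intro convex_imp_contractible convex_real_interval)
  ultimately obtain L where L: "continuous_on {t0<..<t1} L" "\<And>t. t \<in> {t0<..<t1} \<Longrightarrow> p t - p t0 = exp (L t)"
    using continuous_logarithm_on_contractible[of "{t0<..<t1}" "\<lambda>t. p t - p t0"] nz by metis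
  define u where "u t = (if t = t0 then 0 else exp (L t / of_nat n))" for t
  have un: "u t ^ n = p t - p t0" if "t \<in> {t0..<t1}" for t
  proof (cases "t = t0")
    case False
    then have "u t ^ n = exp (L t / of_nat n) ^ n" by (simp add: u_def)
    also have "\<dots> = exp (of_nat n * (L t / of_nat n))" by (simp only: exp_of_nat_mult)
    also have "\<dots> = exp (L t)" using n by simp
    finally show ?thesis using L(2)[of t] that False by simp
  qed (use n in \<open>simp add: u_def\<close>)
  have norm_u: "cmod (u t) = root n (cmod (p t - p t0))" if "t \<in> {t0..<t1}" for t
  proof -
    have "cmod (p t - p t0) = cmod (u t) ^ n" using un[OF that] by (metis norm_power)
    then show ?thesis using n by (simp add: real_root_power_cancel)
  qed
  have "(u \<longlongrightarrow> u x) (at x within {t0..<t1})" if x: "x \<in> {t0..<t1}" for x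
  proof (cases "x = t0")
    case True
    have "((\<lambda>t. root n (cmod (p t - p t0))) \<longlongrightarrow> root n (cmod (p t0 - p t0))) (at t0 within {t0..<t1})"
      using p(1) t by (intro tendsto_intros) (auto simp: continuous_on_def)
    then have "((\<lambda>t. cmod (u t)) \<longlongrightarrow> 0) (at t0 within {t0..<t1})"
      using n by (subst Lim_cong_within[OF refl refl refl norm_u]) auto
    then have "(u \<longlongrightarrow> 0) (at t0 within {t0..<t1})" by (rule tendsto_norm_zero_cancel)
    moreover have "u t0 = 0" by (simp add: u_def)
    ultimately show ?thesis using True by simp
  next
    case False
    then have xin: "x \<in> {t0<..<t1}" using x by auto
    have "continuous_on {t0<..<t1} (\<lambda>t. exp (L t / of_nat n))"
      using n by (intro continuous_intros L) auto
    then have "continuous_on {t0<..<t1} u"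
      by (rule continuous_on_eq) (auto simp: u_def)
    then have "isCont u x" using xin by (simp add: continuous_on_eq_continuous_at)
    then have "continuous (at x within {t0..<t1}) u" by (rule continuous_at_imp_continuous_at_within)
    then show ?thesis by (simp add: continuous_within)
  qed
  then have "continuous_on {t0..<t1} u" by (simp add: continuous_on_def)
  then show thesis using that un by (simp add: u_def)
qed

lemma local_lift_of_arc:
  fixes p :: "real \<Rightarrow> complex"
  assumes f: "f holomorphic_on UNIV" "\<not> f constant_on UNIV"
    and p: "continuous_on {t0..<t1} p" "inj_on p {t0..<t1}" and t: "t0 < t1" and z: "f z = p t0"
  obtains \<epsilon> q where "0 < \<epsilon>" "t0 + \<epsilon> \<le> t1" "continuous_on {t0..<t0+\<epsilon>} q" "q t0 = z"
    "\<And>t. t \<in> {t0..<t0+\<epsilon>} \<Longrightarrow> f (q t) = p t"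
proof -
  obtain n G r where G: "0 < n" "0 < r" "G holomorphic_on ball z r"
    "\<And>w. w \<in> ball z r \<Longrightarrow> f w - f z = ((w - z) * G w) ^ n" "G z \<noteq> 0"
    using entire_local_power_form[OF f] by metis
  define k where "k w = (w - z) * G w" for w
  have kh: "k holomorphic_on ball z r" unfolding k_def by (intro holomorphic_intros G)
  have zb: "z \<in> ball z r" using G by simp
  have "(G has_field_derivative deriv G z) (at z)" using holomorphic_derivI[OF G(3) open_ball zb] .
  then have "(k has_field_derivative G z) (at z)"
    unfolding k_def by (auto intro!: derivative_eq_intros)
  then have dk: "deriv k z \<noteq> 0" using G(5) DERIV_imp_deriv by metis
  obtain s where s: "s > 0" "ball z s \<subseteq> ball z r" "open (k ` ball z s)" "inj_on k (ball z s)"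
    using has_complex_derivative_locally_invertible[OF kh zb open_ball dk] by metis
  obtain \<kappa> where \<kappa>: "\<kappa> holomorphic_on k ` ball z s" "\<And>w. w \<in> ball z s \<Longrightarrow> \<kappa> (k w) = w"
    using holomorphic_has_inverse[OF holomorphic_on_subset[OF kh s(2)] open_ball s(4)] by metis
  have "0 \<in> k ` ball z s" using s(1) by (intro image_eqI[of _ _ z]) (auto simp: k_def)
  then obtain \<delta> where \<delta>: "\<delta> > 0" "ball 0 \<delta> \<subseteq> k ` ball z s"
    using s(3) by (meson open_contains_ball)
  obtain u where u: "continuous_on {t0..<t1} u" "u t0 = 0" "\<And>t. t \<in> {t0..<t1} \<Longrightarrow> u t ^ n = p t - p t0"
    using continuous_root_of_arc[OF p t G(1)] by metis
  obtain d where d: "d > 0" "\<And>x. x \<in> {t0..<t1} \<Longrightarrow> dist x t0 < d \<Longrightarrow> dist (u x) (u t0) < \<delta>"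
    using u(1) t \<delta>(1) unfolding continuous_on_iff by (metis atLeastLessThan_iff order_refl)
  define \<epsilon> where "\<epsilon> = min d (t1 - t0)"
  have \<epsilon>: "0 < \<epsilon>" "t0 + \<epsilon> \<le> t1" "\<epsilon> \<le> d" using d t by (auto simp: \<epsilon>_def)
  have uV: "u x \<in> k ` ball z s" if "x \<in> {t0..<t0+\<epsilon>}" for x
  proof -
    have "dist (u x) (u t0) < \<delta>" using that \<epsilon> by (intro d(2)) (auto simp: dist_real_def)
    then have "u x \<in> ball 0 \<delta>" by (simp add: u(2) dist_commute)
    then show ?thesis using \<delta>(2) by blast
  qed
  show thesis
  proof (rule that[of \<epsilon> "\<lambda>t. \<kappa> (u t)"])
    show "continuous_on {t0..<t0+\<epsilon>} (\<lambda>t. \<kappa> (u t))"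
      by (rule continuous_on_compose2[OF holomorphic_on_imp_continuous_on[OF \<kappa>(1)] continuous_on_subset[OF u(1)]])
        (use uV \<epsilon> in auto)
    have "k z = 0" by (simp add: k_def)
    then show "\<kappa> (u t0) = z" using \<kappa>(2)[of z] s(1) u(2) by simp
    fix t assume tt: "t \<in> {t0..<t0+\<epsilon>}"
    obtain w where w: "w \<in> ball z s" "u t = k w" using uV[OF tt] by blast
    have "f (\<kappa> (u t)) - f z = (k w) ^ n" using G(4)[of w] w s(2) \<kappa>(2) by (auto simp: k_def)
    also have "\<dots> = p t - p t0" using u(3)[of t] tt \<epsilon> w by simp
    finally show "f (\<kappa> (u t)) = p t" using z by simp
  qed (use \<epsilon> in auto)
qed

text \<open>
  At a critical point the lift can be continued in several ways, so a maximal lift is taken from Zorn's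
  lemma, applied to graphs.  It ends at infinity: at a finite limit it could be continued.
\<close>

lemma maximal_lift_of_arc:
  fixes p :: "real \<Rightarrow> complex"
  assumes f: "f holomorphic_on UNIV" "\<not> f constant_on UNIV"
    and p: "continuous_on {0..<1} p" "inj_on p {0..<1}" "filterlim p at_infinity (at_left 1)" and z: "f z = p 0"
  obtains b q where "0 < b" "b \<le> 1" "continuous_on {0..<b} q" "q 0 = z"
    "\<And>t. t \<in> {0..<b} \<Longrightarrow> f (q t) = p t" "filterlim q at_infinity (at_left b)"
proof -
  define lifts where "lifts b q \<longleftrightarrow> 0 < b \<and> b \<le> 1 \<and> continuous_on {0..<b} q \<and> q 0 = z \<and> (\<forall>t\<in>{0..<b}. f (q t) = p t)"
    for b :: real and q
  define gr where "gr b q = (\<lambda>t. (t, q t)) ` {0..<b}" for b :: real and q :: "real \<Rightarrow> complex"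
  define \<A> where "\<A> = {gr b q |b q. lifts b q}"
  have "\<exists>M\<in>\<A>. \<forall>X\<in>\<A>. M \<subseteq> X \<longrightarrow> X = M"
  proof (rule subset_Zorn_nonempty)
    obtain \<epsilon> q where "0 < \<epsilon>" "0 + \<epsilon> \<le> 1" "continuous_on {0..<0+\<epsilon>} q" "q 0 = z"
      "\<And>t. t \<in> {0..<0+\<epsilon>} \<Longrightarrow> f (q t) = p t"
      using local_lift_of_arc[OF f p(1,2) zero_less_one z] by metis
    then have "lifts \<epsilon> q" by (simp add: lifts_def)
    then show "\<A> \<noteq> {}" by (auto simp: \<A>_def)
  next
    fix \<C> assume ne: "\<C> \<noteq> {}" and chain: "subset.chain \<A> \<C>"
    have memb: "\<exists>b q. X = gr b q \<and> lifts b q" if "X \<in> \<C>" for X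
      using chain that by (auto simp: subset.chain_def \<A>_def)
    have single: "v = v'" if vv: "(t, v) \<in> \<Union>\<C>" "(t, v') \<in> \<Union>\<C>" for t v v'
    proof -
      obtain X X' where X: "X \<in> \<C>" "(t, v) \<in> X" "X' \<in> \<C>" "(t, v') \<in> X'" using vv by blast
      then have "X \<subseteq> X' \<or> X' \<subseteq> X" using chain by (auto simp: subset_chain_def)
      then obtain Y where "Y \<in> \<C>" "(t, v) \<in> Y" "(t, v') \<in> Y" using X by blast
      then show ?thesis using memb[of Y] by (auto simp: gr_def)
    qed
    define D where "D = {b. \<exists>q. lifts b q \<and> gr b q \<in> \<C>}"
    define b where "b = Sup D"
    define q where "q t = (THE v. (t, v) \<in> \<Union>\<C>)" for t
    have Dne: "D \<noteq> {}" using ne memb by (fastforce simp: D_def)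
    have D01: "0 < d" "d \<le> 1" if "d \<in> D" for d using that by (auto simp: D_def lifts_def)
    then have Dbdd: "bdd_above D" by (intro bdd_aboveI[of _ 1])
    have q_eq: "q t = q' t" if "gr b' q' \<in> \<C>" "0 \<le> t" "t < b'" for t b' q'
    proof -
      have "(t, q' t) \<in> \<Union>\<C>" using that by (auto simp: gr_def intro!: bexI[of _ "gr b' q'"])
      then show ?thesis unfolding q_def using single by blast
    qed
    have below: "\<exists>b' q'. lifts b' q' \<and> gr b' q' \<in> \<C> \<and> t < b'" if "t < b" for t
      using less_cSup_iff[OF Dne Dbdd, of t] that by (auto simp: b_def D_def)
    have D_le: "d \<le> b" if "d \<in> D" for d unfolding b_def by (rule cSup_upper[OF that Dbdd])
    have b0: "0 < b" using Dne D01 D_le by (meson ex_in_conv less_le_trans)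
    have b1: "b \<le> 1" unfolding b_def using Dne D01 by (intro cSup_least) auto
    have "(q \<longlongrightarrow> q t) (at t within {0..<b})" if t: "t \<in> {0..<b}" for t
    proof -
      obtain b' q' where b': "lifts b' q'" "gr b' q' \<in> \<C>" "t < b'" using below[of t] t by auto
      have "b' \<le> b" using b' by (intro D_le) (auto simp: D_def)
      have eq: "at t within {0..<b} = at t within {0..<b'}"
        by (rule at_within_nhd[of t "{..<b'}"]) (use b' \<open>b' \<le> b\<close> in auto)
      have "(q' \<longlongrightarrow> q' t) (at t within {0..<b'})"
        using b' t by (auto simp: lifts_def continuous_on_def)
      then have "(q \<longlongrightarrow> q' t) (at t within {0..<b'})"
        by (rule Lim_transform_eventually) (use q_eq[OF b'(2)] in \<open>auto simp: eventually_at_filter\<close>)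
      then show ?thesis using q_eq[OF b'(2), of t] b' t eq by simp
    qed
    then have "continuous_on {0..<b} q" by (simp add: continuous_on_def)
    moreover have "q 0 = z" "\<forall>t\<in>{0..<b}. f (q t) = p t"
    proof -
      show "q 0 = z" using below[OF b0] q_eq by (auto simp: lifts_def)
      show "\<forall>t\<in>{0..<b}. f (q t) = p t"
      proof
        fix t assume t: "t \<in> {0..<b}"
        then obtain b' q' where b': "lifts b' q'" "gr b' q' \<in> \<C>" "t < b'" using below[of t] by auto
        then show "f (q t) = p t" using q_eq[OF b'(2), of t] t by (auto simp: lifts_def)
      qed
    qed
    ultimately have "lifts b q" using b0 b1 by (simp add: lifts_def)
    moreover have "\<Union>\<C> = gr b q"
    proof (intro equalityI subsetI)
      fix x assume "x \<in> \<Union>\<C>"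
      then obtain X where X: "X \<in> \<C>" "x \<in> X" by blast
      then obtain b' q' where b': "X = gr b' q'" "lifts b' q'" using memb by blast
      then obtain t where t: "0 \<le> t" "t < b'" "x = (t, q' t)" using X by (auto simp: gr_def)
      have "b' \<le> b" using b' X by (intro D_le) (auto simp: D_def)
      then show "x \<in> gr b q" using t q_eq[of b' q' t] b' X by (auto simp: gr_def)
    next
      fix x assume "x \<in> gr b q"
      then obtain t where t: "0 \<le> t" "t < b" "x = (t, q t)" by (auto simp: gr_def)
      obtain b' q' where b': "lifts b' q'" "gr b' q' \<in> \<C>" "t < b'" using below[OF t(2)] by auto
      then have "x \<in> gr b' q'" using t q_eq[OF b'(2), of t] by (auto simp: gr_def)
      then show "x \<in> \<Union>\<C>" using b' by blast
    qed
    ultimately show "\<Union>\<C> \<in> \<A>" by (auto simp: \<A>_def)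
  qed
  then obtain M where M: "M \<in> \<A>" "\<And>X. X \<in> \<A> \<Longrightarrow> M \<subseteq> X \<Longrightarrow> X = M" by blast
  then obtain b q where bq: "lifts b q" "M = gr b q" by (auto simp: \<A>_def)
  have max: "gr b' q' = gr b q" if "lifts b' q'" "gr b q \<subseteq> gr b' q'" for b' q'
  proof -
    have "gr b' q' \<in> \<A>" using that(1) unfolding \<A>_def by blast
    then show ?thesis using M(2) that(2) bq(2) by blast
  qed
  have b: "0 < b" "b \<le> 1" "continuous_on {0..<b} q" "q 0 = z" "\<And>t. t \<in> {0..<b} \<Longrightarrow> f (q t) = p t"
    using bq by (auto simp: lifts_def)
  have ev: "\<forall>\<^sub>F t in at_left b. t \<in> {0<..<b}" using b(1) by (intro eventually_at_left_real) auto
  have "filterlim q at_infinity (at_left b)"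
  proof (cases "b = 1")
    case True
    have "filterlim (\<lambda>t. f (q t)) at_infinity (at_left b)"
      by (rule filterlim_mono_eventually[OF p(3)]) (use ev True b(5) in \<open>auto elim!: eventually_mono\<close>)
    then show ?thesis by (rule filterlim_at_infinity_of_image[OF f(1)])
  next
    case False
    then have b1: "b < 1" using b by simp
    have "continuous_on {0<..<1} p" using p(1) by (rule continuous_on_subset) auto
    then have "isCont p b" using b(1) b1 by (simp add: continuous_on_eq_continuous_at)
    then have pb: "(p \<longlongrightarrow> p b) (at_left b)" by (simp add: isCont_def filterlim_at_split)
    have lim: "((\<lambda>t. f (q t)) \<longlongrightarrow> p b) (at_left b)"
      by (rule Lim_transform_eventually[OF pb]) (use ev b(5) in \<open>auto elim!: eventually_mono\<close>)
    show ?thesis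
    proof (rule ccontr)
      assume "\<not> ?thesis"
      then obtain z' where z': "(q \<longlongrightarrow> z') (at_left b)" "f z' = p b"
        using limit_or_infinity[OF f b(3,1) lim] by blast
      have "continuous_on {b..<1} p" "inj_on p {b..<1}"
        using continuous_on_subset[OF p(1), of "{b..<1}"] inj_on_subset[OF p(2), of "{b..<1}"] b(1) by auto
      then obtain \<epsilon> q2 where q2: "0 < \<epsilon>" "b + \<epsilon> \<le> 1" "continuous_on {b..<b+\<epsilon>} q2" "q2 b = z'"
        "\<And>t. t \<in> {b..<b+\<epsilon>} \<Longrightarrow> f (q2 t) = p t"
        using local_lift_of_arc[of f b 1 p z', OF f _ _ b1 z'(2)] by metis
      define q4 where "q4 = q(b := z')"
      have q4: "continuous_on {0..b} q4"
      proof (rule continuous_on_IccI)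
        have same: "\<forall>\<^sub>F t in F. q t = q4 t" if "\<forall>\<^sub>F t in F. t \<noteq> b" for F
          using that by eventually_elim (simp add: q4_def)
        have "\<forall>\<^sub>F t in at_left b. q t = q4 t" using ev by (intro same) (auto elim!: eventually_mono)
        with z'(1) have "(q4 \<longlongrightarrow> z') (at_left b)" by (rule Lim_transform_eventually)
        moreover have "q4 b = z'" by (simp add: q4_def)
        ultimately show "(q4 \<longlongrightarrow> q4 b) (at_left b)" by simp
        have "(q \<longlongrightarrow> q 0) (at 0 within {0..<b})" using b by (auto simp: continuous_on_def)
        moreover have "at 0 within {0..<b} = at_right 0"
          by (rule at_within_nhd[of 0 "{..<b}"]) (use b(1) in auto)
        ultimately have "(q \<longlongrightarrow> q 0) (at_right 0)" by simp
        moreover have "\<forall>\<^sub>F t in at_right 0. t \<noteq> b"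
          using eventually_at_right_real[OF b(1)] by eventually_elim auto
        ultimately have "(q4 \<longlongrightarrow> q 0) (at_right 0)" using Lim_transform_eventually same by blast
        moreover have "q4 0 = q 0" using b(1) by (simp add: q4_def)
        ultimately show "(q4 \<longlongrightarrow> q4 0) (at_right 0)" by simp
        fix x assume x: "0 < x" "x < b"
        have "continuous_on {0<..<b} q" using b(3) by (rule continuous_on_subset) auto
        then have "continuous_on {0<..<b} q4" by (rule continuous_on_eq) (auto simp: q4_def)
        then show "q4 \<midarrow>x\<rightarrow> q4 x" using x by (simp add: continuous_on_eq_continuous_at isCont_def)
      qed (rule b(1))
      define q3 where "q3 t = (if t \<le> b then q4 t else q2 t)" for t
      have c3: "continuous_on {0..<b+\<epsilon>} q3"
        unfolding q3_def
      proof (rule continuous_on_cases_le)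
        show "continuous_on {t \<in> {0..<b + \<epsilon>}. t \<le> b} q4" using q4 by (rule continuous_on_subset) auto
        show "continuous_on {t \<in> {0..<b + \<epsilon>}. b \<le> t} q2" using q2(3) by (rule continuous_on_subset) auto
        show "\<And>t. t \<in> {0..<b + \<epsilon>} \<Longrightarrow> t = b \<Longrightarrow> q4 t = q2 t" using q2(4) by (simp add: q4_def)
      qed (rule continuous_on_id)
      have q3q: "q3 t = q t" if "t < b" for t using that by (simp add: q3_def q4_def)
      have f3: "f (q3 t) = p t" if "t \<in> {0..<b+\<epsilon>}" for t
        using that b(5) q2(5) z'(2) by (cases "t < b"; cases "t = b") (auto simp: q3_def q4_def)
      have "lifts (b + \<epsilon>) q3"
        unfolding lifts_def using c3 f3 q2 b q3q[of 0] by auto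
      moreover have "gr b q \<subseteq> gr (b + \<epsilon>) q3" using q3q q2(1) by (force simp: gr_def)
      ultimately have "gr (b + \<epsilon>) q3 = gr b q" by (rule max)
      moreover have "(b, q3 b) \<in> gr (b + \<epsilon>) q3" using b q2 by (auto simp: gr_def)
      ultimately have "(b, q3 b) \<in> gr b q" by simp
      then show False by (auto simp: gr_def)
    qed
  qed
  then show thesis using that b by blast
qed

lemma lift_of_arc_to_infinity:
  assumes f: "f holomorphic_on UNIV" "\<not> f constant_on UNIV"
    and p: "curve_to_infinity p" "inj_on p {0..}" and z: "f z = p 0"
  obtains q where "curve_to_infinity q" "inj_on q {0..}" "q 0 = z" "f ` q ` {0..} \<subseteq> p ` {0..}"
proof -
  define \<tau> where "\<tau> x = x / (1 - x)" for x :: real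
  have \<tau>: "continuous_on {0..<1} \<tau>" "inj_on \<tau> {0..<1}" "\<tau> 0 = 0" "\<And>x. x \<in> {0..<1} \<Longrightarrow> 0 \<le> \<tau> x"
    unfolding \<tau>_def by (auto intro!: continuous_intros simp: inj_on_def divide_simps algebra_simps)
  have "filterlim \<tau> at_top (at_left 1)" unfolding \<tau>_def by real_asymp
  then have lim: "filterlim (p \<circ> \<tau>) at_infinity (at_left 1)"
    using p(1) filterlim_compose unfolding curve_to_infinity_def o_def by blast
  have cont: "continuous_on {0..<1} (p \<circ> \<tau>)"
  proof -
    have "continuous_on {0..} p" using p(1) by (simp add: curve_to_infinity_def)
    then show ?thesis unfolding o_def by (rule continuous_on_compose2[OF _ \<tau>(1)]) (use \<tau>(4) in auto)
  qed
  have inj: "inj_on (p \<circ> \<tau>) {0..<1}"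
    using \<tau> p(2) by (intro comp_inj_on) (auto intro: inj_on_subset)
  obtain b q where q: "0 < b" "b \<le> 1" "continuous_on {0..<b} q" "q 0 = z"
    "\<And>t. t \<in> {0..<b} \<Longrightarrow> f (q t) = (p \<circ> \<tau>) t" "filterlim q at_infinity (at_left b)"
    using maximal_lift_of_arc[OF f cont inj lim, of z] z \<tau>(3) by auto
  note st = stretch[OF q(1)]
  have in_b: "stretch b s \<in> {0..<b}" if "s \<in> {0..}" for s using st(3) that by blast
  show thesis
  proof (rule that[of "q \<circ> stretch b"])
    show "curve_to_infinity (q \<circ> stretch b)" using curve_to_infinity_stretch[OF q(1,3,6)] .
    show "inj_on (q \<circ> stretch b) {0..}"
    proof (rule inj_onI)
      fix s s' :: real assume s: "s \<in> {0..}" "s' \<in> {0..}" "(q \<circ> stretch b) s = (q \<circ> stretch b) s'"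
      then have "(p \<circ> \<tau>) (stretch b s) = (p \<circ> \<tau>) (stretch b s')"
        using q(5)[OF in_b[OF s(1)]] q(5)[OF in_b[OF s(2)]] by simp
      moreover have "stretch b s \<in> {0..<1}" "stretch b s' \<in> {0..<1}" using in_b[OF s(1)] in_b[OF s(2)] q(2) by auto
      ultimately have "stretch b s = stretch b s'" using inj by (meson inj_onD)
      then show "s = s'" using st(2) s by (meson inj_onD)
    qed
    show "(q \<circ> stretch b) 0 = z" by (simp add: st(4) q(4))
    have "f (q (stretch b s)) \<in> p ` {0..}" if "s \<in> {0..}" for s
      using q(5)[OF in_b[OF that]] in_b[OF that] q(2) \<tau>(4)[of "stretch b s"] by auto
    then show "f ` (q \<circ> stretch b) ` {0..} \<subseteq> p ` {0..}" by auto
  qed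
qed

lemma iterated_lift_of_arc_to_infinity:
  assumes f: "f holomorphic_on UNIV" "\<not> f constant_on UNIV"
    and p: "curve_to_infinity p" "inj_on p {0..}" "(f ^^ n) z = p 0"
  shows "\<exists>q. curve_to_infinity q \<and> inj_on q {0..} \<and> q 0 = z \<and> (f ^^ n) ` q ` {0..} \<subseteq> p ` {0..}"
  using p
proof (induction n arbitrary: p)
  case 0
  then show ?case by (intro exI[of _ p]) auto
next
  case (Suc n)
  then have "f ((f ^^ n) z) = p 0" by simp
  then obtain q where q: "curve_to_infinity q" "inj_on q {0..}" "q 0 = (f ^^ n) z" "f ` q ` {0..} \<subseteq> p ` {0..}"
    using lift_of_arc_to_infinity[OF f Suc.prems(1,2)] by metis
  obtain q' where q': "curve_to_infinity q'" "inj_on q' {0..}" "q' 0 = z" "(f ^^ n) ` q' ` {0..} \<subseteq> q ` {0..}"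
    using Suc.IH[OF q(1,2)] q(3) by auto
  have "(f ^^ Suc n) ` q' ` {0..} = f ` ((f ^^ n) ` q' ` {0..})" by (simp add: image_comp o_assoc)
  also have "\<dots> \<subseteq> f ` (q ` {0..})" using q'(4) by (rule image_mono)
  also have "\<dots> \<subseteq> p ` {0..}" using q(4) .
  finally show ?case using q' by blast
qed

section \<open>Criniferous functions\<close>

text \<open>
  Later, \<open>Q\<close> is chosen such that the whole family of curves lies where the inverse branches contract.
\<close>

lemma disjoint_type_bouquet_rays:
  assumes g: "disjoint_type g" "Cantor_bouquet (Julia_set g)" and w: "w \<in> escaping_set g"
  shows "\<exists>N \<sigma>. \<sigma> 0 = (g ^^ N) w \<and>
    (\<forall>n. curve_to_infinity ((g ^^ n) \<circ> \<sigma>)) \<and> (\<forall>n. inj_on ((g ^^ n) \<circ> \<sigma>) {0..}) \<and>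
    (\<forall>n. \<forall>s\<ge>0. Q < cmod ((g ^^ n) (\<sigma> s))) \<and>
    (\<forall>R. \<forall>\<^sub>F n in sequentially. \<forall>s\<ge>0. R < cmod ((g ^^ n) (\<sigma> s)))"
proof -
  obtain \<psi> \<psi>' where "homeomorphism UNIV UNIV \<psi> \<psi>'" "straight_brush (\<psi> ` Julia_set g)"
    using g(2) unfolding Cantor_bouquet_def by blast
  then interpret bouquet_chart "Julia_set g" \<psi> \<psi>' by unfold_locales
  have gB: "g \<in> class_B" using g(1) by (simp add: disjoint_type_def)
  then have gh: "g holomorphic_on UNIV" by (simp add: class_B_def transcendental_entire_def)
  have inv: "g z \<in> Julia_set g" if "z \<in> Julia_set g" for z
    using that Fatou_backward_invariant[OF gh] by (auto simp: Julia_set_def)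
  have sing: "z \<notin> Julia_set g" if "z \<in> singular_set g" for z
    by (rule disjoint_type_singular_set_disjnt_Julia[OF g(1) that])
  define x where "x n = (g ^^ n) w" for n
  have xJ: "x n \<in> Julia_set g" for n
    by (induction n) (use escaping_set_subset_Julia[OF gB w] inv in \<open>auto simp: x_def\<close>)
  have x_lim: "\<forall>\<^sub>F n in sequentially. R < cmod (x n)" for R
    using w by (auto simp: escaping_set_def x_def intro!: eventually_norm_gt_of_filterlim)
  have far: "\<exists>n0. \<forall>n\<ge>n0. \<forall>u\<ge>0. R < cmod (tail (x n) u)" for R
  proof -
    obtain M where M: "\<And>w u. w \<in> Julia_set g \<Longrightarrow> M < cmod w \<Longrightarrow> 0 \<le> u \<Longrightarrow> R < cmod (tail w u)"
      using tail_far by blast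
    obtain n0 where "\<forall>n\<ge>n0. M < cmod (x n)" using x_lim[of M] unfolding eventually_sequentially by blast
    then show ?thesis using M xJ by blast
  qed
  obtain N where N: "\<forall>n\<ge>N. \<forall>u\<ge>0. Q < cmod (tail (x n) u)" using far by blast
  define \<sigma> where "\<sigma> = tail (x N)"
  have it: "inj_on ((g ^^ n) \<circ> \<sigma>) {0..} \<and> ((g ^^ n) \<circ> \<sigma>) ` {0..} = tail (x (N + n)) ` {0..}" for n
  proof (induction n)
    case 0
    then show ?case by (simp add: \<sigma>_def tail_inj)
  next
    case (Suc n)
    note ti = tail_image[OF gh inv sing xJ[of "N + n"]]
    have eq: "(g ^^ Suc n) \<circ> \<sigma> = g \<circ> ((g ^^ n) \<circ> \<sigma>)" by (simp add: o_assoc)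
    have "inj_on g (tail (x (N + n)) ` {0..})" using ti(1) by (rule inj_on_imageI)
    then have "inj_on (g \<circ> ((g ^^ n) \<circ> \<sigma>)) {0..}" 
      using Suc comp_inj_on[of "(g ^^ n) \<circ> \<sigma>" "{0..}" g] by metis
    moreover have "(g \<circ> ((g ^^ n) \<circ> \<sigma>)) ` {0..} = g ` tail (x (N + n)) ` {0..}"
      using Suc by (metis image_comp)
    moreover have "\<dots> = tail (g (x (N + n))) ` {0..}" using ti(2) by (simp add: image_comp)
    moreover have "g (x (N + n)) = x (N + Suc n)" by (simp add: x_def)
    ultimately show ?case unfolding eq by metis
  qed
  have in_tail: "\<exists>u\<ge>0. (g ^^ n) (\<sigma> s) = tail (x (N + n)) u" if "0 \<le> s" for n s
  proof -
    have "((g ^^ n) \<circ> \<sigma>) s \<in> tail (x (N + n)) ` {0..}" using it[of n] that by blast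
    then show ?thesis by auto
  qed
  show ?thesis
  proof (intro exI[of _ N] exI[of _ \<sigma>] conjI allI impI)
    show "\<sigma> 0 = (g ^^ N) w" by (simp add: \<sigma>_def x_def)
    show "inj_on ((g ^^ n) \<circ> \<sigma>) {0..}" for n using it by blast
    show "curve_to_infinity ((g ^^ n) \<circ> \<sigma>)" for n
    proof (rule curve_onto_tail_to_infinity)
      show "continuous_on {0..} ((g ^^ n) \<circ> \<sigma>)"
        unfolding \<sigma>_def by (intro continuous_on_compose tail_continuous funpow_continuous gh)
    qed (use it in blast)+
    show "Q < cmod ((g ^^ n) (\<sigma> s))" if "0 \<le> s" for n s
      using in_tail[OF that, of n] N by auto
    show "\<forall>\<^sub>F n in sequentially. \<forall>s\<ge>0. R < cmod ((g ^^ n) (\<sigma> s))" for R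
    proof -
      obtain n0 where n0: "\<forall>n\<ge>n0. \<forall>u\<ge>0. R < cmod (tail (x n) u)" using far by blast
      have "R < cmod ((g ^^ n) (\<sigma> s))" if "n0 \<le> n" "0 \<le> s" for n s
        using in_tail[OF that(2), of n] n0 that(1) by (metis trans_le_add2)
      then show ?thesis unfolding eventually_sequentially by blast
    qed
  qed
qed

text \<open>
  Orbits are transferred between \<open>f\<close> and \<open>g\<close> twice.  The logarithmic orbit \<open>\<zeta>\<close> of \<open>z\<close> under \<open>f\<close> is shadowed by
  an orbit \<open>\<xi>\<close> for \<open>g\<close>, whose exponential escapes.  The tails of the hairs along that orbit have
  logarithms \<open>\<eta>\<close> starting at \<open>\<xi>\<close>, and these are shadowed by \<open>\<nu>\<close> for \<open>f\<close>.  All four sequences are orbits under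
  one and the same sequence \<open>\<Psi>\<close> of inverse branches, up to the shift by \<open>\<kappa>\<close>.  Therefore \<open>\<nu>\<close> starts at \<open>\<zeta>\<close> and
  not at some other orbit nearby, and distinct points of a tail are shadowed by distinct points.
\<close>

lemma class_CB_rays:
  assumes f: "f \<in> class_CB" and z: "z \<in> escaping_set f"
  shows "\<exists>N \<gamma>. (\<forall>n. curve_to_infinity (\<gamma> n)) \<and> (\<forall>n. inj_on (\<gamma> n) {0..}) \<and>
    (\<forall>n. \<gamma> n 0 = (f ^^ (N + n)) z) \<and> (\<forall>n. \<forall>s\<ge>0. f (\<gamma> n s) = \<gamma> (Suc n) s) \<and>
    (\<forall>R. \<forall>\<^sub>F n in sequentially. \<forall>s\<ge>0. R < cmod (\<gamma> n s))"
proof -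
  obtain c where c: "c \<noteq> 0" "disjoint_type (\<lambda>z. c * f z)" "Cantor_bouquet (Julia_set (\<lambda>z. c * f z))"
    using f unfolding class_CB_def by blast
  define g where "g z = c * f z" for z
  have g: "disjoint_type g" "Cantor_bouquet (Julia_set g)" using c by (simp_all add: g_def[abs_def])
  have "f \<in> class_B" using f by (simp add: class_CB_def)
  then obtain \<rho> where \<rho>: "tame_beyond f \<rho>" using class_B_tame_beyond by blast
  define \<kappa> where "\<kappa> = Ln c"
  define k where "k = cmod \<kappa>"
  define r where "r = \<rho> + 24 * pi"
  have exp_\<kappa>: "exp \<kappa> = c" using c(1) by (simp add: \<kappa>_def)
  have k0: "0 \<le> k" and r\<rho>: "\<rho> < r" by (simp_all add: k_def r_def)
  have Re_\<kappa>: "\<bar>Re \<kappa>\<bar> \<le> k" by (simp add: k_def abs_Re_le_cmod)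
  have Re_close: "Re v - k \<le> Re u" if "dist u v \<le> k" for u v
    using that abs_Re_le_cmod[of "u - v"] by (simp add: dist_norm)

  \<comment> \<open>Shadowing needs the margin \<open>2 * k\<close> beyond the line where the branches contract, and the shadowing
    orbit may come closer to that line by \<open>k\<close>.  For the branches of \<open>g\<close> the line itself is shifted by up
    to \<open>k\<close>, whence the bound \<open>r + 3 * k\<close> for the tails below.\<close>
  have fz_lim: "\<forall>\<^sub>F n in sequentially. R < cmod ((f ^^ n) z)" for R
    using z by (auto simp: escaping_set_def intro!: eventually_norm_gt_of_filterlim)
  obtain N1 where N1: "\<forall>n\<ge>N1. exp (r + 2 * k) < cmod ((f ^^ n) z)"
    using fz_lim[of "exp (r + 2 * k)"] unfolding eventually_sequentially by blast
  define \<zeta> where "\<zeta> n = Ln ((f ^^ (N1 + n)) z)" for n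
  have nz: "(f ^^ (N1 + n)) z \<noteq> 0" for n
  proof
    assume "(f ^^ (N1 + n)) z = 0"
    then have "exp (r + 2 * k) < 0" using N1 by (metis le_add1 norm_zero)
    then show False using exp_gt_zero[of "r + 2 * k"] by linarith
  qed
  have exp_\<zeta>: "exp (\<zeta> n) = (f ^^ (N1 + n)) z" for n using nz by (simp add: \<zeta>_def)
  have Re_\<zeta>: "r + 2 * k \<le> Re (\<zeta> n)" for n
  proof -
    have "exp (r + 2 * k) < exp (Re (\<zeta> n))" using N1 by (simp add: exp_\<zeta> flip: norm_exp_eq_Re)
    then show ?thesis by simp
  qed
  have "\<exists>\<Psi>. inverse_branch f \<rho> \<Psi> \<and> \<Psi> (\<zeta> (Suc n)) = \<zeta> n" for n
    using Re_\<zeta>[of "Suc n"] k0 r\<rho> by (intro inverse_branch_exists[OF \<rho>]) (simp_all add: exp_\<zeta>)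
  then obtain \<Psi> where \<Psi>: "\<And>n. inverse_branch f \<rho> (\<Psi> n)" "\<And>n. \<Psi> n (\<zeta> (Suc n)) = \<zeta> n" by metis
  have f\<Psi>: "f (exp (\<Psi> n u)) = exp u" if "\<rho> < Re u" for n u
    using \<Psi>(1) that by (simp add: inverse_branch_def)
  have lip: "dist (\<Psi> n u) (\<Psi> n v) \<le> dist u v / 2" if "r \<le> Re u" "r \<le> Re v" for n u v
    using inverse_branch_lipschitz[OF \<rho> \<Psi>(1)] that by (simp add: r_def)

  obtain \<xi>' where \<xi>': "\<And>n. \<xi>' n (0::real) = \<Psi> n (\<xi>' (Suc n) 0 - \<kappa>)" "\<And>n. dist (\<xi>' n 0) (\<zeta> n) \<le> cmod \<kappa>"
  proof (rule shadowing[of r \<Psi> "{0::real}" "\<lambda>n _. \<zeta> n" \<kappa>])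
    show "\<zeta> n = \<Psi> n (\<zeta> (Suc n))" for n using \<Psi>(2) by simp
    show "r + 2 * cmod \<kappa> \<le> Re (\<zeta> n)" for n using Re_\<zeta> by (simp add: k_def)
    show "dist (\<Psi> n u) (\<Psi> n v) \<le> dist u v / 2" if "r \<le> Re u" "r \<le> Re v" for n u v by (rule lip[OF that])
    show "continuous_on {0::real} (\<lambda>_. \<zeta> n)" for n by (rule continuous_on_const)
    fix \<xi>' assume "\<And>n. continuous_on {0::real} (\<xi>' n)"
      and a: "\<And>n s. s \<in> {0} \<Longrightarrow> \<xi>' n s = \<Psi> n (\<xi>' (Suc n) s - \<kappa>)"
        "\<And>n s. s \<in> {0} \<Longrightarrow> dist (\<xi>' n s) (\<zeta> n) \<le> cmod \<kappa>"
    show thesis by (rule that[of \<xi>', OF a(1)[OF singletonI] a(2)[OF singletonI]])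
  qed
  define \<xi> where "\<xi> n = \<xi>' n 0" for n
  have \<xi>: "\<xi> n = \<Psi> n (\<xi> (Suc n) - \<kappa>)" and \<xi>_close: "dist (\<xi> n) (\<zeta> n) \<le> k" for n
    unfolding \<xi>_def k_def by (rule \<xi>')+
  have Re_\<xi>: "r + k \<le> Re (\<xi> n)" for n using Re_close[OF \<xi>_close, of n] Re_\<zeta>[of n] by linarith
  have g_step: "g (exp (\<xi> n)) = exp (\<xi> (Suc n))" for n
  proof -
    have "\<rho> < Re (\<xi> (Suc n) - \<kappa>)" using Re_\<xi>[of "Suc n"] Re_\<kappa> r\<rho> by simp
    then have "f (exp (\<xi> n)) = exp (\<xi> (Suc n) - \<kappa>)" using f\<Psi> \<xi>[of n] by metis
    then show ?thesis using c(1) by (simp add: g_def exp_diff exp_\<kappa>)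
  qed
  define w where "w = exp (\<xi> 0)"
  have orb_w: "(g ^^ n) w = exp (\<xi> n)" for n
    by (induction n) (simp_all add: w_def g_step)
  have "w \<in> escaping_set g"
    unfolding escaping_set_def mem_Collect_eq
  proof (rule filterlim_at_infinityI_norm_gt)
    fix R
    have "\<forall>\<^sub>F n in sequentially. \<bar>R\<bar> * exp k < cmod ((f ^^ (n + N1)) z)"
      using fz_lim[of "\<bar>R\<bar> * exp k"] by (rule sequentially_offset)
    then show "\<forall>\<^sub>F n in sequentially. R < cmod ((g ^^ n) w)"
    proof eventually_elim
      case (elim n)
      have "cmod ((f ^^ (n + N1)) z) = exp (Re (\<zeta> n))"
        using exp_\<zeta>[of n] by (simp add: add.commute flip: norm_exp_eq_Re)
      also have "\<dots> \<le> exp (Re (\<xi> n) + k)" using Re_close[of "\<zeta> n" "\<xi> n"] Re_close[OF \<xi>_close, of n] by simp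
      also have "\<dots> = cmod ((g ^^ n) w) * exp k" by (simp add: orb_w exp_add norm_exp_eq_Re)
      finally have "\<bar>R\<bar> * exp k < cmod ((g ^^ n) w) * exp k" using elim by linarith
      then show ?case by simp
    qed
  qed
  from disjoint_type_bouquet_rays[OF g this, of "exp (r + 3 * k)"]
  obtain N2 \<sigma> where "\<sigma> 0 = (g ^^ N2) w"
    "\<forall>n. curve_to_infinity ((g ^^ n) \<circ> \<sigma>)" "\<forall>n. inj_on ((g ^^ n) \<circ> \<sigma>) {0..}"
    "\<forall>n. \<forall>s\<ge>0. exp (r + 3 * k) < cmod ((g ^^ n) (\<sigma> s))"
    "\<forall>R. \<forall>\<^sub>F n in sequentially. \<forall>s\<ge>0. R < cmod ((g ^^ n) (\<sigma> s))" by blast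
  note \<sigma> = this[rule_format]

  have "\<exists>\<eta>. continuous_on {0..} \<eta> \<and> (\<forall>s\<ge>0. exp (\<eta> s) = (g ^^ n) (\<sigma> s)) \<and> \<eta> 0 = \<xi> (N2 + n)" for n
  proof -
    have "((g ^^ n) \<circ> \<sigma>) s \<noteq> 0" if "s \<in> {0..}" for s
    proof -
      have "0 < exp (r + 3 * k)" by simp
      then show ?thesis using \<sigma>(4)[of s n] that by auto
    qed
    moreover have "contractible {0::real..}" by (intro convex_imp_contractible convex_real_interval)
    moreover have "continuous_on {0..} ((g ^^ n) \<circ> \<sigma>)" using \<sigma>(2)[of n] by (simp add: curve_to_infinity_def)
    ultimately obtain L where L: "continuous_on {0..} L" "\<And>s. s \<in> {0..} \<Longrightarrow> ((g ^^ n) \<circ> \<sigma>) s = exp (L s)"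
      using continuous_logarithm_on_contractible by metis
    have "(g ^^ n) (\<sigma> 0) = (g ^^ (n + N2)) w" by (simp add: \<sigma>(1) funpow_add)
    also have "\<dots> = exp (\<xi> (N2 + n))" by (simp add: orb_w add.commute)
    finally have "exp (L 0) = exp (\<xi> (N2 + n))" using L(2)[of 0] by simp
    then have "exp (\<xi> (N2 + n) - L 0) = 1" by (simp add: exp_diff)
    then have "\<forall>s\<ge>0. exp (L s + (\<xi> (N2 + n) - L 0)) = (g ^^ n) (\<sigma> s)"
      using L(2) by (simp add: exp_add)
    moreover have "continuous_on {0..} (\<lambda>s. L s + (\<xi> (N2 + n) - L 0))" by (intro continuous_intros L)
    ultimately show ?thesis by (intro exI[of _ "\<lambda>s. L s + (\<xi> (N2 + n) - L 0)"]) simp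
  qed
  then obtain \<eta> where \<eta>: "\<And>n. continuous_on {0..} (\<eta> n)"
    "\<And>n s. 0 \<le> s \<Longrightarrow> exp (\<eta> n s) = (g ^^ n) (\<sigma> s)" "\<And>n. \<eta> n 0 = \<xi> (N2 + n)" by metis
  have Re_\<eta>: "r + 3 * k \<le> Re (\<eta> n s)" if "0 \<le> s" for n s
  proof -
    have "exp (r + 3 * k) < exp (Re (\<eta> n s))" using \<sigma>(4)[OF that, of n] \<eta>(2)[OF that, of n] by (simp flip: norm_exp_eq_Re)
    then show ?thesis by simp
  qed
  \<comment> \<open>The corresponding inverse branches of \<open>g\<close>.\<close>
  define \<Psi>g where "\<Psi>g n u = \<Psi> (N2 + n) (u - \<kappa>)" for n u
  have \<eta>_step: "\<eta> n s = \<Psi>g n (\<eta> (Suc n) s)" if s: "s \<in> {0..}" for n s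
    unfolding \<Psi>g_def
  proof (rule inverse_branch_follows[of f \<rho> "\<Psi> (N2 + n)" "{0..}" "\<eta> n" "\<lambda>s. \<eta> (Suc n) s - \<kappa>" 0 s, OF \<rho> \<Psi>(1)])
    show "continuous_on {0..} (\<lambda>s. \<eta> (Suc n) s - \<kappa>)" by (intro continuous_intros \<eta>)
    show "connected {0::real..}" by (simp add: convex_connected)
    fix x :: real assume x: "x \<in> {0..}"
    have "c * f (exp (\<eta> n x)) = g ((g ^^ n) (\<sigma> x))" using \<eta>(2)[of x n] x by (simp add: g_def)
    also have "\<dots> = exp (\<eta> (Suc n) x)" using \<eta>(2)[of x "Suc n"] x by simp
    finally show "f (exp (\<eta> n x)) = exp (\<eta> (Suc n) x - \<kappa>)"
      using c(1) by (simp add: exp_diff exp_\<kappa> field_simps)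
    show "\<rho> < Re (\<eta> (Suc n) x - \<kappa>)" using Re_\<eta>[of x "Suc n"] x Re_\<kappa> k0 r\<rho> by simp
  next
    show "\<eta> n 0 = \<Psi> (N2 + n) (\<eta> (Suc n) 0 - \<kappa>)" using \<eta>(3)[of n] \<eta>(3)[of "Suc n"] \<xi>[of "N2 + n"] by simp
  qed (use s \<eta>(1) in auto)
  have lip_g: "dist (\<Psi>g n u) (\<Psi>g n v) \<le> dist u v / 2" if "r + k \<le> Re u" "r + k \<le> Re v" for n u v
  proof -
    have "r \<le> Re (u - \<kappa>)" "r \<le> Re (v - \<kappa>)" using that Re_\<kappa> by simp_all
    then show ?thesis using lip[of "u - \<kappa>" "v - \<kappa>" "N2 + n"] by (simp add: \<Psi>g_def dist_norm)
  qed
  obtain \<nu> where \<nu>: "\<And>n. continuous_on {0..} (\<nu> n)"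
    "\<And>n s. s \<in> {0..} \<Longrightarrow> \<nu> n s = \<Psi>g n (\<nu> (Suc n) s - - \<kappa>)"
    "\<And>n s. s \<in> {0..} \<Longrightarrow> dist (\<nu> n s) (\<eta> n s) \<le> cmod (- \<kappa>)"
  proof (rule shadowing[of "r + k" \<Psi>g "{0..}" \<eta> "- \<kappa>"])
    show "\<eta> n s = \<Psi>g n (\<eta> (Suc n) s)" if "s \<in> {0..}" for n s by (rule \<eta>_step[OF that])
    show "r + k + 2 * cmod (- \<kappa>) \<le> Re (\<eta> n s)" if "s \<in> {0..}" for n s using Re_\<eta>[of s n] that by (simp add: k_def)
    show "dist (\<Psi>g n u) (\<Psi>g n v) \<le> dist u v / 2" if "r + k \<le> Re u" "r + k \<le> Re v" for n u v by (rule lip_g[OF that])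
    show "continuous_on {0..} (\<eta> n)" for n by (rule \<eta>(1))
    fix \<nu>' assume a: "\<And>n. continuous_on {0..} (\<nu>' n)"
      "\<And>n s. s \<in> {0..} \<Longrightarrow> \<nu>' n s = \<Psi>g n (\<nu>' (Suc n) s - - \<kappa>)"
      "\<And>n s. s \<in> {0..} \<Longrightarrow> dist (\<nu>' n s) (\<eta> n s) \<le> cmod (- \<kappa>)"
    show thesis by (rule that[OF a])
  qed
  have \<nu>_step: "\<nu> n s = \<Psi> (N2 + n) (\<nu> (Suc n) s)" if "0 \<le> s" for n s
    using \<nu>(2)[of s n] that by (simp add: \<Psi>g_def)
  have \<nu>_close: "dist (\<nu> n s) (\<eta> n s) \<le> k" if "0 \<le> s" for n s using \<nu>(3)[of s n] that by (simp add: k_def)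
  have Re_\<nu>: "r + 2 * k \<le> Re (\<nu> n s)" if "0 \<le> s" for n s
    using Re_close[OF \<nu>_close[OF that], of n] Re_\<eta>[OF that, of n] by linarith
  define \<gamma> where "\<gamma> n s = exp (\<nu> n s)" for n s
  have \<gamma>_step: "f (\<gamma> n s) = \<gamma> (Suc n) s" if "0 \<le> s" for n s
  proof -
    have "\<rho> < Re (\<nu> (Suc n) s)" using Re_\<nu>[OF that, of "Suc n"] k0 r\<rho> by linarith
    then show ?thesis using f\<Psi> \<nu>_step[OF that, of n] by (simp add: \<gamma>_def)
  qed
  have \<gamma>_large: "exp (- k) * cmod ((g ^^ n) (\<sigma> s)) \<le> cmod (\<gamma> n s)" if "0 \<le> s" for n s
  proof -
    have "exp (- k) * cmod ((g ^^ n) (\<sigma> s)) = exp (Re (\<eta> n s) - k)"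
      using \<eta>(2)[OF that, of n] by (simp add: exp_diff exp_minus field_simps flip: norm_exp_eq_Re)
    also have "\<dots> \<le> exp (Re (\<nu> n s))" using Re_close[OF \<nu>_close[OF that], of n] by simp
    finally show ?thesis by (simp add: \<gamma>_def norm_exp_eq_Re)
  qed
  have \<gamma>_gt: "R < cmod (\<gamma> n s)" if "0 \<le> s" "R * exp k < cmod ((g ^^ n) (\<sigma> s))" for R n s
  proof -
    have "R = exp (- k) * (R * exp k)" by (simp add: exp_minus field_simps)
    also have "\<dots> < exp (- k) * cmod ((g ^^ n) (\<sigma> s))" using that(2) by (intro mult_strict_left_mono) auto
    also have "\<dots> \<le> cmod (\<gamma> n s)" by (rule \<gamma>_large[OF that(1)])
    finally show ?thesis .
  qed
  have \<nu>_0: "\<nu> n 0 = \<zeta> (N2 + n)" for n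
  proof (rule backward_orbits_coincide[of r "\<lambda>n. \<Psi> (N2 + n)" "\<lambda>n. \<nu> n 0" "\<lambda>n. \<zeta> (N2 + n)" "2 * k"])
    show "dist (\<nu> n 0) (\<zeta> (N2 + n)) \<le> 2 * k" for n
      using dist_triangle[of "\<nu> n 0" "\<zeta> (N2 + n)" "\<eta> n 0"] \<nu>_close[of 0 n] \<xi>_close[of "N2 + n"] \<eta>(3)[of n] by simp
    show "r \<le> Re (\<nu> n 0)" for n using Re_\<nu>[of 0 n] k0 by simp
    show "r \<le> Re (\<zeta> (N2 + n))" for n using Re_\<zeta>[of "N2 + n"] k0 by simp
    show "\<nu> n 0 = \<Psi> (N2 + n) (\<nu> (Suc n) 0)" for n by (rule \<nu>_step) simp
    show "\<zeta> (N2 + n) = \<Psi> (N2 + n) (\<zeta> (N2 + Suc n))" for n using \<Psi>(2)[of "N2 + n"] by simp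
  qed (rule lip)
  have \<gamma>_inj: "inj_on (\<gamma> n) {0..}" for n
  proof (rule inj_onI)
    fix s s' :: real assume s: "s \<in> {0..}" "s' \<in> {0..}" "\<gamma> n s = \<gamma> n s'"
    have s0: "0 \<le> s" "0 \<le> s'" using s by auto
    have eq: "\<gamma> (n + m) s = \<gamma> (n + m) s'" for m
    proof (induction m)
      case (Suc m)
      then show ?case using \<gamma>_step[OF s0(1), of "n + m"] \<gamma>_step[OF s0(2), of "n + m"] by simp
    qed (use s in simp)
    \<comment> \<open>From the next step on, equality holds even for the logarithms, because \<open>exp\<close> is injective on the
      image of each inverse branch.\<close>
    have \<nu>_eq: "\<nu> (Suc (n + m)) s = \<nu> (Suc (n + m)) s'" for m
    proof (rule inverse_branch_inj[OF \<rho> \<Psi>(1)[of "N2 + (n + m)"]])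
      show "\<rho> < Re (\<nu> (Suc (n + m)) s)" "\<rho> < Re (\<nu> (Suc (n + m)) s')"
        using Re_\<nu>[OF s0(1), of "Suc (n + m)"] Re_\<nu>[OF s0(2), of "Suc (n + m)"] k0 r\<rho> by linarith+
      show "exp (\<Psi> (N2 + (n + m)) (\<nu> (Suc (n + m)) s)) = exp (\<Psi> (N2 + (n + m)) (\<nu> (Suc (n + m)) s'))"
        using eq[of m] \<nu>_step[OF s0(1), of "n + m"] \<nu>_step[OF s0(2), of "n + m"] by (simp add: \<gamma>_def)
    qed
    have "\<eta> (Suc n + 0) s = \<eta> (Suc n + 0) s'"
    proof (rule backward_orbits_coincide[of "r + k" "\<lambda>m. \<Psi>g (Suc n + m)" "\<lambda>m. \<eta> (Suc n + m) s" "\<lambda>m. \<eta> (Suc n + m) s'" "2 * k"])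
      show "dist (\<eta> (Suc n + m) s) (\<eta> (Suc n + m) s') \<le> 2 * k" for m
        using dist_triangle3[of "\<eta> (Suc n + m) s" "\<eta> (Suc n + m) s'" "\<nu> (Suc n + m) s"]
          \<nu>_close[OF s0(1), of "Suc n + m"] \<nu>_close[OF s0(2), of "Suc n + m"] \<nu>_eq[of m] by simp
      show "r + k \<le> Re (\<eta> (Suc n + m) s)" "r + k \<le> Re (\<eta> (Suc n + m) s')" for m
        using Re_\<eta>[OF s0(1), of "Suc n + m"] Re_\<eta>[OF s0(2), of "Suc n + m"] k0 by linarith+
      show "\<eta> (Suc n + m) s = \<Psi>g (Suc n + m) (\<eta> (Suc n + Suc m) s)"
        "\<eta> (Suc n + m) s' = \<Psi>g (Suc n + m) (\<eta> (Suc n + Suc m) s')" for m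
        using \<eta>_step[OF s(1), of "Suc n + m"] \<eta>_step[OF s(2), of "Suc n + m"] by simp_all
    qed (rule lip_g)
    then have "((g ^^ Suc n) \<circ> \<sigma>) s = ((g ^^ Suc n) \<circ> \<sigma>) s'"
      using \<eta>(2)[OF s0(1), of "Suc n"] \<eta>(2)[OF s0(2), of "Suc n"] by simp
    then show "s = s'" using inj_onD[OF \<sigma>(3)] s by blast
  qed
  show ?thesis
  proof (intro exI[of _ "N1 + N2"] exI[of _ \<gamma>] conjI allI impI)
    show "curve_to_infinity (\<gamma> n)" for n
      unfolding curve_to_infinity_def
    proof
      show "continuous_on {0..} (\<gamma> n)" unfolding \<gamma>_def by (intro continuous_intros \<nu>)
      show "filterlim (\<gamma> n) at_infinity at_top"
      proof (rule filterlim_at_infinityI_norm_gt)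
        fix R
        have "\<forall>\<^sub>F s in at_top. R * exp k < cmod (((g ^^ n) \<circ> \<sigma>) s)"
          by (rule eventually_norm_gt_of_filterlim) (use \<sigma>(2)[of n] in \<open>simp only: curve_to_infinity_def\<close>)
        then show "\<forall>\<^sub>F s in at_top. R < cmod (\<gamma> n s)"
          using eventually_ge_at_top[of 0] by eventually_elim (simp add: \<gamma>_gt)
      qed
    qed
    show "\<gamma> n 0 = (f ^^ (N1 + N2 + n)) z" for n
      by (simp add: \<gamma>_def \<nu>_0 exp_\<zeta> add.assoc)
    show "\<forall>\<^sub>F n in sequentially. \<forall>s\<ge>0. R < cmod (\<gamma> n s)" for R
      using \<sigma>(5)[of "R * exp k"] by eventually_elim (simp add: \<gamma>_gt)
  qed (use \<gamma>_inj \<gamma>_step in auto)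
qed

theorem theorem1p4:
  fixes f :: "complex \<Rightarrow> complex"
  assumes "f \<in> class_CB"
  shows "criniferous f \<and>
         (\<forall>z \<in> escaping_set f. \<exists>\<gamma> :: real \<Rightarrow> complex.
            curve_to_infinity \<gamma> \<and> \<gamma> 0 = z \<and>
            uniformly_to_infinity_on (\<gamma> ` {0..}) (\<lambda>n. f ^^ n))"
proof (intro conjI ballI)
  have te: "transcendental_entire f" using assms by (simp add: class_CB_def class_B_def)
  then have f: "f holomorphic_on UNIV" "\<not> f constant_on UNIV"
    using transcendental_entire_nonconstant by (auto simp: transcendental_entire_def)
  show "criniferous f"
    unfolding criniferous_def
  proof (intro conjI ballI f(1))
    fix z assume "z \<in> escaping_set f"
    from class_CB_rays[OF assms this] obtain N \<gamma> where
      "\<forall>n. curve_to_infinity (\<gamma> n)" "\<forall>n. inj_on (\<gamma> n) {0..}" "\<forall>n. \<gamma> n 0 = (f ^^ (N + n)) z"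
      "\<forall>n. \<forall>s\<ge>0. f (\<gamma> n s) = \<gamma> (Suc n) s"
      "\<forall>R. \<forall>\<^sub>F n in sequentially. \<forall>s\<ge>0. R < cmod (\<gamma> n s)" by blast
    note \<gamma> = this[rule_format]
    define \<Gamma> where "\<Gamma> n = \<gamma> (n - N) ` {0..}" for n
    have "arc_to_infinity_from ((f ^^ n) z) (\<Gamma> n) \<and> bij_betw f (\<Gamma> n) (\<Gamma> (Suc n))" if "N \<le> n" for n
    proof
      define m where "m = n - N"
      have n: "n = N + m" "Suc n - N = Suc m" using that by (auto simp: m_def)
      show "arc_to_infinity_from ((f ^^ n) z) (\<Gamma> n)"
        unfolding arc_to_infinity_from_def \<Gamma>_def
        using \<gamma>(1)[of m] \<gamma>(2)[of m] \<gamma>(3)[of m] n by (intro exI[of _ "\<gamma> m"]) simp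
      have img: "f ` \<Gamma> n = \<Gamma> (Suc n)"
        unfolding \<Gamma>_def image_image n(2) by (rule image_cong) (simp_all add: n(1) \<gamma>(4))
      have "inj_on f (\<Gamma> n)"
      proof (rule inj_onI)
        fix x y assume "x \<in> \<Gamma> n" "y \<in> \<Gamma> n" and eq: "f x = f y"
        then obtain s t where st: "0 \<le> s" "x = \<gamma> m s" "0 \<le> t" "y = \<gamma> m t" by (auto simp: \<Gamma>_def m_def)
        then have "\<gamma> (Suc m) s = \<gamma> (Suc m) t" using eq \<gamma>(4)[of s m] \<gamma>(4)[of t m] by simp
        then have "s = t" using inj_onD[OF \<gamma>(2)[of "Suc m"]] st by auto
        then show "x = y" using st by simp
      qed
      with img show "bij_betw f (\<Gamma> n) (\<Gamma> (Suc n))" by (simp add: bij_betw_def)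
    qed
    moreover have "filterlim (\<lambda>n. INF w\<in>\<Gamma> n. cmod w) at_top sequentially"
      unfolding filterlim_at_top
    proof
      fix R :: real
      obtain n0 where n0: "\<And>n. n0 \<le> n \<Longrightarrow> \<forall>s\<ge>0. R < cmod (\<gamma> n s)"
        using \<gamma>(5)[of R] unfolding eventually_sequentially by blast
      have "R \<le> (INF w\<in>\<Gamma> n. cmod w)" if "n0 + N \<le> n" for n
      proof (rule cINF_greatest)
        show "\<Gamma> n \<noteq> {}" by (auto simp: \<Gamma>_def)
        show "R \<le> cmod w" if "w \<in> \<Gamma> n" for w
          using that n0[of "n - N"] \<open>n0 + N \<le> n\<close> by (force simp: \<Gamma>_def)
      qed
      then show "\<forall>\<^sub>F n in sequentially. R \<le> (INF w\<in>\<Gamma> n. cmod w)"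
        unfolding eventually_sequentially by blast
    qed
    ultimately show "\<exists>\<gamma> N. (\<forall>n\<ge>N. arc_to_infinity_from ((f ^^ n) z) (\<gamma> n) \<and> bij_betw f (\<gamma> n) (\<gamma> (Suc n))) \<and>
        filterlim (\<lambda>n. INF w\<in>\<gamma> n. cmod w) at_top sequentially" by blast
  qed
  fix z assume "z \<in> escaping_set f"
  from class_CB_rays[OF assms this] obtain N \<gamma> where
    "\<forall>n. curve_to_infinity (\<gamma> n)" "\<forall>n. inj_on (\<gamma> n) {0..}" "\<forall>n. \<gamma> n 0 = (f ^^ (N + n)) z"
    "\<forall>n. \<forall>s\<ge>0. f (\<gamma> n s) = \<gamma> (Suc n) s"
    "\<forall>R. \<forall>\<^sub>F n in sequentially. \<forall>s\<ge>0. R < cmod (\<gamma> n s)" by blast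
  note \<gamma> = this[rule_format]
  have "(f ^^ N) z = \<gamma> 0 0" using \<gamma>(3)[of 0] by simp
  then obtain q where q: "curve_to_infinity q" "q 0 = z" "(f ^^ N) ` q ` {0..} \<subseteq> \<gamma> 0 ` {0..}"
    using iterated_lift_of_arc_to_infinity[OF f \<gamma>(1,2)[of 0]] by metis
  have orbit: "\<exists>s\<ge>0. (f ^^ (N + n)) x = \<gamma> n s" if x: "x \<in> q ` {0..}" for n x
  proof (induction n)
    case 0
    have "(f ^^ N) x \<in> \<gamma> 0 ` {0..}" using q(3) x by blast
    then show ?case by auto
  next
    case (Suc n)
    then obtain s where "0 \<le> s" "(f ^^ (N + n)) x = \<gamma> n s" by blast
    then show ?case using \<gamma>(4)[of s n] by (intro exI[of _ s]) simp
  qed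
  have "uniformly_to_infinity_on (q ` {0..}) (\<lambda>n. f ^^ n)"
    unfolding uniformly_to_infinity_on_def
  proof
    fix R :: real
    obtain n0 where n0: "\<And>n. n0 \<le> n \<Longrightarrow> \<forall>s\<ge>0. R < cmod (\<gamma> n s)"
      using \<gamma>(5)[of R] unfolding eventually_sequentially by blast
    have "R < cmod ((f ^^ n) x)" if "N + n0 \<le> n" "x \<in> q ` {0..}" for n x
    proof -
      have "n = N + (n - N)" "n0 \<le> n - N" using that(1) by auto
      then show ?thesis using orbit[OF that(2), of "n - N"] n0[of "n - N"] by auto
    qed
    then show "\<forall>\<^sub>F n in sequentially. \<forall>w\<in>q ` {0..}. R < cmod ((f ^^ n) w)"
      unfolding eventually_sequentially by blast
  qed
  then show "\<exists>\<gamma>. curve_to_infinity \<gamma> \<and> \<gamma> 0 = z \<and> uniformly_to_infinity_on (\<gamma> ` {0..}) (\<lambda>n. f ^^ n)"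
    using q by blast
qed

end
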